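(* Colored Unit 2-Interval Recognition is NP-complete, even for graphs of degree at most 6.
   Context: A unit 1-interval is a closed interval of length 1; a unit 2-interval is the union of two disjoint unit intervals. Colored Unit 2-Interval Recognition: given a graph $G=(V,E)$ and a coloring $\gamma: V\to\{\texttt{white},\texttt{black}\}$, decide whether $G$ is the intersection graph of a family in which every white vertex is represented by a unit 2-interval and every black vertex by a unit 1-interval (two vertices adjacent iff their representing sets intersect). *)

theory Defs
  imports Complex_Main "HOL-Computational_Algebra.Polynomial"
begin

section \<open>Multi-tape Turing machines\<close>

text \<open>
  Tapes are infinite in both directions. The states of a machine \<open>M\<close> are \<open>0, \<dots>, nstates M\<close>,
  where \<open>0\<close> is initial and \<open>nstates M\<close> is the halting state; the tape symbols are
  \<open>0, \<dots>, nsyms M - 1\<close>, where \<open>0\<close> is the blank and \<open>1\<close>, \<open>2\<close> represent the bits \<open>False\<close>, \<open>True\<close>.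
  Tape \<open>0\<close> carries the input and tape \<open>1\<close> the output. A transition maps the state and the
  symbols scanned by the heads to the new state and, for each tape, the symbol to write and
  the head movement.
\<close>

datatype move = Move_Left | Stay | Move_Right

record machine =
  ntapes :: nat
  nstates :: nat
  nsyms :: nat
  delta :: "nat \<Rightarrow> nat list \<Rightarrow> nat \<times> (nat \<times> move) list"

definition wf_machine :: "machine \<Rightarrow> bool" where
  "wf_machine M \<longleftrightarrow> ntapes M \<ge> 2 \<and> nsyms M \<ge> 3 \<and>
    (\<forall>q < nstates M. \<forall>as. length as = ntapes M \<longrightarrow> set as \<subseteq> {..<nsyms M} \<longrightarrow>
      fst (delta M q as) \<le> nstates M \<and>
      length (snd (delta M q as)) = ntapes M \<and>
      (\<forall>(a, d) \<in> set (snd (delta M q as)). a < nsyms M))"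

type_synonym tape = "(int \<Rightarrow> nat) \<times> int"

type_synonym config = "nat \<times> tape list"

fun move_head :: "move \<Rightarrow> int \<Rightarrow> int" where
  "move_head Move_Left i = i - 1"
| "move_head Stay i = i"
| "move_head Move_Right i = i + 1"

definition scanned :: "tape \<Rightarrow> nat" where
  "scanned tp = fst tp (snd tp)"

definition act :: "nat \<times> move \<Rightarrow> tape \<Rightarrow> tape" where
  "act a tp = ((fst tp)(snd tp := fst a), move_head (snd a) (snd tp))"

definition step :: "machine \<Rightarrow> config \<Rightarrow> config" where
  "step M c = (case c of (q, tps) \<Rightarrow>
     if q < nstates M
     then (let (q', as) = delta M q (map scanned tps) in (q', map2 act as tps))
     else (q, tps))"

definition contents :: "bool list \<Rightarrow> int \<Rightarrow> nat" where
  "contents w i =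
     (if 0 \<le> i \<and> i < int (length w) then (if w ! nat i then 2 else 1) else 0)"

definition initial :: "machine \<Rightarrow> bool list \<Rightarrow> config" where
  "initial M w = (0, (contents w, 0) # replicate (ntapes M - 1) (contents [], 0))"

definition computes_in_time ::
    "machine \<Rightarrow> (bool list \<Rightarrow> bool list) \<Rightarrow> (nat \<Rightarrow> nat) \<Rightarrow> bool" where
  "computes_in_time M f T \<longleftrightarrow>
     (\<forall>w. \<exists>t \<le> T (length w). \<exists>tps.
        (step M ^^ t) (initial M w) = (nstates M, tps) \<and> fst (tps ! 1) = contents (f w))"


section \<open>Polynomial time, NP and completeness\<close>

type_synonym language = "bool list set"

definition poly_time :: "(bool list \<Rightarrow> bool list) \<Rightarrow> bool" where
  "poly_time f \<longleftrightarrow>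
     (\<exists>M (p :: nat poly). wf_machine M \<and> computes_in_time M f (poly p))"

definition in_P :: "language \<Rightarrow> bool" where
  "in_P L \<longleftrightarrow> poly_time (\<lambda>w. [w \<in> L])"

text \<open>A self-delimiting code for pairs: each bit of the first word is preceded by \<open>True\<close>.\<close>

definition pair_code :: "bool list \<Rightarrow> bool list \<Rightarrow> bool list" where
  "pair_code x u = concat (map (\<lambda>b. [True, b]) x) @ False # u"

definition in_NP :: "language \<Rightarrow> bool" where
  "in_NP L \<longleftrightarrow> (\<exists>R (p :: nat poly). in_P R \<and>
     (\<forall>x. x \<in> L \<longleftrightarrow> (\<exists>u. length u \<le> poly p (length x) \<and> pair_code x u \<in> R)))"

definition poly_reducible :: "language \<Rightarrow> language \<Rightarrow> bool" where
  "poly_reducible K L \<longleftrightarrow> (\<exists>f. poly_time f \<and> (\<forall>x. x \<in> K \<longleftrightarrow> f x \<in> L))"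

definition NP_hard :: "language \<Rightarrow> bool" where
  "NP_hard L \<longleftrightarrow> (\<forall>K. in_NP K \<longrightarrow> poly_reducible K L)"

definition NP_complete :: "language \<Rightarrow> bool" where
  "NP_complete L \<longleftrightarrow> in_NP L \<and> NP_hard L"


section \<open>Colored unit 2-interval graphs\<close>

definition simple_graph :: "'a set \<Rightarrow> 'a set set \<Rightarrow> bool" where
  "simple_graph V E \<longleftrightarrow> finite V \<and> E \<subseteq> {e. e \<subseteq> V \<and> card e = 2}"

definition degree_at_most :: "nat \<Rightarrow> 'a set \<Rightarrow> 'a set set \<Rightarrow> bool" where
  "degree_at_most d V E \<longleftrightarrow> (\<forall>v\<in>V. card {e \<in> E. v \<in> e} \<le> d)"

datatype color = White | Black

definition unit_1_interval :: "real set \<Rightarrow> bool" where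
  "unit_1_interval S \<longleftrightarrow> (\<exists>a. S = {a..a + 1})"

definition unit_2_interval :: "real set \<Rightarrow> bool" where
  "unit_2_interval S \<longleftrightarrow>
     (\<exists>I J. unit_1_interval I \<and> unit_1_interval J \<and> I \<inter> J = {} \<and> S = I \<union> J)"

definition intersection_graph :: "'a set \<Rightarrow> 'a set set \<Rightarrow> ('a \<Rightarrow> 'b set) \<Rightarrow> bool" where
  "intersection_graph V E S \<longleftrightarrow>
     (\<forall>u\<in>V. \<forall>v\<in>V. u \<noteq> v \<longrightarrow> ({u, v} \<in> E \<longleftrightarrow> S u \<inter> S v \<noteq> {}))"

definition colored_unit_2_interval_graph ::
    "'a set \<Rightarrow> 'a set set \<Rightarrow> ('a \<Rightarrow> color) \<Rightarrow> bool" where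
  "colored_unit_2_interval_graph V E \<gamma> \<longleftrightarrow>
     (\<exists>S :: 'a \<Rightarrow> real set.
        (\<forall>v\<in>V. \<gamma> v = White \<longrightarrow> unit_2_interval (S v)) \<and>
        (\<forall>v\<in>V. \<gamma> v = Black \<longrightarrow> unit_1_interval (S v)) \<and>
        intersection_graph V E S)"

text \<open>
  Instances have vertex set \<open>{..<n}\<close> and are written as \<open>n\<close> in unary, followed by the
  colors of the vertices and the rows of the adjacency matrix.
\<close>

definition encode :: "nat \<Rightarrow> nat set set \<Rightarrow> (nat \<Rightarrow> color) \<Rightarrow> bool list" where
  "encode n E \<gamma> = replicate n True @ [False] @ map (\<lambda>v. \<gamma> v = Black) [0..<n] @
     concat (map (\<lambda>u. map (\<lambda>v. {u, v} \<in> E) [0..<n]) [0..<n])"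

definition colored_unit_2_interval_recognition :: language where
  "colored_unit_2_interval_recognition =
     {encode n E \<gamma> | n E \<gamma>.
        simple_graph {..<n} E \<and> colored_unit_2_interval_graph {..<n} E \<gamma>}"

definition colored_unit_2_interval_recognition_max_degree :: "nat \<Rightarrow> language" where
  "colored_unit_2_interval_recognition_max_degree d =
     {encode n E \<gamma> | n E \<gamma>.
        simple_graph {..<n} E \<and> degree_at_most d {..<n} E \<and>
        colored_unit_2_interval_graph {..<n} E \<gamma>}"

text \<open>The encoding determines the graph and the coloring of its vertices.\<close>

lemma replicate_True_inj:
  assumes "replicate m True @ False # xs = replicate n True @ False # ys"
  shows "m = n \<and> xs = ys"
  using assms
proof (induction m arbitrary: n)
  case 0
  then show ?case by (cases n) auto
next
  case (Suc m)
  then show ?case by (cases n) auto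
qed

lemma encode_inj:
  assumes eq: "encode n E \<gamma> = encode n' E' \<gamma>'"
    and E: "simple_graph {..<n} E" and E': "simple_graph {..<n'} E'"
  shows "n = n'" "E = E'" "\<forall>v<n. \<gamma> v = \<gamma>' v"
proof -
  let ?C = "\<lambda>n \<gamma>. map (\<lambda>v. \<gamma> v = Black) [0..<n]"
  let ?A = "\<lambda>n E. map (\<lambda>u. map (\<lambda>v. {u, v} \<in> E) [0..<n]) [0..<n]"
  have "replicate n True @ False # (?C n \<gamma> @ concat (?A n E)) =
      replicate n' True @ False # (?C n' \<gamma>' @ concat (?A n' E'))"
    using eq unfolding encode_def append_Cons append_Nil .
  note 1 = replicate_True_inj[OF this]
  then show n: "n = n'" by (rule conjunct1)
  have "?C n \<gamma> @ concat (?A n E) = ?C n \<gamma>' @ concat (?A n E')"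
    using conjunct2[OF 1] unfolding n .
  then have split: "?C n \<gamma> = ?C n \<gamma>' \<and> concat (?A n E) = concat (?A n E')"
    by (rule append_eq_append_conv[OF disjI1, THEN iffD1, rotated]) (simp only: length_map)
  note 2 = conjunct1[OF split] conjunct2[OF split]
  show "\<forall>v<n. \<gamma> v = \<gamma>' v"
  proof (intro allI impI)
    fix v assume "v < n"
    then have "\<gamma> v = Black \<longleftrightarrow> \<gamma>' v = Black" using 2(1) unfolding map_eq_conv by simp
    then show "\<gamma> v = \<gamma>' v" by (metis (full_types) color.exhaust)
  qed
  have "\<forall>(x, y) \<in> set (zip (?A n E) (?A n E')). length x = length y"
    by (auto simp: set_zip)
  then have A: "?A n E = ?A n E'" by (intro concat_injective[OF 2(2)]) simp_all
  have adj: "{u, v} \<in> E \<longleftrightarrow> {u, v} \<in> E'" if "u < n" "v < n" for u v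
  proof -
    have "map (\<lambda>v. {u, v} \<in> E) [0..<n] = map (\<lambda>v. {u, v} \<in> E') [0..<n]"
      using A that(1) unfolding map_eq_conv by simp
    then show ?thesis using that(2) unfolding map_eq_conv by simp
  qed
  have "e \<in> E \<longleftrightarrow> e \<in> E'" if e: "e \<subseteq> {..<n}" "card e = 2" for e
  proof -
    obtain u v where "e = {u, v}" using e(2) unfolding card_2_iff by blast
    then show ?thesis using e(1) adj by simp
  qed
  then show "E = E'" using E E' n unfolding simple_graph_def by blast
qed

end

theory Submission
  imports Defs
begin

text \<open>
  Both directions rest on one notion of computation: expressions built from bounded sums and the input
  bits have polynomially bounded values, and counters that hold these values in unary are just heads of
  a Turing machine. Verifiers and reductions whose output bits are given by such expressions hence run
  in polynomial time.

  The problem is in NP because the left endpoints of a representation can be replaced by small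
  integers, which serve as a certificate.

  For hardness, a computation is described by clauses, and each clause by triangles of literal vertices. In
  a triangle of unit intervals that is realized at one place, the middle interval is covered by the other
  two and has no room for further neighbors; so some member of the triangle must spend a whole interval on
  it. In the gadget of a variable, two positive literals and a negative one compete for room at two
  anchors, such that the negative literal and a positive one cannot both have a whole interval left.
\<close>


section \<open>Counter programs and their implementation by Turing machines\<close>

text \<open>What shapes the gadget is that at the free side of an anchor only the outermost interval
  has room: every inner one is covered by the anchor and the outermost one. Hence two positive
  literals with private tails cannot both have room at one anchor. The second one gets an anchor of
  its own, and the switch carries the outcome over: it shares the tail \<open>8\<close> with literal
  \<open>1\<close>, so that these two can reach out together; if literal \<open>3\<close> covers
  them, then the other interval of the switch must serve \<open>7\<close> and \<open>8\<close>, and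
  in turn covers literal \<open>2\<close>. A gadget thus offers two positive occurrences and one
  negative one. This forces the splitting of wide clauses, with an auxiliary gadget for each
  literal, and the ring of implications that equates the occurrences of a variable. A literal has at
  most four neighbors in its gadget and two in its clause, and the switch has six neighbors; hence
  the degree bound. Since hardness starts from an arbitrary verifier, the tableau itself must be
  written down by a machine; once its entries are expressions with bounded sums, this is a matter of
  closure properties.\<close>

text \<open>
  Register \<open>0\<close> is the head position on the input tape, register \<open>j \<ge> 2\<close> the head position on tape
  \<open>j\<close>. Register \<open>1\<close> is not available, since tape \<open>1\<close> carries the output.
\<close>

datatype test = Pos nat | Bit | Nonblank

datatype com = Skip | Inc nat | Dec nat | Out bool | Seq com com | Cond test com com | While test com

datatype instr = Nop | IncR nat | DecR nat | Emit bool

type_synonym store = "(nat \<Rightarrow> nat) \<times> bool list"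

text \<open>Control is separated from data: the store enters only through the answers to tests, so
  this function can become the transition function of a finite control.\<close>

fun advance :: "(test \<Rightarrow> bool) \<Rightarrow> com \<Rightarrow> com \<times> instr" where
  "advance v Skip = (Skip, Nop)"
| "advance v (Inc r) = (Skip, IncR r)"
| "advance v (Dec r) = (Skip, DecR r)"
| "advance v (Out b) = (Skip, Emit b)"
| "advance v (Seq c d) =
     (if c = Skip then (d, Nop) else (Seq (fst (advance v c)) d, snd (advance v c)))"
| "advance v (Cond b c d) = (if v b then c else d, Nop)"
| "advance v (While b c) = (if v b then Seq c (While b c) else Skip, Nop)"

fun holds :: "bool list \<Rightarrow> store \<Rightarrow> test \<Rightarrow> bool" where
  "holds w s (Pos r) \<longleftrightarrow> fst s r \<noteq> 0"
| "holds w s Bit \<longleftrightarrow> contents w (int (fst s 0)) = 2"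
| "holds w s Nonblank \<longleftrightarrow> contents w (int (fst s 0)) \<noteq> 0"

fun perform :: "instr \<Rightarrow> store \<Rightarrow> store" where
  "perform Nop s = s"
| "perform (IncR r) s = ((fst s)(r := fst s r + 1), snd s)"
| "perform (DecR r) s = ((fst s)(r := fst s r - 1), snd s)"
| "perform (Emit b) s = (fst s, snd s @ [b])"

definition com_step :: "bool list \<Rightarrow> com \<times> store \<Rightarrow> com \<times> store" where
  "com_step w cs = (fst (advance (holds w (snd cs)) (fst cs)),
     perform (snd (advance (holds w (snd cs)) (fst cs))) (snd cs))"

section \<open>Timed executions of programs\<close>

definition runs :: "bool list \<Rightarrow> com \<Rightarrow> store \<Rightarrow> nat \<Rightarrow> store \<Rightarrow> bool" where
  "runs w c s t s' \<longleftrightarrow> (\<exists>n\<le>t. (com_step w ^^ n) (c, s) = (Skip, s'))"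

lemma runs_mono: "runs w c s t s' \<Longrightarrow> t \<le> t' \<Longrightarrow> runs w c s t' s'"
  unfolding runs_def by (meson le_trans)

lemma runs_Skip: "runs w Skip s t s"
  unfolding runs_def by (rule exI[of _ 0]) simp

lemma runs_step:
  assumes "com_step w (c, s) = (c', s')" "runs w c' s' t s''"
  shows "runs w c s (Suc t) s''"
proof -
  obtain n where "n \<le> t" "(com_step w ^^ n) (c', s') = (Skip, s'')"
    using assms(2) unfolding runs_def by auto
  then show ?thesis unfolding runs_def
    by (intro exI[of _ "Suc n"]) (simp add: funpow_Suc_right assms(1) del: funpow.simps)
qed

lemma runs_Inc: "t \<ge> 1 \<Longrightarrow> runs w (Inc r) (f, out) t (f(r := f r + 1), out)"
  using runs_step[of w "Inc r" "(f, out)" Skip "(f(r := f r + 1), out)" 0, OF _ runs_Skip]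
  by (auto simp: com_step_def intro: runs_mono)

lemma runs_Dec: "t \<ge> 1 \<Longrightarrow> runs w (Dec r) (f, out) t (f(r := f r - 1), out)"
  using runs_step[of w "Dec r" "(f, out)" Skip "(f(r := f r - 1), out)" 0, OF _ runs_Skip]
  by (auto simp: com_step_def intro: runs_mono)

lemma runs_Out: "t \<ge> 1 \<Longrightarrow> runs w (Out b) (f, out) t (f, out @ [b])"
  using runs_step[of w "Out b" "(f, out)" Skip "(f, out @ [b])" 0, OF _ runs_Skip]
  by (auto simp: com_step_def intro: runs_mono)

lemma runs_Cond:
  assumes "runs w (if holds w s b then c else d) s t s'" "t' \<ge> Suc t"
  shows "runs w (Cond b c d) s t' s'"
  by (rule runs_mono[OF runs_step[OF _ assms(1)] assms(2)]) (simp add: com_step_def)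

lemma runs_Seq:
  assumes "runs w c s t1 s1" "runs w d s1 t2 s2" "t \<ge> t1 + t2 + 1"
  shows "runs w (Seq c d) s t s2"
proof -
  have *: "(com_step w ^^ n) (c, s) = (Skip, s1) \<Longrightarrow> runs w (Seq c d) s (n + t2 + 1) s2" for n
  proof (induction n arbitrary: c s)
    case 0
    then show ?case
      by (auto intro!: runs_step[OF _ assms(2)] simp: com_step_def)
  next
    case (Suc n)
    show ?case
    proof (cases "c = Skip")
      case True
      \<comment> \<open>\<open>Skip\<close> is a fixed point of the semantics, so a first program
        that ends before its \<open>n\<close> steps are over has already produced
        \<open>s1\<close>.\<close>
      have fixp: "(com_step w ^^ m) (Skip, s) = (Skip, s)" for m
        by (induction m) (auto simp: com_step_def)
      have "s = s1" using Suc.prems True fixp[of "Suc n"] by simp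
      then have "runs w (Seq c d) s (Suc t2) s2"
        using True by (auto intro!: runs_step[OF _ assms(2)] simp: com_step_def)
      then show ?thesis by (rule runs_mono) simp
    next
      case False
      obtain c' s' where cs: "com_step w (c, s) = (c', s')" by (meson surj_pair)
      have "(com_step w ^^ n) (c', s') = (Skip, s1)"
        using Suc.prems cs by (simp add: funpow_Suc_right del: funpow.simps)
      then have "runs w (Seq c' d) s' (n + t2 + 1) s2" by (rule Suc.IH)
      moreover have "com_step w (Seq c d, s) = (Seq c' d, s')"
        using cs False by (auto simp: com_step_def)
      ultimately show ?thesis using runs_step by fastforce
    qed
  qed
  obtain n where "n \<le> t1" "(com_step w ^^ n) (c, s) = (Skip, s1)"
    using assms(1) unfolding runs_def by auto
  then show ?thesis using * assms(3) by (meson runs_mono add_le_mono1 le_trans)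
qed

text \<open>Each round costs two steps more than the body, one for the test and one for discarding
  the finished body; the last summand is the failing test.\<close>

lemma runs_While:
  assumes "\<And>i. i < n \<Longrightarrow> holds w (S i) b \<and> runs w c (S i) t (S (Suc i))"
    and "\<not> holds w (S n) b" and "t' \<ge> (t + 2) * n + 1"
  shows "runs w (While b c) (S 0) t' (S n)"
proof -
  have "runs w (While b c) (S (n - k)) ((t + 2) * k + 1) (S n)" if "k \<le> n" for k
    using that
  proof (induction k)
    case 0
    show ?case using assms(2) runs_step[OF _ runs_Skip, of w "While b c" "S n" "S n" 0]
      by (simp add: com_step_def)
  next
    case (Suc k)
    have i: "n - Suc k < n" "Suc (n - Suc k) = n - k" using Suc.prems by auto
    have "runs w (Seq c (While b c)) (S (n - Suc k)) (t + ((t + 2) * k + 1) + 1) (S n)"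
      using assms(1)[OF i(1)] Suc i(2) by (intro runs_Seq[of w c _ t "S (n - k)"]) auto
    then have "runs w (While b c) (S (n - Suc k)) (Suc (t + ((t + 2) * k + 1) + 1)) (S n)"
      using assms(1)[OF i(1)] by (intro runs_step) (auto simp: com_step_def)
    then show ?case by (rule runs_mono) (simp add: algebra_simps)
  qed
  from this[of n] show ?thesis using assms(3) by (auto intro: runs_mono)
qed

text \<open>The programs that can remain during an execution. This set is finite and closed under
  \<open>advance\<close>; its members become the states of the machine.\<close>

fun residuals :: "com \<Rightarrow> com set" where
  "residuals Skip = {Skip}"
| "residuals (Inc r) = {Inc r, Skip}"
| "residuals (Dec r) = {Dec r, Skip}"
| "residuals (Out b) = {Out b, Skip}"
| "residuals (Seq c d) = (\<lambda>c'. Seq c' d) ` residuals c \<union> residuals d"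
| "residuals (Cond b c d) = insert (Cond b c d) (residuals c \<union> residuals d)"
| "residuals (While b c) =
     insert (While b c) (insert Skip ((\<lambda>c'. Seq c' (While b c)) ` residuals c))"

lemma finite_residuals: "finite (residuals c)"
  by (induction c) auto

lemma self_in_residuals: "c \<in> residuals c"
  by (induction c) auto

lemma Skip_in_residuals: "Skip \<in> residuals c"
  by (induction c) auto

lemma residuals_advance: "d \<in> residuals c \<Longrightarrow> fst (advance v d) \<in> residuals c"
proof (induction c arbitrary: d)
  case (Seq c1 c2)
  then show ?case by (auto simp: self_in_residuals split: if_splits)
next
  case (While b c)
  then show ?case by (auto simp: self_in_residuals split: if_splits)
qed (auto simp: self_in_residuals)

fun regs :: "com \<Rightarrow> nat set" where
  "regs Skip = {}"
| "regs (Inc r) = {r}"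
| "regs (Dec r) = {r}"
| "regs (Out b) = {}"
| "regs (Seq c d) = regs c \<union> regs d"
| "regs (Cond b c d) = (case b of Pos r \<Rightarrow> {r} | _ \<Rightarrow> {}) \<union> regs c \<union> regs d"
| "regs (While b c) = (case b of Pos r \<Rightarrow> {r} | _ \<Rightarrow> {}) \<union> regs c"

lemma regs_residuals: "d \<in> residuals c \<Longrightarrow> regs d \<subseteq> regs c"
  by (induction c arbitrary: d) fastforce+

text \<open>Only the tests on registers that occur in the program have to agree. This allows the
  tests to be answered from the symbols scanned on finitely many tapes.\<close>

lemma advance_cong:
  assumes "\<And>r. r \<in> regs d \<Longrightarrow> v (Pos r) = v' (Pos r)" "v Bit = v' Bit" "v Nonblank = v' Nonblank"
  shows "advance v d = advance v' d"
proof -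
  have b: "v b = v' b" if "\<And>r. b = Pos r \<Longrightarrow> r \<in> regs d" for b
    using assms that by (cases b) auto
  show ?thesis using b
  proof (induction d)
    case (Seq c d)
    have "advance v c = advance v' c" using Seq.prems by (intro Seq.IH(1)) auto
    then show ?case by simp
  qed (force simp: split: test.splits)+
qed

lemma advance_regs:
  "snd (advance v d) = IncR r \<Longrightarrow> r \<in> regs d" "snd (advance v d) = DecR r \<Longrightarrow> r \<in> regs d"
  by (induction d) (auto split: if_splits)

section \<open>The simulating Turing machine\<close>

locale counter_machine =
  fixes prog :: com and K :: nat
  assumes K: "K \<ge> 2" and regs_prog: "regs prog \<subseteq> {..<K} - {1}"
begin

text \<open>The extra state \<open>None\<close> is the initial one, in which the cells \<open>0\<close> get marked.\<close>

definition states :: "com option list" where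
  "states = (SOME xs. hd xs = None \<and> last xs = Some Skip \<and> distinct xs \<and>
     set xs = insert None (Some ` residuals prog))"

text \<open>States are numbered by their positions in this list. A machine starts in state
  \<open>0\<close> and halts in its largest state, so \<open>None\<close> has to come first and
  \<open>Some Skip\<close> last.\<close>

lemma states: "hd states = None" "last states = Some Skip" "distinct states"
  "set states = insert None (Some ` residuals prog)"
proof -
  obtain ys where ys: "set ys = residuals prog - {Skip}" "distinct ys"
    using finite_distinct_list[of "residuals prog - {Skip}"] finite_residuals by auto
  have "\<exists>xs. hd xs = None \<and> last xs = Some Skip \<and> distinct xs \<and>
     set xs = insert None (Some ` residuals prog)"
    using ys Skip_in_residuals[of prog]
    by (intro exI[of _ "None # map Some ys @ [Some Skip]"]) (auto simp: distinct_map image_iff)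
  from someI_ex[OF this] show "hd states = None" "last states = Some Skip" "distinct states"
    "set states = insert None (Some ` residuals prog)" unfolding states_def by auto
qed

definition idx :: "com option \<Rightarrow> nat" where
  "idx x = (LEAST i. i < length states \<and> states ! i = x)"

lemma idx:
  assumes "x \<in> set states"
  shows "idx x < length states" "states ! idx x = x"
proof -
  have "\<exists>i. i < length states \<and> states ! i = x" using assms by (auto simp: in_set_conv_nth)
  from LeastI_ex[OF this] show "idx x < length states" "states ! idx x = x"
    unfolding idx_def by auto
qed

lemma idx_nth: "i < length states \<Longrightarrow> idx (states ! i) = i"
  by (metis idx nth_eq_iff_index_eq nth_mem states(3))

lemma states_nonempty: "states \<noteq> []" using states(4) by auto

lemma idx_None: "idx None = 0"
  using idx_nth[of 0] states(1) states_nonempty by (simp add: hd_conv_nth)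

lemma idx_Skip: "idx (Some Skip) = length states - 1"
  using idx_nth[of "length states - 1"] states(2) states_nonempty by (simp add: last_conv_nth)

text \<open>The mark adds 3 to a symbol. A symbol below 3 therefore means that the head is off cell
  0, that is, that the register is positive, and the residue modulo 3 is the unmarked
  symbol.\<close>

definition sym_test :: "nat list \<Rightarrow> test \<Rightarrow> bool" where
  "sym_test as b = (case b of Pos r \<Rightarrow> as ! r < 3 | Bit \<Rightarrow> as ! 0 mod 3 = 2
     | Nonblank \<Rightarrow> as ! 0 mod 3 \<noteq> 0)"

definition react :: "instr \<Rightarrow> nat list \<Rightarrow> nat \<Rightarrow> nat \<times> move" where
  "react i as j = (case i of
       IncR r \<Rightarrow> (as ! j, if r = j then Move_Right else Stay)
     | DecR r \<Rightarrow> (as ! j, if r = j \<and> as ! j < 3 then Move_Left else Stay)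
     | Emit b \<Rightarrow> if j = 1 then (if b then 2 else 1, Move_Right) else (as ! j, Stay)
     | Nop \<Rightarrow> (as ! j, Stay))"

definition tm :: machine where
  "tm = \<lparr>ntapes = K, nstates = length states - 1, nsyms = 6,
     delta = (\<lambda>q as. case states ! q of
        None \<Rightarrow> (idx (Some prog),
          map (\<lambda>j. (if j \<noteq> 1 \<and> as ! j < 3 then as ! j + 3 else as ! j, Stay)) [0..<K])
      | Some c \<Rightarrow> (idx (Some (fst (advance (sym_test as) c))),
          map (react (snd (advance (sym_test as) c)) as) [0..<K]))\<rparr>"

lemma wf_tm: "wf_machine tm"
proof -
  have "fst (delta tm q as) \<le> nstates tm \<and> length (snd (delta tm q as)) = ntapes tm \<and>
      (\<forall>(a, d) \<in> set (snd (delta tm q as)). a < nsyms tm)"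
    if q: "q < nstates tm" and as: "length as = ntapes tm" "set as \<subseteq> {..<nsyms tm}" for q as
  proof -
    have lt: "as ! j < 6" if "j < K" for j
      using as that nth_mem[of j as] by (fastforce simp: tm_def)
    show ?thesis
    proof (cases "states ! q")
      case None
      have "idx (Some prog) < length states" using idx states(4) self_in_residuals by auto
      then show ?thesis using None lt by (force simp: tm_def)
    next
      case (Some c)
      have "c \<in> residuals prog"
        using Some q nth_mem[of q states] states(4) by (fastforce simp: tm_def)
      then have "idx (Some (fst (advance (sym_test as) c))) < length states"
        using idx states(4) residuals_advance by auto
      then show ?thesis using Some lt
        by (force simp: tm_def react_def split: instr.splits if_splits)
    qed
  qed
  then show ?thesis using K unfolding wf_machine_def by (simp add: tm_def)
qed

definition marked :: "(int \<Rightarrow> nat) \<Rightarrow> int \<Rightarrow> nat" where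
  "marked f = f(0 := f 0 + 3)"

text \<open>The coupling of stores and configurations. Apart from the marks only the output tape is
  ever written to, and its head stands right behind the last bit; on all other tapes the head
  position is the only information.\<close>

definition tapes :: "bool list \<Rightarrow> store \<Rightarrow> tape list" where
  "tapes w s = map (\<lambda>j. if j = 1 then (contents (snd s), int (length (snd s)))
     else (marked (contents (if j = 0 then w else [])), int (fst s j))) [0..<K]"

lemma sym_test_holds:
  assumes "c \<in> residuals prog"
  shows "advance (sym_test (map scanned (tapes w s))) c = advance (holds w s) c"
proof (rule advance_cong)
  fix r assume "r \<in> regs c"
  then have r: "r < K" "r \<noteq> 1" using regs_residuals[OF assms] regs_prog by auto
  have 1: "contents w' i < 3" for w' i by (simp add: contents_def)
  show "sym_test (map scanned (tapes w s)) (Pos r) = holds w s (Pos r)"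
    using r 1 by (auto simp: sym_test_def tapes_def scanned_def marked_def)
next
  have 0: "map scanned (tapes w s) ! 0 = marked (contents w) (int (fst s 0))"
    using K by (simp add: tapes_def scanned_def)
  have 1: "marked (contents w) i mod 3 = contents w i" for i
    by (simp add: marked_def contents_def)
  show "sym_test (map scanned (tapes w s)) Bit = holds w s Bit"
    "sym_test (map scanned (tapes w s)) Nonblank = holds w s Nonblank"
    unfolding sym_test_def by (simp_all add: 0 1)
qed

lemma contents_snoc:
  "(contents w)(int (length w) := (if b then 2 else 1)) = contents (w @ [b])"
  by (auto simp: contents_def fun_eq_iff nth_append)

lemma tm_step:
  assumes c: "c \<in> residuals prog" "c \<noteq> Skip"
  shows "step tm (idx (Some c), tapes w s) =
    (idx (Some (fst (com_step w (c, s)))), tapes w (snd (com_step w (c, s))))"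
proof -
  have mem: "Some c \<in> set states" using c states(4) by auto
  have "idx (Some c) \<noteq> length states - 1"
    using idx_Skip idx[OF mem] idx(2)[of "Some Skip"] states(4) Skip_in_residuals c(2) by (metis imageI insertCI option.inject)
  then have q: "idx (Some c) < nstates tm" using idx(1)[OF mem] by (simp add: tm_def)
  let ?as = "map scanned (tapes w s)"
  let ?a = "advance (holds w s) c"
  have d: "delta tm (idx (Some c)) ?as = (idx (Some (fst ?a)), map (react (snd ?a) ?as) [0..<K])"
    using idx(2)[OF mem] sym_test_holds[OF c(1), of w s] by (simp add: tm_def)
  have len: "length (tapes w s) = K" by (simp add: tapes_def)
  have "act (react (snd ?a) ?as j) (tapes w s ! j) = tapes w (perform (snd ?a) s) ! j"
    if j: "j < K" for j
  proof -
    have as: "?as ! j = scanned (tapes w s ! j)" using j len by simp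
    have mk: "marked (contents w') (int m) < 3 \<longleftrightarrow> m \<noteq> 0" for w' m
      by (simp add: marked_def contents_def)
    have r: "r \<noteq> 1" if "snd ?a = IncR r \<or> snd ?a = DecR r" for r
      using advance_regs[of "holds w s" c r] that regs_residuals[OF c(1)] regs_prog by auto
    show ?thesis
    proof (cases "snd ?a")
      case (DecR r)
      show ?thesis using j as r[of r] DecR mk
        by (auto simp: react_def tapes_def scanned_def act_def of_nat_diff)
    next
      case Nop
      show ?thesis using j as Nop
        by (auto simp: react_def tapes_def scanned_def act_def)
    next
      case (IncR r)
      show ?thesis using j as r[of r] IncR
        by (auto simp: react_def tapes_def scanned_def act_def)
    next
      case (Emit b)
      show ?thesis using j as Emit
        by (auto simp: react_def tapes_def scanned_def act_def contents_snoc[symmetric])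
    qed
  qed
  then have "map2 act (map (react (snd ?a) ?as) [0..<K]) (tapes w s) = tapes w (perform (snd ?a) s)"
    by (intro nth_equalityI) (simp_all add: len, simp add: tapes_def)
  then show ?thesis using q d by (simp add: step_def com_step_def)
qed

lemma tm_initial: "step tm (initial tm w) = (idx (Some prog), tapes w (\<lambda>_. 0, []))"
proof -
  have q: "0 < nstates tm"
    using idx_None idx_Skip idx(2)[of None] idx(2)[of "Some Skip"] states(4) Skip_in_residuals
    by (simp add: tm_def) (metis diff_is_0_eq imageI insertCI linorder_not_less option.distinct(1))
  have s0: "states ! 0 = None" using states(1) states_nonempty by (simp add: hd_conv_nth)
  let ?tps = "(contents w, 0) # replicate (K - 1) (contents [], 0)"
  have nth: "?tps ! j = (contents (if j = 0 then w else []), 0)" if "j < K" for j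
    using that by (cases j) auto
  have len: "length ?tps = K" using K by simp
  have cl: "contents w' i < 3" for w' i by (simp add: contents_def)
  have *: "map2 act (map (\<lambda>j. (if j \<noteq> 1 \<and> map scanned ?tps ! j < 3 then map scanned ?tps ! j + 3
      else map scanned ?tps ! j, Stay)) [0..<K]) ?tps = tapes w (\<lambda>_. 0, [])" (is "?l = ?r")
  proof (rule nth_equalityI)
    show "length ?l = length ?r" using len by (simp add: tapes_def)
    fix j assume "j < length ?l"
    then have j: "j < K" by simp
    then have ms: "map scanned ?tps ! j = contents (if j = 0 then w else []) 0"
      using nth[OF j] nth_map[of j ?tps scanned] len by (simp add: scanned_def)
    have "?l ! j = act (if j \<noteq> 1 then contents (if j = 0 then w else []) 0 + 3
        else contents [] 0, Stay) (contents (if j = 0 then w else []), 0)"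
      using j len ms nth[OF j] cl by (auto simp del: replicate.simps list.map nth_Cons_Suc)
    then show "?l ! j = ?r ! j" using j by (auto simp: tapes_def act_def marked_def)
  qed
  have "ntapes tm = K" "delta tm 0 (map scanned ?tps) = (idx (Some prog),
      map (\<lambda>j. (if j \<noteq> 1 \<and> map scanned ?tps ! j < 3 then map scanned ?tps ! j + 3
      else map scanned ?tps ! j, Stay)) [0..<K])"
    unfolding tm_def using s0 by (simp_all del: list.map)
  then show ?thesis using q unfolding step_def initial_def
    by (simp only: prod.case if_True * Let_def)
qed

text \<open>The simulation is in lock-step, one machine step for each program step; the extra
  \<open>[:1:]\<close> pays for the initial step that marks the cells.\<close>

lemma computes:
  assumes "\<And>w. \<exists>s. runs w prog (\<lambda>_. 0, []) (poly p (length w)) (s, f w)"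
  shows "poly_time f"
proof -
  have "\<exists>t\<le>poly (p + [:1:]) (length w). \<exists>tps. (step tm ^^ t) (initial tm w) = (nstates tm, tps) \<and>
      fst (tps ! 1) = contents (f w)" for w
  proof -
    obtain s n where n: "n \<le> poly p (length w)"
      "(com_step w ^^ n) (prog, (\<lambda>_. 0, [])) = (Skip, (s, f w))"
      using assms[of w] unfolding runs_def by auto
    have fixp: "step tm (idx (Some Skip), tps) = (idx (Some Skip), tps)" for tps
      unfolding step_def using idx_Skip by (simp add: tm_def)
    have "fst ((com_step w ^^ m) (prog, s0)) \<in> residuals prog \<and>
        (step tm ^^ m) (idx (Some prog), tapes w s0) =
        (idx (Some (fst ((com_step w ^^ m) (prog, s0)))), tapes w (snd ((com_step w ^^ m) (prog, s0))))"
      for m s0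
    proof (induction m)
      case 0
      show ?case by (simp add: self_in_residuals)
    next
      case (Suc m)
      obtain c s where cs: "(com_step w ^^ m) (prog, s0) = (c, s)" by (meson surj_pair)
      have c: "c \<in> residuals prog" using Suc cs by simp
      have "fst (com_step w (c, s)) \<in> residuals prog"
        using c residuals_advance by (simp add: com_step_def)
      moreover have "step tm (idx (Some c), tapes w s) =
        (idx (Some (fst (com_step w (c, s)))), tapes w (snd (com_step w (c, s))))"
        using tm_step[OF c] fixp by (cases "c = Skip") (auto simp: com_step_def)
      ultimately show ?case using Suc cs by simp
    qed
    from this[of n "(\<lambda>_. 0, [])"] have
      "(step tm ^^ Suc n) (initial tm w) = (idx (Some Skip), tapes w (s, f w))"
      using n(2) tm_initial by (simp add: funpow_Suc_right del: funpow.simps)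
    moreover have "fst (tapes w (s, f w) ! 1) = contents (f w)" using K by (simp add: tapes_def)
    moreover have "idx (Some Skip) = nstates tm" using idx_Skip by (simp add: tm_def)
    moreover have "Suc n \<le> poly (p + [:1:]) (length w)" using n(1) by simp
    ultimately show ?thesis by metis
  qed
  then show ?thesis unfolding poly_time_def computes_in_time_def using wf_tm by blast
qed

end

lemma poly_time_by_program:
  assumes "1 \<notin> regs c"
    and "\<And>w. \<exists>s. runs w c (\<lambda>_. 0, []) (poly p (length w)) (s, f w)"
  shows "poly_time f"
proof -
  have "finite (regs c)" by (induction c) (auto split: test.splits)
  then obtain K where K: "\<forall>r\<in>regs c. r < K" using finite_nat_set_iff_bounded by auto
  interpret counter_machine c "K + 2"
    by standard (use K assms(1) in auto)
  show ?thesis using computes assms(2) by blast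
qed


section \<open>Expressions with bounded sums\<close>

text \<open>
  The body of a bounded sum sees its index as variable \<open>0\<close>, and the other variables shifted by
  one. All values are polynomially bounded, so that unary counters suffice for the evaluation.
\<close>

datatype exp = Var nat | One | Inp exp | Len | Plus exp exp | Minus exp exp | Sum exp exp

definition bit :: "bool list \<Rightarrow> nat \<Rightarrow> bool" where
  "bit w i \<longleftrightarrow> i < length w \<and> w ! i"

fun eval :: "bool list \<Rightarrow> (nat \<Rightarrow> nat) \<Rightarrow> exp \<Rightarrow> nat" where
  "eval w s (Var i) = s i"
| "eval w s One = 1"
| "eval w s (Inp e) = of_bool (bit w (eval w s e))"
| "eval w s Len = length w"
| "eval w s (Plus a b) = eval w s a + eval w s b"
| "eval w s (Minus a b) = eval w s a - eval w s b"
| "eval w s (Sum a b) = (\<Sum>i<eval w s a. eval w (case_nat i s) b)"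

subsection \<open>Compilation\<close>

abbreviation move_to :: "nat \<Rightarrow> nat \<Rightarrow> com" where
  "move_to k r \<equiv> While (Pos k) (Seq (Dec k) (Inc r))"

abbreviation clear :: "nat \<Rightarrow> com" where
  "clear k \<equiv> While (Pos k) (Dec k)"

text \<open>
  The code adds the value of the expression to register \<open>r\<close>; variable \<open>i\<close> is held in register
  \<open>env i\<close>, and the registers from \<open>k\<close> on are free, that is, zero before and after.
\<close>

fun compile :: "exp \<Rightarrow> (nat \<Rightarrow> nat) \<Rightarrow> nat \<Rightarrow> nat \<Rightarrow> com" where
  "compile (Var i) env k r =
     Seq (While (Pos (env i)) (Seq (Dec (env i)) (Seq (Inc r) (Inc k)))) (move_to k (env i))"
| "compile One env k r = Inc r"
| "compile (Inp e) env k r = Seq (compile e env (k + 1) k) (Seq (move_to k 0)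
     (Seq (Cond Bit (Inc r) Skip) (clear 0)))"
| "compile Len env k r = Seq (While Nonblank (Seq (Inc 0) (Inc r))) (clear 0)"
| "compile (Plus a b) env k r = Seq (compile a env k r) (compile b env k r)"
| "compile (Minus a b) env k r = Seq (compile a env (k + 2) k) (Seq (compile b env (k + 2) (k + 1))
     (Seq (While (Pos (k + 1)) (Seq (Dec (k + 1)) (Dec k))) (move_to k r)))"
| "compile (Sum a b) env k r = Seq (compile a env (k + 1) k)
     (Seq (While (Pos k) (Seq (Dec k)
        (Seq (compile b (case_nat (k + 1) env) (k + 2) r) (Inc (k + 1))))) (clear (k + 1)))"

lemma regs_compile:
  "2 \<le> r \<Longrightarrow> 2 \<le> k \<Longrightarrow> \<forall>i. 2 \<le> env i \<Longrightarrow> 1 \<notin> regs (compile e env k r)"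
proof (induction e arbitrary: env k r)
  case (Var i)
  then have "env i \<noteq> 1" by (metis Suc_1 not_less_eq_eq One_nat_def order_refl)
  then show ?case using Var by auto
next
  case (Sum a b)
  have "\<forall>i. 2 \<le> case_nat (k + 1) env i" using Sum.prems by (auto split: nat.split)
  then have "1 \<notin> regs (compile b (case_nat (k + 1) env) (k + 2) r)"
    using Sum.prems by (intro Sum.IH) auto
  then show ?case using Sum.IH(1)[of k "k + 1" env] Sum.prems by auto
qed auto

section \<open>Polynomial bounds for values and running times\<close>

definition poly_fun :: "(nat \<Rightarrow> nat) \<Rightarrow> bool" where
  "poly_fun g \<longleftrightarrow> (\<exists>p :: nat poly. g = poly p)"

lemma poly_fun_intros:
  "poly_fun (\<lambda>_. c)" "poly_fun (\<lambda>x. x)"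
  "poly_fun g \<Longrightarrow> poly_fun h \<Longrightarrow> poly_fun (\<lambda>x. g x + h x)"
  "poly_fun g \<Longrightarrow> poly_fun h \<Longrightarrow> poly_fun (\<lambda>x. g x * h x)"
proof -
  show "poly_fun (\<lambda>_. c)" unfolding poly_fun_def by (intro exI[of _ "[:c:]"]) auto
  show "poly_fun (\<lambda>x. x)" unfolding poly_fun_def by (intro exI[of _ "[:0, 1:]"]) auto
  assume "poly_fun g" "poly_fun h"
  then obtain p q where pq: "g = poly p" "h = poly q" unfolding poly_fun_def by auto
  show "poly_fun (\<lambda>x. g x + h x)" unfolding poly_fun_def pq by (intro exI[of _ "p + q"]) auto
  show "poly_fun (\<lambda>x. g x * h x)" unfolding poly_fun_def pq by (intro exI[of _ "p * q"]) auto
qed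

lemma poly_fun_compose: "poly_fun g \<Longrightarrow> poly_fun h \<Longrightarrow> poly_fun (\<lambda>x. g (h x))"
proof -
  assume "poly_fun g" "poly_fun h"
  then obtain p q where pq: "g = poly p" "h = poly q" unfolding poly_fun_def by auto
  show ?thesis unfolding poly_fun_def pq
    by (intro exI[of _ "pcompose p q"]) (simp add: poly_pcompose fun_eq_iff)
qed

lemma poly_nat_mono: "a \<le> b \<Longrightarrow> poly (p :: nat poly) a \<le> poly p b"
  by (induction p) (auto intro: add_mono mult_mono)

lemma runs_clear: "t \<ge> 3 * f k + 1 \<Longrightarrow> runs w (clear k) (f, out) t (f(k := 0), out)"
proof -
  assume t: "t \<ge> 3 * f k + 1"
  let ?S = "\<lambda>i. (f(k := f k - i), out)"
  have "runs w (clear k) (?S 0) t (?S (f k))"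
  proof (rule runs_While[where S = ?S and n = "f k"])
    fix i assume "i < f k"
    then show "holds w (?S i) (Pos k) \<and> runs w (Dec k) (?S i) 1 (?S (Suc i))"
      using runs_Dec[of 1 w k "f(k := f k - i)" out] by simp
  qed (use t in auto)
  then show ?thesis by simp
qed

lemma runs_move_to:
  assumes "k \<noteq> r" "t \<ge> 5 * f k + 1"
  shows "runs w (move_to k r) (f, out) t (f(k := 0, r := f r + f k), out)"
proof -
  let ?S = "\<lambda>i. (f(k := f k - i, r := f r + i), out)"
  have "runs w (move_to k r) (?S 0) t (?S (f k))"
  proof (rule runs_While[where S = ?S and n = "f k"])
    fix i assume i: "i < f k"
    have "runs w (Seq (Dec k) (Inc r)) (?S i) 3 (((f(k := f k - i, r := f r + i))(k := f k - i - 1))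
        (r := f r + i + 1), out)"
      using runs_Dec[of 1 w k "f(k := f k - i, r := f r + i)" out] assms(1)
        runs_Inc[of 1 w r "(f(k := f k - i, r := f r + i))(k := f k - i - 1)" out]
      by (intro runs_Seq[of _ _ _ 1 _ _ 1]) auto
    then show "holds w (?S i) (Pos k) \<and> runs w (Seq (Dec k) (Inc r)) (?S i) 3 (?S (Suc i))"
      using i assms(1) by (auto simp: fun_upd_twist)
  qed (use assms in auto)
  then show ?thesis by simp
qed

lemma runs_monus:
  assumes "a \<noteq> b" "t \<ge> 5 * f b + 1"
  shows "runs w (While (Pos b) (Seq (Dec b) (Dec a))) (f, out) t (f(b := 0, a := f a - f b), out)"
proof -
  let ?S = "\<lambda>i. (f(b := f b - i, a := f a - i), out)"
  have "runs w (While (Pos b) (Seq (Dec b) (Dec a))) (?S 0) t (?S (f b))"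
  proof (rule runs_While[where S = ?S and n = "f b"])
    fix i assume i: "i < f b"
    have "runs w (Seq (Dec b) (Dec a)) (?S i) 3 (((f(b := f b - i, a := f a - i))(b := f b - i - 1))
        (a := f a - i - 1), out)"
      using runs_Dec[of 1 w b "f(b := f b - i, a := f a - i)" out] assms(1)
        runs_Dec[of 1 w a "(f(b := f b - i, a := f a - i))(b := f b - i - 1)" out]
      by (intro runs_Seq[of _ _ _ 1 _ _ 1]) auto
    then show "holds w (?S i) (Pos b) \<and> runs w (Seq (Dec b) (Dec a)) (?S i) 3 (?S (Suc i))"
      using i assms(1) by (auto simp: fun_upd_twist)
  qed (use assms in auto)
  then show ?thesis by simp
qed

text \<open>Reading a unary counter destroys it. So \<open>x\<close> is emptied into
  \<open>r\<close> and the scratch register \<open>k\<close> simultaneously and then restored from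
  \<open>k\<close>.\<close>

lemma runs_copy:
  assumes "x \<noteq> r" "x \<noteq> k" "r \<noteq> k" "f k = 0" "t \<ge> 12 * f x + 3"
  shows "runs w (Seq (While (Pos x) (Seq (Dec x) (Seq (Inc r) (Inc k)))) (move_to k x))
    (f, out) t (f(r := f r + f x), out)"
proof -
  let ?S = "\<lambda>i. (f(x := f x - i, r := f r + i, k := f k + i), out)"
  have 1: "runs w (While (Pos x) (Seq (Dec x) (Seq (Inc r) (Inc k)))) (?S 0) (7 * f x + 1) (?S (f x))"
  proof (rule runs_While[where S = ?S and n = "f x"])
    fix i assume i: "i < f x"
    let ?f = "f(x := f x - i, r := f r + i, k := f k + i)"
    have "runs w (Seq (Dec x) (Seq (Inc r) (Inc k))) (?S i) 5
      (((?f(x := f x - i - 1))(r := f r + i + 1))(k := f k + i + 1), out)"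
      using runs_Dec[of 1 w x ?f out] runs_Inc[of 1 w r "?f(x := f x - i - 1)" out]
        runs_Inc[of 1 w k "(?f(x := f x - i - 1))(r := f r + i + 1)" out] assms
      by (intro runs_Seq[of _ _ _ 1 _ _ 3] runs_Seq[of _ _ _ 1 _ _ 1]) auto
    moreover have "((?f(x := f x - i - 1))(r := f r + i + 1))(k := f k + i + 1) =
        f(x := f x - Suc i, r := f r + Suc i, k := f k + Suc i)"
      using assms by (auto simp: fun_eq_iff)
    ultimately show "holds w (?S i) (Pos x) \<and>
        runs w (Seq (Dec x) (Seq (Inc r) (Inc k))) (?S i) 5 (?S (Suc i))"
      using i assms by auto
  qed (use assms in auto)
  let ?f = "f(x := 0, r := f r + f x, k := f x)"
  have 2: "runs w (move_to k x) (?f, out) (5 * f x + 1) (?f(k := 0, x := ?f x + ?f k), out)"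
    using assms by (intro runs_move_to) auto
  have 3: "?f(k := 0, x := ?f x + ?f k) = f(r := f r + f x)" using assms by (auto simp: fun_eq_iff)
  have 4: "?S 0 = (f, out)" "?S (f x) = (?f, out)" using assms by auto
  have 5: "runs w (While (Pos x) (Seq (Dec x) (Seq (Inc r) (Inc k)))) (f, out) (7 * f x + 1) (?f, out)"
    using 1 by (simp only: 4)
  have 6: "runs w (move_to k x) (?f, out) (5 * f x + 1) (f(r := f r + f x), out)"
    using 2 by (simp only: 3)
  have 7: "t \<ge> (7 * f x + 1) + (5 * f x + 1) + 1" using assms(5) by linarith
  show ?thesis using runs_Seq[OF 5 6 7] .
qed

lemma runs_len:
  assumes "r \<noteq> 0" "f 0 = 0" "t \<ge> 8 * length w + 3"
  shows "runs w (Seq (While Nonblank (Seq (Inc 0) (Inc r))) (clear 0))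
    (f, out) t (f(r := f r + length w), out)"
proof -
  let ?S = "\<lambda>i. (f(0 := i, r := f r + i), out)"
  have 1: "runs w (While Nonblank (Seq (Inc 0) (Inc r))) (?S 0) (5 * length w + 1) (?S (length w))"
  proof (rule runs_While[where S = ?S and n = "length w"])
    fix i assume i: "i < length w"
    let ?f = "f(0 := i, r := f r + i)"
    have "runs w (Seq (Inc 0) (Inc r)) (?f, out) 3
        ((?f(0 := ?f 0 + 1))(r := (?f(0 := ?f 0 + 1)) r + 1), out)"
      by (rule runs_Seq[OF runs_Inc[of 1] runs_Inc[of 1]]) simp_all
    moreover have "(?f(0 := ?f 0 + 1))(r := (?f(0 := ?f 0 + 1)) r + 1) = f(0 := Suc i, r := f r + Suc i)"
      using assms(1) by (simp add: fun_eq_iff)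
    moreover have "holds w (?S i) Nonblank" using i assms(1) by (simp add: contents_def)
    ultimately show "holds w (?S i) Nonblank \<and> runs w (Seq (Inc 0) (Inc r)) (?S i) 3 (?S (Suc i))"
      by simp
  qed (use assms in \<open>simp_all add: contents_def\<close>)
  have 2: "runs w (clear 0) (?S (length w)) (3 * length w + 1) (f(r := f r + length w), out)"
    using runs_clear[of "f(0 := length w, r := f r + length w)" 0 "3 * length w + 1" w out] assms
    by (auto simp: fun_upd_twist fun_upd_idem)
  have 3: "?S 0 = (f, out)" using assms by (auto simp: fun_upd_idem)
  show ?thesis by (rule runs_Seq[OF 1[unfolded 3] 2]) (use assms(3) in linarith)
qed

text \<open>The invariant of compiled code. \<open>N\<close> is the single size parameter, bounding
  the input length and all variables. Variables may share a register; in particular, all variables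
  that are irrelevant can be kept in one register that is always zero.\<close>

definition env_ok :: "(nat \<Rightarrow> nat) \<Rightarrow> nat \<Rightarrow> nat \<Rightarrow> nat \<Rightarrow> bool list \<Rightarrow> (nat \<Rightarrow> nat) \<Rightarrow> bool" where
  "env_ok env k r N w f \<longleftrightarrow> length w \<le> N \<and> (\<forall>i. f (env i) \<le> N \<and> 2 \<le> env i \<and> env i < k \<and> env i \<noteq> r)
     \<and> 2 \<le> r \<and> r < k \<and> (\<forall>j\<ge>k. f j = 0) \<and> f 0 = 0"

text \<open>Value and time must be bounded in the same induction: the value of the upper limit of a
  sum is the number of iterations, and the index becomes a variable of the body. This is why the
  bound of the body is taken at \<open>N + g N\<close>.\<close>

lemma compile_correct:
  "\<exists>g. poly_fun g \<and> (\<forall>env k r N w f out. env_ok env k r N w f \<longrightarrow>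
     eval w (\<lambda>i. f (env i)) e \<le> g N \<and>
     runs w (compile e env k r) (f, out) (g N) (f(r := f r + eval w (\<lambda>i. f (env i)) e), out))"
proof (induction e)
  case (Var i)
  show ?case
  proof (intro exI[of _ "\<lambda>N. 12 * N + 3"] conjI allI impI)
    show "poly_fun (\<lambda>N. 12 * N + 3)" by (intro poly_fun_intros)
    fix env k r N w f out assume "env_ok env k r N w f"
    then have e: "f (env i) \<le> N" "env i < k" "env i \<noteq> r" "r < k" "f k = 0"
      unfolding env_ok_def by auto
    have *: "f (env i) \<le> N" "env i < k" "env i \<noteq> r" "r < k" "f k = 0" "env i \<noteq> k" "r \<noteq> k"
      using e by simp_all
    have "12 * f (env i) + 3 \<le> 12 * N + 3" using *(1) by linarith
    note runs_copy[OF *(3) *(6) *(7) *(5) this]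
    then show "runs w (compile (Var i) env k r) (f, out) (12 * N + 3)
        (f(r := f r + eval w (\<lambda>i. f (env i)) (Var i)), out)"
      unfolding compile.simps eval.simps .
    show "eval w (\<lambda>i. f (env i)) (Var i) \<le> 12 * N + 3" unfolding eval.simps using *(1) by linarith
  qed

next
  case One
  show ?case
  proof (intro exI[of _ "\<lambda>N. 1"] conjI allI impI)
    show "poly_fun (\<lambda>N. 1)" by (intro poly_fun_intros)
    fix env k r w f out
    show "eval w (\<lambda>i. f (env i :: nat)) One \<le> 1" by simp
    show "runs w (compile One env k r) (f, out) 1 (f(r := f r + eval w (\<lambda>i. f (env i)) One), out)"
      unfolding compile.simps eval.simps by (rule runs_Inc) simp
  qed
next
  case (Inp e)
  then obtain g where g: "poly_fun g" "\<And>env k r N w f out. env_ok env k r N w f \<Longrightarrow>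
     eval w (\<lambda>i. f (env i)) e \<le> g N \<and>
     runs w (compile e env k r) (f, out) (g N) (f(r := f r + eval w (\<lambda>i. f (env i)) e), out)" by blast
  show ?case
  proof (intro exI[of _ "\<lambda>N. 10 * g N + 20"] conjI allI impI)
    show "poly_fun (\<lambda>N. 10 * g N + 20)" by (intro poly_fun_intros g(1))
    fix env k r N w f out assume ok: "env_ok env k r N w f"
    then have ok': "env_ok env (k + 1) k N w f" unfolding env_ok_def
      by (auto simp: less_Suc_eq) 
    let ?v = "eval w (\<lambda>i. f (env i)) e"
    note ge = g(2)[OF ok', of out]
    have fk: "f k = 0" "f 0 = 0" "k \<noteq> 0" "r \<noteq> 0" "r \<noteq> k" using ok unfolding env_ok_def by auto
    let ?f = "f(k := ?v)"
    have 1: "runs w (compile e env (k + 1) k) (f, out) (g N) (?f, out)" using ge fk by simp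
    have 2: "runs w (move_to k 0) (?f, out) (5 * g N + 1) (?f(k := 0, 0 := ?f 0 + ?f k), out)"
      using ge fk by (intro runs_move_to) auto
    have 3: "?f(k := 0, 0 := ?f 0 + ?f k) = f(0 := ?v)" using fk by (auto simp: fun_eq_iff)
    let ?f1 = "(f(0 := ?v))(r := f r + of_bool (bit w ?v))"
    have 4: "runs w (Cond Bit (Inc r) Skip) (f(0 := ?v), out) 2 (?f1, out)"
    proof (rule runs_Cond[where t = 1])
      have b: "holds w (f(0 := ?v), out) Bit \<longleftrightarrow> bit w ?v" by (auto simp: contents_def bit_def)
      show "runs w (if holds w (f(0 := ?v), out) Bit then Inc r else Skip) (f(0 := ?v), out) 1 (?f1, out)"
        unfolding b using runs_Inc[of 1 w r "f(0 := ?v)" out] fk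
        by (cases "bit w ?v") (auto intro: runs_Skip simp: fun_upd_idem fun_upd_twist)
    qed simp
    have 5: "runs w (clear 0) (?f1, out) (3 * g N + 1) (?f1(0 := 0), out)"
      using ge fk by (intro runs_clear) auto
    have 6: "?f1(0 := 0) = f(r := f r + of_bool (bit w ?v))" using fk by (auto simp: fun_eq_iff)
    show "eval w (\<lambda>i. f (env i)) (Inp e) \<le> 10 * g N + 20" by simp
    show "runs w (compile (Inp e) env k r) (f, out) (10 * g N + 20)
        (f(r := f r + eval w (\<lambda>i. f (env i)) (Inp e)), out)"
      unfolding compile.simps eval.simps
      by (rule runs_Seq[OF 1 runs_Seq[OF 2[unfolded 3] runs_Seq[OF 4 5[unfolded 6] order_refl] order_refl]])
        simp
  qed
next
  case Len
  show ?case
  proof (intro exI[of _ "\<lambda>N. 8 * N + 3"] conjI allI impI)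
    show "poly_fun (\<lambda>N. 8 * N + 3)" by (intro poly_fun_intros)
    fix env k r N w f out assume "env_ok env k r N w f"
    then have *: "r \<noteq> 0" "f 0 = 0" "length w \<le> N" unfolding env_ok_def by auto
    then show "eval w (\<lambda>i. f (env i)) Len \<le> 8 * N + 3" by simp
    show "runs w (compile Len env k r) (f, out) (8 * N + 3)
        (f(r := f r + eval w (\<lambda>i. f (env i)) Len), out)"
      using * unfolding compile.simps eval.simps by (intro runs_len) auto
  qed
next
  case (Plus a b)
  then obtain g h where g: "poly_fun g" "\<And>env k r N w f out. env_ok env k r N w f \<Longrightarrow>
     eval w (\<lambda>i. f (env i)) a \<le> g N \<and>
     runs w (compile a env k r) (f, out) (g N) (f(r := f r + eval w (\<lambda>i. f (env i)) a), out)"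
    and h: "poly_fun h" "\<And>env k r N w f out. env_ok env k r N w f \<Longrightarrow>
     eval w (\<lambda>i. f (env i)) b \<le> h N \<and>
     runs w (compile b env k r) (f, out) (h N) (f(r := f r + eval w (\<lambda>i. f (env i)) b), out)" by blast
  show ?case
  proof (intro exI[of _ "\<lambda>N. g N + h N + 1"] conjI allI impI)
    show "poly_fun (\<lambda>N. g N + h N + 1)" by (intro poly_fun_intros g(1) h(1))
    fix env k r N w f out assume ok: "env_ok env k r N w f"
    let ?f = "f(r := f r + eval w (\<lambda>i. f (env i)) a)"
    have env: "(\<lambda>i. ?f (env i)) = (\<lambda>i. f (env i))" using ok by (auto simp: env_ok_def)
    have ok': "env_ok env k r N w ?f" using ok unfolding env_ok_def by auto
    show "eval w (\<lambda>i. f (env i)) (Plus a b) \<le> g N + h N + 1"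
      using g(2)[OF ok] h(2)[OF ok'] unfolding env by force
    show "runs w (compile (Plus a b) env k r) (f, out) (g N + h N + 1)
        (f(r := f r + eval w (\<lambda>i. f (env i)) (Plus a b)), out)"
      using runs_Seq[OF conjunct2[OF g(2)[OF ok]] conjunct2[OF h(2)[OF ok']], of "g N + h N + 1" out]
      unfolding env by (simp add: add.assoc)
  qed
next
  case (Minus a b)
  then obtain g h where g: "poly_fun g" "\<And>env k r N w f out. env_ok env k r N w f \<Longrightarrow>
     eval w (\<lambda>i. f (env i)) a \<le> g N \<and>
     runs w (compile a env k r) (f, out) (g N) (f(r := f r + eval w (\<lambda>i. f (env i)) a), out)"
    and h: "poly_fun h" "\<And>env k r N w f out. env_ok env k r N w f \<Longrightarrow>
     eval w (\<lambda>i. f (env i)) b \<le> h N \<and>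
     runs w (compile b env k r) (f, out) (h N) (f(r := f r + eval w (\<lambda>i. f (env i)) b), out)" by blast
  show ?case
  proof (intro exI[of _ "\<lambda>N. 6 * g N + 6 * h N + 20"] conjI allI impI)
    show "poly_fun (\<lambda>N. 6 * g N + 6 * h N + 20)" by (intro poly_fun_intros g(1) h(1))
    fix env k r N w f out assume ok: "env_ok env k r N w f"
    let ?a = "eval w (\<lambda>i. f (env i)) a" and ?b = "eval w (\<lambda>i. f (env i)) b"
    have ne: "env i \<noteq> k" "env i \<noteq> Suc k" "r \<noteq> k" "r \<noteq> Suc k" for i
      using ok unfolding env_ok_def by (metis less_irrefl less_Suc_eq)+
    have f0: "f k = 0" "f (Suc k) = 0" using ok unfolding env_ok_def by auto
    have ok1: "env_ok env (k + 2) k N w f" using ok ne unfolding env_ok_def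
      by (auto simp: less_SucI)
    let ?f = "f(k := ?a)"
    have env: "(\<lambda>i. ?f (env i)) = (\<lambda>i. f (env i))" using ne by auto
    have ok2: "env_ok env (k + 2) (k + 1) N w ?f" using ok ne unfolding env_ok_def
      by (auto simp: less_SucI)
    note ga = g(2)[OF ok1, of out] and hb = h(2)[OF ok2, of out, unfolded env]
    let ?f1 = "f(k := ?a, k + 1 := ?b)"
    have 1: "runs w (compile a env (k + 2) k) (f, out) (g N) (?f, out)" using ga f0 by simp
    have 2: "runs w (compile b env (k + 2) (k + 1)) (?f, out) (h N) (?f1, out)" using hb f0 by simp
    have 3: "runs w (While (Pos (k + 1)) (Seq (Dec (k + 1)) (Dec k))) (?f1, out) (5 * h N + 1)
      (?f1(k + 1 := 0, k := ?f1 k - ?f1 (k + 1)), out)"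
      using hb by (intro runs_monus) auto
    have 4: "?f1(k + 1 := 0, k := ?f1 k - ?f1 (k + 1)) = f(k := ?a - ?b)"
      using f0 by (auto simp: fun_eq_iff)
    have 5: "runs w (move_to k r) (f(k := ?a - ?b), out) (5 * g N + 1)
      ((f(k := ?a - ?b))(k := 0, r := (f(k := ?a - ?b)) r + (f(k := ?a - ?b)) k), out)"
      using ga ne by (intro runs_move_to) auto
    have 6: "(f(k := ?a - ?b))(k := 0, r := (f(k := ?a - ?b)) r + (f(k := ?a - ?b)) k) =
      f(r := f r + (?a - ?b))" using f0 ne by (auto simp: fun_eq_iff)
    show "eval w (\<lambda>i. f (env i)) (Minus a b) \<le> 6 * g N + 6 * h N + 20"
      using conjunct1[OF ga] unfolding eval.simps by linarith
    show "runs w (compile (Minus a b) env k r) (f, out) (6 * g N + 6 * h N + 20)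
        (f(r := f r + eval w (\<lambda>i. f (env i)) (Minus a b)), out)"
      unfolding compile.simps eval.simps
      by (rule runs_Seq[OF 1 runs_Seq[OF 2 runs_Seq[OF 3[unfolded 4] 5[unfolded 6] order_refl] order_refl]])
        simp
  qed
next
  case (Sum a b)
  then obtain g h where g: "poly_fun g" "\<And>env k r N w f out. env_ok env k r N w f \<Longrightarrow>
     eval w (\<lambda>i. f (env i)) a \<le> g N \<and>
     runs w (compile a env k r) (f, out) (g N) (f(r := f r + eval w (\<lambda>i. f (env i)) a), out)"
    and h: "poly_fun h" "\<And>env k r N w f out. env_ok env k r N w f \<Longrightarrow>
     eval w (\<lambda>i. f (env i)) b \<le> h N \<and>
     runs w (compile b env k r) (f, out) (h N) (f(r := f r + eval w (\<lambda>i. f (env i)) b), out)" by blast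
  let ?G = "\<lambda>N. g N + (h (N + g N) + 10) * g N + 3 * g N + 20"
  show ?case
  proof (intro exI[of _ ?G] conjI allI impI)
    show "poly_fun ?G" by (intro poly_fun_intros g(1) poly_fun_compose[OF h(1)])
    fix env k r N w f out assume ok: "env_ok env k r N w f"
    let ?s = "\<lambda>i. f (env i)"
    let ?n = "eval w ?s a"
    have ne: "env i \<noteq> k" "env i \<noteq> Suc k" "r \<noteq> k" "r \<noteq> Suc k" "env i \<noteq> r" for i
      using ok unfolding env_ok_def by (metis less_irrefl less_Suc_eq)+
    have f0: "f k = 0" "f (Suc k) = 0" using ok unfolding env_ok_def by auto
    have ok1: "env_ok env (k + 1) k N w f" using ok ne unfolding env_ok_def
      by (auto simp: less_SucI)
    note ga = g(2)[OF ok1, of out]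
    have 1: "runs w (compile a env (k + 1) k) (f, out) (g N) (f(k := ?n), out)" using ga f0 by simp
    define F where "F i = f(k := ?n - i, k + 1 := i, r := f r + (\<Sum>j<i. eval w (case_nat j ?s) b))" for i
    have body: "eval w (case_nat i ?s) b \<le> h (N + g N) \<and>
        runs w (Seq (Dec k) (Seq (compile b (case_nat (k + 1) env) (k + 2) r) (Inc (k + 1))))
         (F i, out) (h (N + g N) + 4) (F (Suc i), out)" if i: "i < ?n" for i
    proof -
      let ?env = "case_nat (k + 1) env"
      let ?F = "(F i)(k := ?n - i - 1)"
      have Fk: "F i k = ?n - i" using ne by (simp add: F_def)
      have s: "(\<lambda>j. ?F (?env j)) = case_nat i ?s"
        using ne by (auto simp: F_def fun_eq_iff split: nat.split)
      have okb: "env_ok ?env (k + 2) r (N + g N) w ?F"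
        using ok ne i ga unfolding env_ok_def F_def by (auto split: nat.split simp: less_SucI trans_le_add1)
      note hb = h(2)[OF okb, of out, unfolded s]
      let ?F2 = "?F(r := ?F r + eval w (case_nat i ?s) b)"
      have d: "runs w (Dec k) (F i, out) 1 (?F, out)" using runs_Dec[of 1 w k "F i" out] Fk by simp
      have j: "runs w (Inc (k + 1)) (?F2, out) 1 (?F2(k + 1 := ?F2 (k + 1) + 1), out)"
        by (rule runs_Inc) simp
      have F: "?F2(k + 1 := ?F2 (k + 1) + 1) = F (Suc i)"
        using ne i by (auto simp: F_def fun_eq_iff)
      have "runs w (Seq (Dec k) (Seq (compile b ?env (k + 2) r) (Inc (k + 1))))
          (F i, out) (h (N + g N) + 4) (?F2(k + 1 := ?F2 (k + 1) + 1), out)"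
        by (rule runs_Seq[OF d runs_Seq[OF conjunct2[OF hb] j order_refl]]) linarith
      then show ?thesis using conjunct1[OF hb] unfolding F by blast
    qed
    let ?c = "Seq (Dec k) (Seq (compile b (case_nat (k + 1) env) (k + 2) r) (Inc (k + 1)))"
    have "runs w (While (Pos k) ?c) (F 0, out) ((h (N + g N) + 6) * g N + 1) (F ?n, out)"
    proof (rule runs_While[where S = "\<lambda>i. (F i, out)" and n = ?n and t = "h (N + g N) + 4"])
      fix i assume "i < ?n"
      moreover have "F i k = ?n - i" using ne by (simp add: F_def)
      ultimately show "holds w (F i, out) (Pos k) \<and>
          runs w ?c (F i, out) (h (N + g N) + 4) (F (Suc i), out)"
        using conjunct2[OF body[of i]] by simp
    next
      have "F ?n k = 0" using ne by (simp add: F_def)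
      then show "\<not> holds w (F ?n, out) (Pos k)" by simp
      have e: "h (N + g N) + 4 + 2 = h (N + g N) + 6" by simp
      show "(h (N + g N) + 4 + 2) * ?n + 1 \<le> (h (N + g N) + 6) * g N + 1"
        unfolding e by (rule add_right_mono[OF mult_le_mono2[OF conjunct1[OF ga]]])
    qed
    moreover have "F 0 = f(k := ?n)" using ne f0 by (auto simp: F_def fun_eq_iff)
    ultimately have 2: "runs w (While (Pos k) ?c) (f(k := ?n), out) ((h (N + g N) + 6) * g N + 1) (F ?n, out)"
      by simp
    have "F ?n (k + 1) = ?n" using ne by (simp add: F_def)
    then have "3 * F ?n (k + 1) + 1 \<le> 3 * g N + 1" using conjunct1[OF ga] by linarith
    then have 3: "runs w (clear (k + 1)) (F ?n, out) (3 * g N + 1) ((F ?n)(k + 1 := 0), out)"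
      by (rule runs_clear)
    have 4: "(F ?n)(k + 1 := 0) = f(r := f r + eval w ?s (Sum a b))"
      using ne f0 by (auto simp: F_def fun_eq_iff)
    have "eval w ?s (Sum a b) \<le> (\<Sum>i<?n. h (N + g N))"
      unfolding eval.simps using body by (intro sum_mono) blast
    also have "\<dots> = ?n * h (N + g N)" by simp
    also have "\<dots> \<le> g N * h (N + g N)" by (rule mult_le_mono1[OF conjunct1[OF ga]])
    also have "\<dots> \<le> ?G N" by (simp add: algebra_simps)
    finally show "eval w ?s (Sum a b) \<le> ?G N" .
    have "g N + ((h (N + g N) + 6) * g N + 1 + (3 * g N + 1) + 1) + 1 \<le> ?G N"
      by (simp add: algebra_simps)
    from runs_Seq[OF 1 runs_Seq[OF 2 3[unfolded 4] order_refl] this]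
    show "runs w (compile (Sum a b) env k r) (f, out) (?G N)
        (f(r := f r + eval w ?s (Sum a b)), out)"
      unfolding compile.simps .
  qed
qed

text \<open>Register \<open>2\<close> stays zero and holds all variables except the index. Register
  \<open>3\<close> counts the output bits still to be written, \<open>4\<close> is the index, and
  \<open>5\<close> receives the value that decides the bit.\<close>

lemma poly_time_map:
  "poly_time (\<lambda>w. map (\<lambda>i. eval w (case_nat i (\<lambda>_. 0)) eb \<noteq> 0) [0..<eval w (\<lambda>_. 0) el])"
proof -
  obtain g h where g: "poly_fun g" "\<And>env k r N w f out. env_ok env k r N w f \<Longrightarrow>
     eval w (\<lambda>i. f (env i)) el \<le> g N \<and>
     runs w (compile el env k r) (f, out) (g N) (f(r := f r + eval w (\<lambda>i. f (env i)) el), out)"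
    and h: "poly_fun h" "\<And>env k r N w f out. env_ok env k r N w f \<Longrightarrow>
     eval w (\<lambda>i. f (env i)) eb \<le> h N \<and>
     runs w (compile eb env k r) (f, out) (h N) (f(r := f r + eval w (\<lambda>i. f (env i)) eb), out)"
    using compile_correct[of el] compile_correct[of eb] by blast
  define body where "body = Seq (Dec 3) (Seq (compile eb (case_nat 4 (\<lambda>_. 2)) 6 5)
    (Seq (Cond (Pos 5) (Out True) (Out False)) (Seq (clear 5) (Inc 4))))"
  define prog where "prog = Seq (compile el (\<lambda>_. 2) 4 3) (While (Pos 3) body)"
  let ?G = "\<lambda>L. g L + ((4 * h (L + g L) + 14) * g L + 1) + 1"
  have "poly_fun ?G"
    by (intro poly_fun_intros g(1) poly_fun_compose[OF h(1)])
  then obtain p where p: "?G = poly p" unfolding poly_fun_def by blast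
  have "1 \<notin> regs (compile eb (case_nat 4 (\<lambda>_. 2)) 6 5)"
    by (rule regs_compile) (auto split: nat.split)
  then have "1 \<notin> regs prog" unfolding prog_def body_def
    using regs_compile[of 3 4 "\<lambda>_. 2" el] by simp
  moreover have "\<exists>s. runs w prog (\<lambda>_. 0, []) (poly p (length w))
      (s, map (\<lambda>i. eval w (case_nat i (\<lambda>_. 0)) eb \<noteq> 0) [0..<eval w (\<lambda>_. 0) el])" for w
  proof -
    let ?L = "length w" and ?n = "eval w (\<lambda>_. 0) el"
    let ?H = "h (?L + g ?L)"
    let ?v = "\<lambda>i. eval w (case_nat i (\<lambda>_. 0)) eb"
    have "env_ok (\<lambda>_. 2) 4 3 ?L w (\<lambda>_. 0)" by (simp add: env_ok_def)
    from g(2)[OF this, of "[]"] have n: "?n \<le> g ?L"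
      and 1: "runs w (compile el (\<lambda>_. 2) 4 3) (\<lambda>_. 0, []) (g ?L) ((\<lambda>_. 0)(3 := ?n), [])" by auto
    define F :: "nat \<Rightarrow> nat \<Rightarrow> nat" where "F i = (\<lambda>_. 0)(3 := ?n - i, 4 := i)" for i
    define S where "S i = (F i, map (\<lambda>i. ?v i \<noteq> 0) [0..<i])" for i
    have 2: "runs w (While (Pos 3) body) (S 0) ((4 * ?H + 14) * g ?L + 1) (S ?n)"
    proof (rule runs_While[where S = S and n = ?n and t = "4 * ?H + 12"])
      fix i assume i: "i < ?n"
      let ?env = "case_nat 4 (\<lambda>_. 2)"
      let ?f = "(F i)(3 := F i 3 - 1)" and ?o = "map (\<lambda>i. ?v i \<noteq> 0) [0..<i]"
      have s: "(\<lambda>j. ?f (?env j)) = case_nat i (\<lambda>_. 0)" by (auto simp: F_def fun_eq_iff split: nat.split)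
      have "env_ok ?env 6 5 (?L + g ?L) w ?f"
        using i n unfolding env_ok_def by (auto simp: F_def split: nat.split)
      note hb = h(2)[OF this, of ?o, unfolded s]
      let ?f1 = "?f(5 := ?f 5 + ?v i)"
      have v: "?f1 5 = ?v i" by (simp add: F_def)
      have c: "runs w (Cond (Pos 5) (Out True) (Out False)) (?f1, ?o) 2 (?f1, ?o @ [?v i \<noteq> 0])"
      proof (rule runs_Cond[where t = 1])
        have "holds w (?f1, ?o) (Pos 5) \<longleftrightarrow> ?v i \<noteq> 0" using v by simp
        then show "runs w (if holds w (?f1, ?o) (Pos 5) then Out True else Out False)
            (?f1, ?o) 1 (?f1, ?o @ [?v i \<noteq> 0])"
          using runs_Out[of 1 w "?v i \<noteq> 0" ?f1 ?o] by (cases "?v i = 0") simp_all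
      qed simp
      have d: "runs w (clear 5) (?f1, ?o @ [?v i \<noteq> 0]) (3 * ?H + 1) (?f1(5 := 0), ?o @ [?v i \<noteq> 0])"
        by (rule runs_clear) (use hb v in linarith)
      have e: "?f1(5 := 0, 4 := (?f1(5 := 0)) 4 + 1) = F (Suc i)"
        using i by (auto simp: F_def fun_eq_iff)
      have "runs w body (F i, ?o) (4 * ?H + 12) (?f1(5 := 0, 4 := (?f1(5 := 0)) 4 + 1), ?o @ [?v i \<noteq> 0])"
        unfolding body_def
        by (rule runs_Seq[OF runs_Dec[OF order_refl] runs_Seq[OF conjunct2[OF hb] runs_Seq[OF c runs_Seq[OF d
            runs_Inc[OF order_refl] order_refl] order_refl] order_refl]]) simp
      then have "runs w body (S i) (4 * ?H + 12) (S (Suc i))" unfolding S_def e by simp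
      moreover have "holds w (S i) (Pos 3)" using i by (simp add: S_def F_def)
      ultimately show "holds w (S i) (Pos 3) \<and> runs w body (S i) (4 * ?H + 12) (S (Suc i))" by simp
    next
      show "\<not> holds w (S ?n) (Pos 3)" by (simp add: S_def F_def)
      have e: "4 * ?H + 12 + 2 = 4 * ?H + 14" by simp
      show "(4 * ?H + 12 + 2) * ?n + 1 \<le> (4 * ?H + 14) * g ?L + 1"
        unfolding e by (rule add_right_mono[OF mult_le_mono2[OF n]])
    qed
    have "S 0 = ((\<lambda>_. 0)(3 := ?n), [])" by (auto simp: S_def F_def fun_eq_iff)
    then have "runs w (While (Pos 3) body) ((\<lambda>_. 0)(3 := ?n), []) ((4 * ?H + 14) * g ?L + 1) (S ?n)"
      using 2 by simp
    from runs_Seq[OF 1 this order_refl] have "runs w prog (\<lambda>_. 0, []) (?G ?L) (S ?n)"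
      unfolding prog_def .
    moreover have "?G ?L = poly p (length w)" using fun_cong[OF p, of ?L] .
    ultimately show ?thesis unfolding S_def by (metis (no_types, lifting))
  qed
  ultimately show ?thesis by (rule poly_time_by_program)
qed

subsection \<open>Definable functions and predicates\<close>

fun rename :: "(nat \<Rightarrow> nat) \<Rightarrow> exp \<Rightarrow> exp" where
  "rename r (Var i) = Var (r i)"
| "rename r One = One"
| "rename r (Inp e) = Inp (rename r e)"
| "rename r Len = Len"
| "rename r (Plus a b) = Plus (rename r a) (rename r b)"
| "rename r (Minus a b) = Minus (rename r a) (rename r b)"
| "rename r (Sum a b) = Sum (rename r a) (rename (case_nat 0 (\<lambda>i. Suc (r i))) b)"

fun substitute :: "(nat \<Rightarrow> exp) \<Rightarrow> exp \<Rightarrow> exp" where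
  "substitute \<sigma> (Var i) = \<sigma> i"
| "substitute \<sigma> One = One"
| "substitute \<sigma> (Inp e) = Inp (substitute \<sigma> e)"
| "substitute \<sigma> Len = Len"
| "substitute \<sigma> (Plus a b) = Plus (substitute \<sigma> a) (substitute \<sigma> b)"
| "substitute \<sigma> (Minus a b) = Minus (substitute \<sigma> a) (substitute \<sigma> b)"
| "substitute \<sigma> (Sum a b) =
     Sum (substitute \<sigma> a) (substitute (case_nat (Var 0) (\<lambda>i. rename Suc (\<sigma> i))) b)"

lemma eval_rename: "eval w s (rename r e) = eval w (\<lambda>i. s (r i)) e"
proof (induction e arbitrary: r s)
  case (Sum a b)
  have "(\<lambda>j. case_nat i s (case_nat 0 (\<lambda>i. Suc (r i)) j)) = case_nat i (\<lambda>i. s (r i))" for i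
    by (auto split: nat.split)
  then show ?case using Sum by simp
qed auto

lemma eval_substitute: "eval w s (substitute \<sigma> e) = eval w (\<lambda>i. eval w s (\<sigma> i)) e"
proof (induction e arbitrary: \<sigma> s)
  case (Sum a b)
  have "(\<lambda>j. eval w (case_nat i s) (case_nat (Var 0) (\<lambda>i. rename Suc (\<sigma> i)) j)) =
    case_nat i (\<lambda>i. eval w s (\<sigma> i))" for i
    by (auto simp: eval_rename split: nat.split)
  then show ?case using Sum by simp
qed auto

definition definable :: "(bool list \<Rightarrow> (nat \<Rightarrow> nat) \<Rightarrow> nat) \<Rightarrow> bool" where
  "definable f \<longleftrightarrow> (\<exists>e. \<forall>w s. f w s = eval w s e)"

definition definable_pred :: "(bool list \<Rightarrow> (nat \<Rightarrow> nat) \<Rightarrow> bool) \<Rightarrow> bool" where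
  "definable_pred P \<longleftrightarrow> definable (\<lambda>w s. of_bool (P w s))"

section \<open>Closure properties\<close>

lemma definable_var: "definable (\<lambda>w s. s i)"
  unfolding definable_def by (rule exI[of _ "Var i"]) simp

lemma definable_len: "definable (\<lambda>w s. length w)"
  unfolding definable_def by (rule exI[of _ Len]) simp

lemma definable_plus: "definable a \<Longrightarrow> definable b \<Longrightarrow> definable (\<lambda>w s. a w s + b w s)"
  unfolding definable_def by (metis eval.simps(5))

lemma definable_minus: "definable a \<Longrightarrow> definable b \<Longrightarrow> definable (\<lambda>w s. a w s - b w s)"
  unfolding definable_def by (metis eval.simps(6))

lemma definable_one: "definable (\<lambda>w s. 1)"
  unfolding definable_def by (rule exI[of _ One]) simp

lemma definable_const: "definable (\<lambda>w s. c)"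
proof (induction c)
  case 0
  show ?case using definable_minus[OF definable_one definable_one] by simp
next
  case (Suc c)
  show ?case using definable_plus[OF Suc definable_one] by simp
qed

lemma definable_sum:
  assumes "definable a" "definable (\<lambda>w s. b (s 0) w (\<lambda>i. s (Suc i)))"
  shows "definable (\<lambda>w s. \<Sum>i<a w s. b i w s)"
proof -
  obtain ea eb where e: "\<And>w s. a w s = eval w s ea"
    "\<And>w s. b (s 0) w (\<lambda>i. s (Suc i)) = eval w s eb"
    using assms unfolding definable_def by metis
  have "eval w (case_nat i s) eb = b i w s" for i w s
    using e(2)[of "case_nat i s" w] by simp
  then show ?thesis unfolding definable_def e(1) by (intro exI[of _ "Sum ea eb"]) simp
qed

text \<open>A function defined by sums can be treated with plain variables as arguments; arbitrary
  arguments are then plugged in without being shifted under the binders each time.\<close>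

lemma definable_substitute:
  assumes "definable f" "\<And>i. definable (a i)"
  shows "definable (\<lambda>w s. f w (\<lambda>i. a i w s))"
proof -
  obtain e \<sigma> where e: "\<And>w s. f w s = eval w s e" "\<And>i w s. a i w s = eval w s (\<sigma> i)"
    using assms unfolding definable_def by metis
  show ?thesis unfolding definable_def e by (intro exI[of _ "substitute \<sigma> e"]) (simp add: eval_substitute)
qed

text \<open>A product is a sum with constant summands.\<close>

lemma definable_times: "definable a \<Longrightarrow> definable b \<Longrightarrow> definable (\<lambda>w s. a w s * b w s)"
proof -
  assume a: "definable a" and "definable b"
  then have "definable (\<lambda>w s. b w (\<lambda>i. s (Suc i)))"
    by (intro definable_substitute[of b "\<lambda>i w s. s (Suc i)"] definable_var)
  from definable_sum[where b = "\<lambda>i. b", OF a this] show ?thesis by simp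
qed

lemma definable_pred_not: "definable_pred P \<Longrightarrow> definable_pred (\<lambda>w s. \<not> P w s)"
proof -
  assume "definable_pred P"
  moreover have "(of_bool (\<not> x) :: nat) = 1 - of_bool x" for x by simp
  ultimately show ?thesis unfolding definable_pred_def
    by (simp only:) (rule definable_minus[OF definable_one])
qed

lemma definable_pred_conj:
  "definable_pred P \<Longrightarrow> definable_pred Q \<Longrightarrow> definable_pred (\<lambda>w s. P w s \<and> Q w s)"
  unfolding definable_pred_def of_bool_conj by (rule definable_times)

lemma definable_pred_disj:
  "definable_pred P \<Longrightarrow> definable_pred Q \<Longrightarrow> definable_pred (\<lambda>w s. P w s \<or> Q w s)"
  using definable_pred_not[OF definable_pred_conj[OF definable_pred_not[of P] definable_pred_not[of Q]]]
  by (simp only: de_Morgan_conj not_not imp_conv_disj)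

lemma definable_pred_imp:
  "definable_pred P \<Longrightarrow> definable_pred Q \<Longrightarrow> definable_pred (\<lambda>w s. P w s \<longrightarrow> Q w s)"
  unfolding imp_conv_disj by (rule definable_pred_disj[OF definable_pred_not])

lemma definable_pred_const: "definable_pred (\<lambda>w s. c)"
  unfolding definable_pred_def by (rule definable_const)

lemma definable_pred_less:
  assumes "definable a" "definable b"
  shows "definable_pred (\<lambda>w s. a w s < b w s)"
proof -
  \<comment> \<open>In truncated subtraction, \<open>1 - (1 - n)\<close> is the indicator of
    \<open>n > 0\<close>.\<close>
  have "of_bool (a w s < b w s) = 1 - (1 - (b w s - a w s))" for w s by auto
  then show ?thesis unfolding definable_pred_def
    using definable_minus[OF definable_one definable_minus[OF definable_one definable_minus[OF assms(2,1)]]]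
    by simp
qed

lemma definable_pred_le: "definable a \<Longrightarrow> definable b \<Longrightarrow> definable_pred (\<lambda>w s. a w s \<le> b w s)"
  unfolding not_less[symmetric] by (rule definable_pred_not[OF definable_pred_less])

lemma definable_pred_eq:
  "definable a \<Longrightarrow> definable b \<Longrightarrow> definable_pred (\<lambda>w s. a w s = b w s)"
  unfolding order_eq_iff by (rule definable_pred_conj[OF definable_pred_le definable_pred_le])

lemma definable_pred_iff:
  "definable_pred P \<Longrightarrow> definable_pred Q \<Longrightarrow> definable_pred (\<lambda>w s. P w s \<longleftrightarrow> Q w s)"
  unfolding iff_conv_conj_imp by (intro definable_pred_conj definable_pred_imp)

lemma definable_pred_ex:
  assumes "definable a" "definable_pred (\<lambda>w s. P (s 0) w (\<lambda>i. s (Suc i)))"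
  shows "definable_pred (\<lambda>w s. \<exists>i<a w s. P i w s)"
proof -
  have "definable_pred (\<lambda>w s. \<not> (\<Sum>i<a w s. of_bool (P i w s) :: nat) = 0)"
    using assms unfolding definable_pred_def[of "\<lambda>w s. P (s 0) w (\<lambda>i. s (Suc i))"]
    by (intro definable_pred_not definable_pred_eq definable_const definable_sum)
  moreover have "(\<exists>i<n. Q i) \<longleftrightarrow> \<not> (\<Sum>i<n. of_bool (Q i) :: nat) = 0" for n :: nat and Q by auto
  ultimately show ?thesis by simp
qed

lemma definable_pred_all:
  assumes "definable a" "definable_pred (\<lambda>w s. P (s 0) w (\<lambda>i. s (Suc i)))"
  shows "definable_pred (\<lambda>w s. \<forall>i<a w s. P i w s)"
proof -
  have "(\<forall>i<n. Q i) \<longleftrightarrow> \<not> (\<exists>i<n. \<not> Q i)" for n :: nat and Q by blast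
  then show ?thesis
    using definable_pred_not[OF definable_pred_ex[where P = "\<lambda>i w s. \<not> P i w s",
        OF assms(1) definable_pred_not[OF assms(2)]]]
    by (simp only:)
qed

lemma definable_if:
  assumes "definable_pred P" "definable a" "definable b"
  shows "definable (\<lambda>w s. if P w s then a w s else b w s)"
proof -
  have "(if P w s then a w s else b w s) =
      of_bool (P w s) * a w s + of_bool (\<not> P w s) * b w s" for w s by simp
  then show ?thesis
    using assms(1) definable_pred_not[OF assms(1)] assms(2,3) unfolding definable_pred_def
    by (simp only:) (intro definable_plus definable_times)
qed

lemma definable_pred_if:
  assumes "definable_pred P" "definable_pred Q" "definable_pred R"
  shows "definable_pred (\<lambda>w s. if P w s then Q w s else R w s)"
  using definable_if[OF assms(1) assms(2,3)[unfolded definable_pred_def]]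
  unfolding definable_pred_def if_distrib[of of_bool] .

lemma definable_of_bool: "definable_pred P \<Longrightarrow> definable (\<lambda>w s. of_bool (P w s))"
  unfolding definable_pred_def .

lemma definable_pred_bit:
  assumes "definable a"
  shows "definable_pred (\<lambda>w s. bit w (a w s))"
proof -
  obtain e where "\<And>w s. a w s = eval w s e" using assms unfolding definable_def by metis
  then show ?thesis unfolding definable_pred_def definable_def by (intro exI[of _ "Inp e"]) simp
qed

lemma definable_Suc: "definable a \<Longrightarrow> definable (\<lambda>w s. Suc (a w s))"
  using definable_plus[OF _ definable_one] by simp

lemma definable_substitute1:
  "definable (\<lambda>w s. f w (s 0)) \<Longrightarrow> definable a \<Longrightarrow> definable (\<lambda>w s. f w (a w s))"
  by (rule definable_substitute[of _ "\<lambda>_. a"])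

lemma definable_substitute2:
  assumes "definable (\<lambda>w s. f w (s 0) (s (Suc 0)))" "definable a" "definable b"
  shows "definable (\<lambda>w s. f w (a w s) (b w s))"
proof -
  have "definable (case_nat a (\<lambda>_. b) i)" for i using assms(2,3) by (cases i) simp_all
  from definable_substitute[where a = "case_nat a (\<lambda>_. b)", OF assms(1) this] show ?thesis by simp
qed

lemma definable_substitute4:
  assumes "definable (\<lambda>w s. f w (s 0) (s (Suc 0)) (s (Suc (Suc 0))) (s (Suc (Suc (Suc 0)))))"
    "definable a" "definable b" "definable c" "definable d"
  shows "definable (\<lambda>w s. f w (a w s) (b w s) (c w s) (d w s))"
proof -
  have "definable (case_nat a (case_nat b (case_nat c (\<lambda>_. d))) i)" for i
    using assms(2-) by (simp split: nat.split)
  from definable_substitute[where a = "case_nat a (case_nat b (case_nat c (\<lambda>_. d)))", OF assms(1) this]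
  show ?thesis by simp
qed

lemma definable_pred_substitute1:
  "definable_pred (\<lambda>w s. P w (s 0)) \<Longrightarrow> definable a \<Longrightarrow> definable_pred (\<lambda>w s. P w (a w s))"
  unfolding definable_pred_def by (rule definable_substitute1)

text \<open>The quotient counts the positive multiples of \<open>b\<close> up to
  \<open>a\<close>.\<close>

lemma div_eq_sum: "a div b = (if b = 0 then 0 else \<Sum>i<a. of_bool (Suc i * b \<le> a))" for a b :: nat
proof (cases "b = 0")
  case False
  then have "Suc i * b \<le> a \<longleftrightarrow> i < a div b" for i
    by (metis Suc_le_eq less_eq_div_iff_mult_less_eq neq0_conv)
  then have "(\<Sum>i<a. of_bool (Suc i * b \<le> a) :: nat) = card ({..<a} \<inter> {..<a div b})"
    by (simp add: of_bool_def sum.If_cases lessThan_def)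
  also have "{..<a} \<inter> {..<a div b} = {..<a div b}" using False
    by (auto intro: less_le_trans)
  finally show ?thesis using False by simp
qed simp

lemma definable_div:
  assumes "definable a" "definable b"
  shows "definable (\<lambda>w s. a w s div b w s)"
proof (rule definable_substitute2[OF _ assms])
  show "definable (\<lambda>w s. s 0 div s (Suc 0))" unfolding div_eq_sum
    by (intro definable_if definable_pred_eq definable_sum definable_of_bool definable_pred_le
      definable_times definable_Suc definable_var definable_const)
qed

lemma definable_mod:
  assumes "definable a" "definable b"
  shows "definable (\<lambda>w s. a w s mod b w s)"
  unfolding minus_div_mult_eq_mod[symmetric] using assms
  by (intro definable_minus definable_times definable_div)

lemmas definable_intros =
  definable_const definable_var definable_len definable_plus definable_minus definable_times
  definable_sum definable_if definable_of_bool definable_Suc definable_div definable_mod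
  definable_pred_const definable_pred_not definable_pred_conj definable_pred_disj definable_pred_imp
  definable_pred_less definable_pred_le definable_pred_eq definable_pred_iff definable_pred_ex
  definable_pred_all definable_pred_if definable_pred_bit

lemma definable_poly: "definable a \<Longrightarrow> definable (\<lambda>w s. poly p (a w s))"
proof (induction p)
  case 0
  show ?case using definable_const[of 0] by simp
next
  case (pCons c p)
  show ?case using definable_plus[OF definable_const definable_times[OF pCons.prems pCons.IH]]
    pCons.prems by simp
qed

text \<open>The assumption is not uniform in \<open>c\<close>: each \<open>f c\<close> may have an
  expression of its own. In this way finite tables such as the list of tableau rules enter
  expressions, which know only numbers and the input.\<close>

lemma definable_cases:
  assumes "definable h" "\<And>c. c < N \<Longrightarrow> definable (f c)"
  shows "definable (\<lambda>w s. if h w s < N then f (h w s) w s else 0)"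
  using assms(2)
proof (induction N)
  case (Suc N)
  have "definable (\<lambda>w s. if h w s = N then f N w s else if h w s < N then f (h w s) w s else 0)"
    by (rule definable_if[OF definable_pred_eq[OF assms(1) definable_const] Suc.prems[OF lessI]])
      (use Suc in simp)
  then show ?case by (rule back_subst[of definable]) (auto simp: fun_eq_iff less_Suc_eq)
qed (auto intro: definable_const)

theorem poly_time_definable:
  assumes "definable l" "definable_pred b"
  shows "poly_time (\<lambda>w. map (\<lambda>i. b w (case_nat i (\<lambda>_. 0))) [0..<l w (\<lambda>_. 0)])"
proof -
  obtain el eb where e: "\<And>w s. l w s = eval w s el" "\<And>w s. of_bool (b w s) = eval w s eb"
    using assms unfolding definable_pred_def definable_def by metis
  have "b w s \<longleftrightarrow> eval w s eb \<noteq> 0" for w s using e(2)[of w s] by (cases "b w s") auto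
  then show ?thesis using poly_time_map[of eb el] unfolding e(1) by simp
qed


section \<open>Unit interval representations by left endpoints\<close>

definition close :: "real \<Rightarrow> real \<Rightarrow> bool" where
  "close x y \<longleftrightarrow> \<bar>x - y\<bar> \<le> 1"

lemma close_sym: "close x y \<longleftrightarrow> close y x"
  unfolding close_def by linarith

lemma close_iff_meet: "close x y \<longleftrightarrow> {x..x + 1} \<inter> {y..y + 1} \<noteq> {}"
  unfolding close_def by auto

text \<open>Both intervals of a vertex are indexed by a boolean, and for a black vertex they
  coincide. Closed unit intervals meet iff their left endpoints are \<open>close\<close>, so the
  disjointness of the parts of a 2-interval is \<open>\<not> close\<close>.\<close>

definition endpoint_rep ::
    "'a set \<Rightarrow> ('a \<Rightarrow> 'a \<Rightarrow> bool) \<Rightarrow> ('a \<Rightarrow> bool) \<Rightarrow> ('a \<Rightarrow> bool \<Rightarrow> real) \<Rightarrow> bool" where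
  "endpoint_rep V adj white L \<longleftrightarrow>
     (\<forall>v\<in>V. if white v then \<not> close (L v False) (L v True) else L v False = L v True) \<and>
     (\<forall>u\<in>V. \<forall>v\<in>V. u \<noteq> v \<longrightarrow> (adj u v \<longleftrightarrow> (\<exists>i j. close (L u i) (L v j))))"

lemma colored_graph_iff_endpoint_rep:
  "colored_unit_2_interval_graph V E \<gamma> \<longleftrightarrow>
     (\<exists>L. endpoint_rep V (\<lambda>u v. {u, v} \<in> E) (\<lambda>v. \<gamma> v = White) L)"
proof
  let ?I = "\<lambda>x :: real. {x..x + 1}"
  assume "colored_unit_2_interval_graph V E \<gamma>"
  then obtain S where S: "\<forall>v\<in>V. \<gamma> v = White \<longrightarrow> unit_2_interval (S v)"
    "\<forall>v\<in>V. \<gamma> v = Black \<longrightarrow> unit_1_interval (S v)" "intersection_graph V E S"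
    unfolding colored_unit_2_interval_graph_def by blast
  have "\<exists>l. S v = ?I (l False) \<union> ?I (l True) \<and>
      (if \<gamma> v = White then \<not> close (l False) (l True) else l False = l True)" if v: "v \<in> V" for v
  proof (cases "\<gamma> v")
    case White
    then obtain a b where "S v = ?I a \<union> ?I b" "?I a \<inter> ?I b = {}"
      using S(1) v unfolding unit_2_interval_def unit_1_interval_def by blast
    then show ?thesis using White close_iff_meet
      by (intro exI[of _ "\<lambda>c. if c then b else a"]) auto
  next
    case Black
    then obtain a where "S v = ?I a" using S(2) v unfolding unit_1_interval_def by blast
    then show ?thesis using Black by (intro exI[of _ "\<lambda>_. a"]) auto
  qed
  then obtain L where L: "\<And>v. v \<in> V \<Longrightarrow> S v = ?I (L v False) \<union> ?I (L v True) \<and>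
      (if \<gamma> v = White then \<not> close (L v False) (L v True) else L v False = L v True)" by metis
  have "S u \<inter> S v \<noteq> {} \<longleftrightarrow> (\<exists>i j. close (L u i) (L v j))" if "u \<in> V" "v \<in> V" for u v
    using L[OF that(1)] L[OF that(2)] unfolding ex_bool_eq close_iff_meet by blast
  then have "endpoint_rep V (\<lambda>u v. {u, v} \<in> E) (\<lambda>v. \<gamma> v = White) L"
    using S(3) L unfolding endpoint_rep_def intersection_graph_def by simp
  then show "\<exists>L. endpoint_rep V (\<lambda>u v. {u, v} \<in> E) (\<lambda>v. \<gamma> v = White) L" by blast
next
  let ?I = "\<lambda>x :: real. {x..x + 1}"
  assume "\<exists>L. endpoint_rep V (\<lambda>u v. {u, v} \<in> E) (\<lambda>v. \<gamma> v = White) L"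
  then obtain L where L: "endpoint_rep V (\<lambda>u v. {u, v} \<in> E) (\<lambda>v. \<gamma> v = White) L" by blast
  define S where "S v = ?I (L v False) \<union> ?I (L v True)" for v
  have "unit_2_interval (S v)" if "v \<in> V" "\<gamma> v = White" for v
    using L that close_iff_meet[of "L v False" "L v True"]
    unfolding endpoint_rep_def unit_2_interval_def unit_1_interval_def S_def by metis
  moreover have "unit_1_interval (S v)" if "v \<in> V" "\<gamma> v = Black" for v
    using L that unfolding endpoint_rep_def unit_1_interval_def S_def by auto
  moreover have "S u \<inter> S v \<noteq> {} \<longleftrightarrow> (\<exists>i j. close (L u i) (L v j))" for u v
    unfolding ex_bool_eq close_iff_meet S_def by blast
  moreover have "\<forall>u\<in>V. \<forall>v\<in>V. u \<noteq> v \<longrightarrow> ({u, v} \<in> E \<longleftrightarrow> (\<exists>i j. close (L u i) (L v j)))"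
    using L unfolding endpoint_rep_def by (rule conjunct2)
  ultimately show "colored_unit_2_interval_graph V E \<gamma>"
    unfolding colored_unit_2_interval_graph_def intersection_graph_def
    by (intro exI[of _ S]) simp
qed


section \<open>The gadgets\<close>

text \<open>
  The vertex \<open>(g, t)\<close> is the vertex of type \<open>t\<close> in gadget \<open>g\<close>. The types \<open>0\<close> (the switch), \<open>1\<close>, \<open>2\<close>
  (positive literals) and \<open>3\<close> (negative literal) are white. The vertices \<open>5\<close> and \<open>7\<close> are anchors:
  one of their sides is used up by \<open>4\<close> and \<open>6\<close>. The literals \<open>1\<close>, \<open>2\<close>, \<open>3\<close> have the private neighbors
  (tails) \<open>8\<close>, \<open>9\<close>, \<open>10\<close>; of these, \<open>8\<close> is also a neighbor of the switch. Type \<open>11\<close> is a dummy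
  literal, which is always false, with tail \<open>12\<close>.
\<close>

definition base_edges :: "(nat \<times> nat) list" where
  "base_edges = [(4, 5), (0, 5), (1, 5), (3, 5), (0, 1), (0, 3), (1, 3), (0, 8), (1, 8),
     (6, 7), (0, 7), (2, 7), (0, 2), (2, 9), (3, 10), (11, 12)]"

definition base :: "nat \<Rightarrow> nat \<Rightarrow> bool" where
  "base a b \<longleftrightarrow> (a, b) \<in> set base_edges \<or> (b, a) \<in> set base_edges"

definition literal :: "nat \<Rightarrow> bool" where
  "literal t \<longleftrightarrow> t = 1 \<or> t = 2 \<or> t = 3 \<or> t = 11"

definition tail :: "nat \<Rightarrow> nat" where
  "tail t = (if t = 1 then 8 else if t = 2 then 9 else if t = 3 then 10 else 12)"

definition lit_true :: "bool \<Rightarrow> nat \<Rightarrow> bool" where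
  "lit_true x t \<longleftrightarrow> (if t = 1 \<or> t = 2 then x else t = 3 \<and> \<not> x)"

lemma base_sym: "base a b \<longleftrightarrow> base b a"
  unfolding base_def by blast

text \<open>As \<open>i\<close> and \<open>j\<close> meet \<open>c\<close> but avoid
  \<open>c0\<close>, both stick out of \<open>c\<close> at the end away from \<open>c0\<close>. The
  neighbor \<open>t\<close> of \<open>i\<close> avoids \<open>c\<close> and \<open>j\<close>, so
  \<open>i\<close> sticks out further, and \<open>j\<close> is covered by \<open>c\<close> and
  \<open>i\<close>.\<close>

lemma anchor:
  assumes "close c0 c" "close i c" "close j c" "\<not> close i c0" "\<not> close j c0"
    "close t i" "\<not> close t c" "\<not> close t j" "close y j"
  shows "close y c \<or> close y i"
proof -
  have iff: "close a b \<longleftrightarrow> a \<le> b + 1 \<and> b \<le> a + 1" for a b unfolding close_def by linarith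
  note a = assms[unfolded iff]
  consider "c0 \<le> c" | "c \<le> c0" by linarith
  then show ?thesis
  proof cases
    case 1
    then have "i > c0 + 1" "j > c0 + 1" using a(1-5) by linarith+
    moreover from this have "t > c + 1" using a 1 by linarith
    moreover from this have "j < i" using a(3,6,8) by linarith
    ultimately show ?thesis using a(1-3,9) unfolding iff by linarith
  next
    case 2
    then have "i < c0 - 1" "j < c0 - 1" using a(1-5) by linarith+
    moreover from this have "t < c - 1" using a 2 by linarith
    moreover from this have "j > i" using a(3,6,8) by linarith
    ultimately show ?thesis using a(1-3,9) unfolding iff by linarith
  qed
qed

text \<open>The middle one of three unit intervals that meet pairwise lies in the union of the others.\<close>

lemma no_three_tails:
  assumes "close x1 x2" "close x1 x3" "close x2 x3" "close x1 t1" "close x2 t2" "close x3 t3"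
    "\<not> close x1 t2" "\<not> close x1 t3" "\<not> close x2 t1" "\<not> close x2 t3" "\<not> close x3 t1" "\<not> close x3 t2"
  shows False
proof -
  have middle: "close x t \<or> close z t" if "close y t" "close x z" "x \<le> y \<and> y \<le> z \<or> z \<le> y \<and> y \<le> x" for x y z t
    using that unfolding close_def by linarith
  consider "x1 \<le> x2 \<and> x2 \<le> x3 \<or> x3 \<le> x2 \<and> x2 \<le> x1" | "x2 \<le> x1 \<and> x1 \<le> x3 \<or> x3 \<le> x1 \<and> x1 \<le> x2"
    | "x1 \<le> x3 \<and> x3 \<le> x2 \<or> x2 \<le> x3 \<and> x3 \<le> x1" by linarith
  then show False
    using middle[OF assms(5,2)] middle[OF assms(4,3)] middle[OF assms(6,1)] assms(7-) by cases blast+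
qed

text \<open>The geometry of a clause region, with \<open>s\<close> the side (\<open>0\<close> for
  the center) and \<open>d\<close> the distance. Literals at distance 5 all meet, even from opposite
  sides, as 5 + 5 = 10; anything at distance at least 13 is too far from the center and from the
  other side.\<close>

lemma two_sides:
  fixes s s' d d' :: int
  assumes "s = 0 \<or> s = 1 \<or> s = - 1" "s' = 0 \<or> s' = 1 \<or> s' = - 1" "s \<noteq> s'"
    "s = 0 \<Longrightarrow> d = 5" "s' = 0 \<Longrightarrow> d' = 5" "d = 5 \<or> 13 \<le> d" "d' = 5 \<or> 13 \<le> d'"
  shows "\<bar>s * d - s' * d'\<bar> \<le> 10 \<longleftrightarrow> d = 5 \<and> d' = 5"
  using assms by (elim disjE) (simp_all add: abs_le_iff)

text \<open>Each literal vertex is assigned to a seat of a clause. Seats are not shared, so a clause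
  has at most three members, and distinct clauses for the literals of a gadget keep the members of a
  clause away from the rest of each other's gadgets.\<close>

locale gadgets =
  fixes G :: nat and clause seat :: "nat \<Rightarrow> nat \<Rightarrow> nat"
  assumes seat_less: "seat g t < 3"
    and seat_inj: "\<And>g t h r. g < G \<Longrightarrow> h < G \<Longrightarrow> literal t \<Longrightarrow> literal r \<Longrightarrow>
      clause g t = clause h r \<Longrightarrow> seat g t = seat h r \<Longrightarrow> (g, t) = (h, r)"
    and clause_distinct: "\<And>g. g < G \<Longrightarrow> clause g 1 \<noteq> clause g 2"
      "\<And>g. g < G \<Longrightarrow> clause g 1 \<noteq> clause g 3" "\<And>g. g < G \<Longrightarrow> clause g 2 \<noteq> clause g 3"
begin

definition mates :: "nat \<times> nat \<Rightarrow> nat \<times> nat \<Rightarrow> bool" where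
  "mates u v \<longleftrightarrow> u \<noteq> v \<and> literal (snd u) \<and> literal (snd v) \<and>
     clause (fst u) (snd u) = clause (fst v) (snd v)"

definition adj :: "nat \<times> nat \<Rightarrow> nat \<times> nat \<Rightarrow> bool" where
  "adj u v \<longleftrightarrow> fst u = fst v \<and> base (snd u) (snd v) \<or> mates u v"

definition vertices :: "(nat \<times> nat) set" where
  "vertices = {..<G} \<times> {..<13}"

definition white :: "nat \<times> nat \<Rightarrow> bool" where
  "white v \<longleftrightarrow> snd v < 4"

text \<open>By \<open>seat_inj\<close> a seat has at most one literal. An empty seat satisfies its
  clause vacuously, so every clause that is meant as a restriction has to be filled up with
  dummies.\<close>

definition satisfied :: "(nat \<Rightarrow> bool) \<Rightarrow> bool" where
  "satisfied val \<longleftrightarrow> (\<forall>c. \<exists>s<3. \<forall>g<G. \<forall>t. literal t \<longrightarrow> clause g t = c \<longrightarrow> seat g t = s \<longrightarrow>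
     lit_true (val g) t)"

lemma mates_sym: "mates u v \<longleftrightarrow> mates v u"
  unfolding mates_def by auto

lemma adj_sym: "adj u v \<longleftrightarrow> adj v u"
  unfolding adj_def using base_sym mates_sym by auto

subsection \<open>From a representation to an assignment\<close>

lemma representation_imp_satisfied:
  assumes L: "endpoint_rep vertices adj white L"
  shows "\<exists>val. satisfied val"
proof -
  have adj: "adj u v \<longleftrightarrow> (\<exists>i j. close (L u i) (L v j))" if "u \<in> vertices" "v \<in> vertices" "u \<noteq> v" for u v
    using L that unfolding endpoint_rep_def by blast
  have black: "L v True = L v False" if "v \<in> vertices" "\<not> white v" for v
    using L that unfolding endpoint_rep_def by auto
  define P where "P v = L v False" for v
  \<comment> \<open>A blocked literal serves its tail and all its mates with one and the same
    interval. This is the geometric form of being false.\<close>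
  define blocked where "blocked v \<longleftrightarrow> (\<exists>x\<in>range (L v). close x (P (fst v, tail (snd v))) \<and>
    (\<forall>u\<in>vertices. mates v u \<longrightarrow> (\<forall>k j. close (L v k) (L u j) \<longrightarrow> L v k = x)))" for v
  have gadget: "blocked (g, 1) \<and> blocked (g, 2) \<or> blocked (g, 3)" if g: "g < G" for g
  proof (rule disjCI)
    assume nb: "\<not> blocked (g, 3)"
    have V: "(g, t) \<in> vertices" if "t < 13" for t using g that by (simp add: vertices_def)
    have local_adj: "adj (g, a) (g, b) \<longleftrightarrow> base a b" if "\<not> literal a \<or> \<not> literal b" for a b
      using that by (auto simp: adj_def mates_def)
    have Pb: "L (g, t) i = P (g, t)" if "4 \<le> t" "t < 13" for t i
      using black[OF V[OF that(2)]] that by (cases i) (auto simp: P_def white_def)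
    have near: "\<exists>i. close (L (g, a) i) (P (g, b))"
      if "a < 13" "4 \<le> b" "b < 13" "base a b" "a \<noteq> b" for a b
      using adj[OF V[OF that(1)] V[OF that(3)]] that Pb[OF that(2,3)] by (auto simp: adj_def)
    have far: "\<not> close (L (g, a) i) (P (g, b))"
      if "a < 13" "4 \<le> b" "b < 13" "\<not> base a b" "a \<noteq> b" "\<not> literal b" for a b i
      using adj[OF V[OF that(1)] V[OF that(3)]] that local_adj unfolding P_def by blast
    \<comment> \<open>A mate of literal \<open>a\<close> lies in the clause of \<open>a\<close>,
      which contains no other literal \<open>1\<close>, \<open>2\<close> or \<open>3\<close> of the
      gadget, so it is adjacent to none of the vertices \<open>b\<close> considered here.\<close>
    have mate_far: "\<not> close (L u j) (L (g, b) i)"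
      if u: "u \<in> vertices" "mates (g, a) u" and ab: "a = 1 \<or> a = 2 \<or> a = 3" "b < 13" "a \<noteq> b"
        and b: "b = 1 \<or> b = 2 \<or> b = 3 \<or> \<not> literal b"
        and nonadj: "\<And>t. literal t \<Longrightarrow> base t b \<Longrightarrow> t \<in> {1, 2, 3}" for u a b i j
    proof -
      obtain h t where ht: "u = (h, t)" by fastforce
      have t: "literal t" "clause g a = clause h t" "(g, a) \<noteq> (h, t)" using u(2) ht by (auto simp: mates_def)
      have ne: "clause g x \<noteq> clause g y" if "x = 1 \<or> x = 2 \<or> x = 3" "y = 1 \<or> y = 2 \<or> y = 3" "x \<noteq> y" for x y
        using clause_distinct[OF g] that by metis
      have "\<not> (h = g \<and> base t b)"
        using ne[OF ab(1)] t nonadj[OF t(1)] by blast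
      moreover have "u \<noteq> (g, b)" using t ht ne[OF ab(1)] b ab(3) by blast
      moreover have "\<not> mates u (g, b)" unfolding mates_def using t(2) ht ne[OF ab(1), of b] b ab(3)
        by auto
      ultimately have "\<not> adj u (g, b)" unfolding adj_def ht by auto
      then show ?thesis using adj[OF u(1) V[OF ab(2)]] \<open>u \<noteq> (g, b)\<close> by blast
    qed
    note ev = base_def base_edges_def literal_def
    have c45: "close (P (g, 4)) (P (g, 5))" using near[of 4 5] Pb[of 4] by (simp add: ev)
    have c67: "close (P (g, 6)) (P (g, 7))" using near[of 6 7] Pb[of 6] by (simp add: ev)
    obtain i where i: "close (L (g, 3) i) (P (g, 10))" using near[of 3 10] by (auto simp: ev)
    \<comment> \<open>Literal \<open>3\<close> is not blocked: with its interval other than the one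
      on its tail it meets some mate \<open>u\<close>.\<close>
    obtain u k j where u: "u \<in> vertices" "mates (g, 3) u" "close (L (g, 3) k) (L u j)" "L (g, 3) k \<noteq> L (g, 3) i"
      using nb i unfolding blocked_def by (force simp: tail_def)
    obtain k' where k': "close (L (g, 3) k') (P (g, 5))" using near[of 3 5] by (auto simp: ev)
    \<comment> \<open>Whichever interval of literal \<open>3\<close> stands at the anchor
      \<open>5\<close>, it has a neighbor further out, the tail or the mate \<open>u\<close>. This
      is the \<open>t\<close> of the lemma \<open>anchor\<close>.\<close>
    have "\<exists>t. close t (L (g, 3) k') \<and> \<not> close t (P (g, 5)) \<and>
        (\<forall>i. \<not> close t (L (g, 0) i)) \<and> (\<forall>i. \<not> close t (L (g, 1) i))"
    proof (cases "k' = i")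
      case True
      have "\<not> close (P (g, 10)) (P (g, 5))" using far[of 10 5] Pb[of 10] by (simp add: ev)
      moreover have "\<not> close (P (g, 10)) (L (g, 0) i)" "\<not> close (P (g, 10)) (L (g, 1) i)" for i
        using far[of 0 10] far[of 1 10] close_sym by (simp_all add: ev)
      ultimately show ?thesis using i True close_sym by blast
    next
      case False
      then have "k' = k" using u(4) by (cases k; cases k'; cases i) auto
      moreover have "\<not> close (L u j) (P (g, 5))" unfolding P_def
        by (rule mate_far[OF u(1,2)]) (auto simp: ev)
      moreover have "\<not> close (L u j) (L (g, 0) i)" "\<not> close (L u j) (L (g, 1) i)" for i
        by (rule mate_far[OF u(1,2)]; auto simp: ev)+
      ultimately show ?thesis using u(3) close_sym by blast
    qed
    then obtain t where t: "close t (L (g, 3) k')" "\<not> close t (P (g, 5))"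
        "\<And>i. \<not> close t (L (g, 0) i)" "\<And>i. \<not> close t (L (g, 1) i)" by blast
    have n4: "\<not> close (L (g, a) i) (P (g, 4))" if "a = 0 \<or> a = 1 \<or> a = 3" for a i
      using far[of a 4 i] that by (auto simp: ev)
    \<comment> \<open>The intervals of the switch and of literal \<open>1\<close> at this anchor are
      thus covered by the anchor and literal \<open>3\<close>, and are lost for tails, for mates and
      for the second anchor.\<close>
    have inner: "close y (P (g, 5)) \<or> close y (L (g, 3) k')"
      if "a = 0 \<or> a = 1" "close (L (g, a) b) (P (g, 5))" "close y (L (g, a) b)" for a b y
      using anchor[OF c45 k' that(2) n4 n4 t(1,2) _ that(3)] that(1) t(3,4) by blast
    have "blocked (g, 1)"
    proof -
      obtain a where a: "close (L (g, 1) a) (P (g, 8))" using near[of 1 8] by (auto simp: ev)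
      obtain b where b: "close (L (g, 1) b) (P (g, 5))" using near[of 1 5] by (auto simp: ev)
      have "\<not> close (P (g, 8)) (P (g, 5))" using far[of 8 5] Pb[of 8] by (simp add: ev)
      moreover have "\<not> close (P (g, 8)) (L (g, 3) k')" using far[of 3 8] close_sym by (simp add: ev)
      ultimately have ab: "a \<noteq> b" using inner[of 1 b "P (g, 8)"] a b close_sym by blast
      have "L (g, 1) k = L (g, 1) a" if "u \<in> vertices" "mates (g, 1) u" "close (L (g, 1) k) (L u j)" for u k j
      proof -
        have "\<not> close (L u j) (P (g, 5))" unfolding P_def
          by (rule mate_far[OF that(1,2)]) (auto simp: ev)
        moreover have "\<not> close (L u j) (L (g, 3) k')"
          by (rule mate_far[OF that(1,2)]) (auto simp: ev)
        ultimately have "k \<noteq> b" using inner[of 1 b "L u j"] b that(3) close_sym by blast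
        then show ?thesis using ab by (cases k; cases a; cases b) auto
      qed
      then show ?thesis unfolding blocked_def using a by (auto simp: tail_def)
    qed
    moreover have "blocked (g, 2)"
    proof -
      obtain b where b: "close (L (g, 0) b) (P (g, 5))" using near[of 0 5] by (auto simp: ev)
      \<comment> \<open>The covered interval of the switch reaches neither \<open>7\<close> nor
        \<open>8\<close>, so the other one must reach both. At the anchor \<open>7\<close> it now
        has the role that literal \<open>3\<close> has at \<open>5\<close>, with \<open>8\<close> as
        its outer neighbor.\<close>
      have other: "close (L (g, 0) (\<not> b)) (P (g, c))" if c: "c = 7 \<or> c = 8" for c
      proof -
        obtain i where i: "close (L (g, 0) i) (P (g, c))" using near[of 0 c] c by (auto simp: ev)
        have "\<not> close (P (g, c)) (P (g, 5))" using far[of c 5] Pb[of c] c by (auto simp: ev)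
        moreover have "\<not> close (P (g, c)) (L (g, 3) k')" using far[of 3 c] c close_sym by (auto simp: ev)
        ultimately have "i \<noteq> b" using inner[of 0 b "P (g, c)"] i b close_sym by blast
        then have "i = (\<not> b)" by auto
        then show ?thesis using i by simp
      qed
      obtain c where c: "close (L (g, 2) c) (P (g, 7))" using near[of 2 7] by (auto simp: ev)
      have inner': "close y (P (g, 7)) \<or> close y (L (g, 0) (\<not> b))" if "close y (L (g, 2) c)" for y
      proof (rule anchor[OF c67 other c])
        show "\<not> close (L (g, 0) (\<not> b)) (P (g, 6))" using far[of 0 6] by (simp add: ev)
        show "\<not> close (L (g, 2) c) (P (g, 6))" using far[of 2 6] by (simp add: ev)
        show "close (P (g, 8)) (L (g, 0) (\<not> b))" using other[of 8] close_sym by simp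
        show "\<not> close (P (g, 8)) (P (g, 7))" using far[of 8 7] Pb[of 8] by (simp add: ev)
        show "\<not> close (P (g, 8)) (L (g, 2) c)" using far[of 2 8] close_sym by (simp add: ev)
      qed (use that in auto)
      obtain a where a: "close (L (g, 2) a) (P (g, 9))" using near[of 2 9] by (auto simp: ev)
      have "\<not> close (P (g, 9)) (P (g, 7))" using far[of 9 7] Pb[of 9] by (simp add: ev)
      moreover have "\<not> close (P (g, 9)) (L (g, 0) (\<not> b))" using far[of 0 9] close_sym by (simp add: ev)
      ultimately have ac: "a \<noteq> c" using inner'[of "P (g, 9)"] a close_sym by blast
      have "L (g, 2) k = L (g, 2) a" if "u \<in> vertices" "mates (g, 2) u" "close (L (g, 2) k) (L u j)" for u k j
      proof -
        have "\<not> close (L u j) (P (g, 7))" unfolding P_def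
          by (rule mate_far[OF that(1,2)]) (auto simp: ev)
        moreover have "\<not> close (L u j) (L (g, 0) (\<not> b))"
          by (rule mate_far[OF that(1,2)]) (auto simp: ev)
        ultimately have "k \<noteq> c" using inner'[of "L u j"] that(3) close_sym by blast
        then show ?thesis using ac by (cases k; cases a; cases c) auto
      qed
      then show ?thesis unfolding blocked_def using a by (auto simp: tail_def)
    qed
    ultimately show "blocked (g, 1) \<and> blocked (g, 2)" ..
  qed
  \<comment> \<open>If the negative literal is blocked, the variable may be true; otherwise both
    positive literals are blocked and it is false. In both cases all false literals are blocked. A
    dummy is black and so has only one interval to offer.\<close>
  define val where "val g \<longleftrightarrow> blocked (g, 3)" for g
  have false_blocked: "blocked (g, t)" if g: "g < G" and "literal t" "\<not> lit_true (val g) t" for g t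
  proof (cases "t = 11")
    case True
    have V: "(g, 11) \<in> vertices" "(g, 12) \<in> vertices" using g by (auto simp: vertices_def)
    have b: "L (g, 11) i = P (g, 11)" "L (g, 12) i = P (g, 12)" for i
      using black[OF V(1)] black[OF V(2)] by (cases i; simp add: P_def white_def)+
    have "adj (g, 11) (g, 12)" by (simp add: adj_def base_def base_edges_def)
    then have "close (P (g, 11)) (P (g, 12))" using adj[OF V] b by auto
    then show ?thesis unfolding blocked_def True using b by (auto simp: tail_def)
  next
    case False
    then show ?thesis using that(2,3) gadget[OF g] unfolding literal_def lit_true_def val_def
      by (auto split: if_splits)
  qed
  have "satisfied val" unfolding satisfied_def
  proof (rule allI, rule ccontr)
    fix c assume "\<not> (\<exists>s<3. \<forall>g<G. \<forall>t. literal t \<longrightarrow> clause g t = c \<longrightarrow> seat g t = s \<longrightarrow> lit_true (val g) t)"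
    \<comment> \<open>In an unsatisfied clause every seat has a false, hence blocked literal. Their
      blocked intervals meet pairwise, and each meets a tail of its own, which contradicts
      \<open>no_three_tails\<close>.\<close>
    then have "\<forall>s<3. \<exists>l. fst l < G \<and> literal (snd l) \<and> clause (fst l) (snd l) = c \<and>
        seat (fst l) (snd l) = s \<and> \<not> lit_true (val (fst l)) (snd l)" by fastforce
    then obtain l where l: "\<And>s :: nat. s < 3 \<Longrightarrow> fst (l s) < G" "\<And>s. s < 3 \<Longrightarrow> literal (snd (l s))"
      "\<And>s. s < 3 \<Longrightarrow> clause (fst (l s)) (snd (l s)) = c" "\<And>s. s < 3 \<Longrightarrow> seat (fst (l s)) (snd (l s)) = s"
      "\<And>s. s < 3 \<Longrightarrow> \<not> lit_true (val (fst (l s))) (snd (l s))" by metis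
    have V: "l s \<in> vertices" if "s < 3" for s
      using l(1,2)[OF that] by (cases "l s") (auto simp: vertices_def literal_def)
    have ne: "l s \<noteq> l r" if "s < 3" "r < 3" "s \<noteq> r" for s r
      using l(4) that by metis
    have m: "mates (l s) (l r)" if "s < 3" "r < 3" "s \<noteq> r" for s r
      using ne[OF that] l that unfolding mates_def by simp
    have "\<forall>s<3. blocked (l s)" using false_blocked l by (metis prod.collapse)
    then obtain x where x: "\<And>s. s < 3 \<Longrightarrow> close (x s) (P (fst (l s), tail (snd (l s))))"
      "\<And>s u k j. s < 3 \<Longrightarrow> u \<in> vertices \<Longrightarrow> mates (l s) u \<Longrightarrow> close (L (l s) k) (L u j) \<Longrightarrow> L (l s) k = x s"
      "\<And>s. s < 3 \<Longrightarrow> x s \<in> range (L (l s))"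
      unfolding blocked_def by metis
    have meet: "close (x s) (x r)" if "s < 3" "r < 3" "s \<noteq> r" for s r
    proof -
      note iff = adj[OF V[OF that(1)] V[OF that(2)] ne[OF that]]
      have "adj (l s) (l r)" using m[OF that] by (simp add: adj_def)
      then obtain k j where kj: "close (L (l s) k) (L (l r) j)"
        using iff by blast
      have "L (l s) k = x s" by (rule x(2)[OF that(1) V[OF that(2)] m[OF that] kj])
      moreover have "L (l r) j = x r"
        using x(2)[OF that(2) V[OF that(1)] m[OF that(2,1) that(3)[symmetric]]] kj close_sym by blast
      ultimately show ?thesis using kj by simp
    qed
    have far: "\<not> close (x s) (P (fst (l r), tail (snd (l r))))" if "s < 3" "r < 3" "s \<noteq> r" for s r
    proof -
      let ?t = "(fst (l r), tail (snd (l r)))"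
      note range = x(3)[OF that(1)]
      have tV: "?t \<in> vertices" using l(1,2)[OF that(2)] by (auto simp: vertices_def tail_def)
      have "\<not> literal (tail (snd (l r)))" using l(2)[OF that(2)] by (auto simp: literal_def tail_def)
      moreover have "literal a \<Longrightarrow> literal b \<Longrightarrow> base a (tail b) \<Longrightarrow> a = b" for a b
        unfolding literal_def by (auto simp: tail_def base_def base_edges_def)
      ultimately have "\<not> adj (l s) ?t" "l s \<noteq> ?t"
        using l(2)[OF that(1)] l(2)[OF that(2)] ne[OF that] unfolding adj_def mates_def
        by (auto simp: prod_eq_iff)
      moreover obtain i where "x s = L (l s) i" using range by auto
      ultimately show ?thesis using adj[OF V[OF that(1)] tV] unfolding P_def by auto
    qed
    show False
      by (rule no_three_tails[OF meet[of 0 1] meet[of 0 2] meet[of 1 2] x(1)[of 0] x(1)[of 1] x(1)[of 2]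
          far[of 0 1] far[of 0 2] far[of 1 0] far[of 1 2] far[of 2 0] far[of 2 1]]) simp_all
  qed
  then show ?thesis by blast
qed


subsection \<open>From an assignment to a representation\<close>

text \<open>
  All coordinates are integers, and intervals have length \<open>10\<close>. A placement \<open>(0, x)\<close> is the
  position \<open>x\<close> in a region that belongs to the gadget, and \<open>(t, x)\<close> with a literal type \<open>t\<close> is the
  position at distance \<open>x\<close> from the center of the region of the clause of literal \<open>t\<close>; the literal
  itself is at distance \<open>5\<close>. The center is taken by a true literal, and the other two members of
  the clause go to its two sides.
\<close>

definition placements :: "bool \<Rightarrow> ((nat \<times> int) \<times> (nat \<times> int)) list" where
  "placements x = (if x
     then [((0, 16), (0, 111)), ((0, 16), (1, 5)), ((0, 116), (2, 5)), ((0, 11), (3, 5)),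
       ((0, 0), (0, 0)), ((0, 8), (0, 8)), ((0, 100), (0, 100)), ((0, 108), (0, 108)),
       ((0, 24), (0, 24)), ((0, 124), (0, 124)), ((3, 13), (3, 13)), ((11, 5), (11, 5)), ((11, 13), (11, 13))]
     else [((0, 11), (1, 21)), ((0, 11), (1, 5)), ((1, 26), (2, 5)), ((0, 16), (3, 5)),
       ((0, 0), (0, 0)), ((0, 8), (0, 8)), ((1, 37), (1, 37)), ((1, 29), (1, 29)),
       ((1, 13), (1, 13)), ((2, 13), (2, 13)), ((0, 24), (0, 24)), ((11, 5), (11, 5)), ((11, 13), (11, 13))])"

text \<open>The constants in the list come from chains with step 8, such as 0, 8, 16, 24, where
  exactly consecutive intervals meet. An anchor at 8, blocked at 0, has an outer place 16, which
  meets 24, and an inner place 11, which meets 8 and 16 but neither 0 nor 24. For a true variable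
  the second anchor has a copy shifted by 100. For a false one it is the mirrored chain 37, 29, 21,
  13, 5 in the region of literal \<open>1\<close>, with inner place 26: there the tail
  \<open>8\<close> at 13 links the switch at 21 with literal \<open>1\<close> at 5.\<close>

definition placement :: "bool \<Rightarrow> nat \<Rightarrow> bool \<Rightarrow> nat \<times> int" where
  "placement x t i = (if i then snd (placements x ! t) else fst (placements x ! t))"

lemma all_less_13: "(\<forall>t<13. Q t) \<longleftrightarrow> Q 0 \<and> Q 1 \<and> Q 2 \<and> Q 3 \<and> Q 4 \<and> Q 5 \<and> Q 6 \<and> Q 7 \<and> Q 8
    \<and> Q 9 \<and> Q 10 \<and> Q 11 \<and> Q (12 :: nat)"
  by (simp add: eval_nat_numeral All_less_Suc conj_ac)

text \<open>Two facts matter for clause regions: only the literal itself is at distance 5, and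
  nothing else is put into the region of a true literal. The latter is needed because a true literal
  may be at the center, where the sign 0 would make all distances collapse.\<close>

lemma placement_range:
  assumes "t < 13" "placement x t i = (r, d)"
  shows "r = 0 \<and> 0 \<le> d \<and> d \<le> 124 \<or> literal r \<and> d \<in> {5, 13, 21, 26, 29, 37} \<and> (d = 5 \<longleftrightarrow> t = r) \<and>
    (lit_true x r \<longrightarrow> d = 5)"
proof -
  have "\<forall>t<13. \<forall>x i. case placement x t i of (r, d) \<Rightarrow>
    r = 0 \<and> 0 \<le> d \<and> d \<le> 124 \<or> literal r \<and> d \<in> {5, 13, 21, 26, 29, 37} \<and> (d = 5 \<longleftrightarrow> t = r) \<and>
    (lit_true x r \<longrightarrow> d = 5)"
    unfolding all_less_13 all_bool_eq
    by (simp add: placement_def placements_def literal_def lit_true_def)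
  from this[rule_format, OF assms(1), of x i] show ?thesis unfolding assms(2) by (simp only: prod.case)
qed

lemma placement_bound:
  assumes "t < 13" "placement x t i = (r, d)"
  shows "\<bar>d\<bar> \<le> 124" "r \<noteq> 0 \<Longrightarrow> \<bar>d\<bar> \<le> 37"
  using placement_range[OF assms] by auto

lemma placement_literal: "literal t \<Longrightarrow> \<exists>i. placement x t i = (t, 5)"
  unfolding literal_def placement_def placements_def by (cases x; rule exI[of _ True]) auto

text \<open>A finite check of all pairs of types for both truth values, by evaluation.\<close>

lemma placement_base:
  assumes "a < 13" "b < 13" "a \<noteq> b"
  shows "base a b \<longleftrightarrow> (\<exists>i j. fst (placement x a i) = fst (placement x b j) \<and>
    \<bar>snd (placement x a i) - snd (placement x b j)\<bar> \<le> 10)"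
proof -
  let ?meet = "\<lambda>p q. fst p = fst q \<and> \<bar>snd p - snd q\<bar> \<le> (10 :: int)"
  let ?Q = "\<lambda>x a b. base a b \<longleftrightarrow> ?meet (fst (placements x ! a)) (fst (placements x ! b)) \<or>
    ?meet (fst (placements x ! a)) (snd (placements x ! b)) \<or>
    ?meet (snd (placements x ! a)) (fst (placements x ! b)) \<or>
    ?meet (snd (placements x ! a)) (snd (placements x ! b))"
  have "\<forall>x. list_all (\<lambda>a. list_all (\<lambda>b. a = b \<or> ?Q x a b) [0..<13]) [0..<13]"
    unfolding all_bool_eq base_def base_edges_def placements_def by code_simp
  then have "list_all (\<lambda>a. list_all (\<lambda>b. a = b \<or> ?Q x a b) [0..<13]) [0..<13]" by (rule spec)
  then have "\<forall>a\<in>{0..<13}. \<forall>b\<in>{0..<13}. a = b \<or> ?Q x a b" unfolding list_all_iff set_upt .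
  then have "\<forall>b\<in>{0..<13}. a = b \<or> ?Q x a b" by (rule bspec) (use assms in simp)
  then have "a = b \<or> ?Q x a b" by (rule bspec) (use assms in simp)
  then have "?Q x a b" using assms(3) by (simp only: simp_thms)
  then show ?thesis unfolding ex_bool_eq placement_def by auto
qed

text \<open>The three ways in which the two intervals of a white vertex are kept apart. The last one
  occurs for literal \<open>2\<close> of a false variable, whose intervals lie in the regions of two
  different clauses.\<close>

lemma placement_white:
  "t < 4 \<Longrightarrow> (case (placement x t False, placement x t True) of ((r, d), (r', d')) \<Rightarrow>
     r = 0 \<and> r' = 0 \<and> \<bar>d - d'\<bar> > 10 \<or> r = 0 \<and> literal r' \<or> r = 1 \<and> r' = 2)"
proof -
  assume "t < 4"
  then have "t \<in> {0, 1, 2, 3}" by auto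
  then show ?thesis by (cases x) (auto simp: placement_def placements_def literal_def)
qed

lemma placement_black: "4 \<le> t \<Longrightarrow> t < 13 \<Longrightarrow> placement x t False = placement x t True"
proof -
  have "\<forall>t<13. 4 \<le> t \<longrightarrow> placement x t False = placement x t True"
    unfolding all_less_13 by (cases x) (simp_all add: placement_def placements_def)
  then show "4 \<le> t \<Longrightarrow> t < 13 \<Longrightarrow> placement x t False = placement x t True" by blast
qed

lemma satisfied_imp_representation:
  assumes "satisfied val"
  shows "\<exists>L. endpoint_rep vertices adj white L"
proof -
  obtain center where center: "\<And>c. center c < 3" "\<And>c g t. g < G \<Longrightarrow> literal t \<Longrightarrow> clause g t = c \<Longrightarrow>
      seat g t = center c \<Longrightarrow> lit_true (val g) t"
    using assms unfolding satisfied_def by metis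
  define sign :: "nat \<Rightarrow> int" where "sign k = (if k = 0 then 0 else if k = 1 then 1 else - 1)" for k
  have sign_0: "sign k = 0 \<Longrightarrow> k = 0" for k by (auto simp: sign_def split: if_splits)
  have sign_inj: "sign k = sign l \<Longrightarrow> k < 3 \<Longrightarrow> l < 3 \<Longrightarrow> k = l" for k l
    by (auto simp: sign_def split: if_splits)
  \<comment> \<open>A cyclic shift of the seats gives the chosen seat the sign 0 and the other two
    the signs 1 and - 1.\<close>
  define side :: "nat \<Rightarrow> nat \<Rightarrow> int" where
    "side g t = sign ((seat g t + 3 - center (clause g t)) mod 3)" for g t
  have side_range: "side g t = 0 \<or> side g t = 1 \<or> side g t = - 1" for g t
    unfolding side_def sign_def by argo
  have side_0: "lit_true (val g) t" if "side g t = 0" "g < G" "literal t" for g t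
  proof -
    have 3: "a < 3 \<Longrightarrow> b < 3 \<Longrightarrow> (a + 3 - b) mod 3 = 0 \<Longrightarrow> a = b" for a b :: nat
      by presburger
    have "(seat g t + 3 - center (clause g t)) mod 3 = 0"
      using that(1) unfolding side_def by (rule sign_0)
    then have "seat g t = center (clause g t)" by (rule 3[OF seat_less center(1)])
    then show ?thesis by (rule center(2)[OF that(2,3) refl])
  qed
  have side_inj: "side g t \<noteq> side h r"
    if "g < G" "h < G" "literal t" "literal r" "clause g t = clause h r" "(g, t) \<noteq> (h, r)" for g t h r
  proof
    assume eq: "side g t = side h r"
    have 3: "a < 3 \<Longrightarrow> b < 3 \<Longrightarrow> c < 3 \<Longrightarrow> (a + 3 - c) mod 3 = (b + 3 - c) mod 3 \<Longrightarrow> a = b" for a b c :: nat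
    proof -
      assume "a < 3" "b < 3" "c < 3" and eq: "(a + 3 - c) mod 3 = (b + 3 - c) mod 3"
      then have "a = 0 \<or> a = 1 \<or> a = 2" "b = 0 \<or> b = 1 \<or> b = 2" "c = 0 \<or> c = 1 \<or> c = 2" by linarith+
      then show ?thesis using eq by (elim disjE) simp_all
    qed
    have "(seat g t + 3 - center (clause g t)) mod 3 = (seat h r + 3 - center (clause h r)) mod 3"
      using eq unfolding side_def by (rule sign_inj) simp_all
    then have "seat g t = seat h r"
      unfolding that(5) by (rule 3[OF seat_less seat_less center(1)])
    then show False using seat_inj[OF that(1-5)] that(6) by blast
  qed
  \<comment> \<open>Gadget regions are on the negative axis, clause regions around the nonnegative
    multiples of 1000. Placements reach only up to 124 and 37, so intervals of different regions
    cannot meet.\<close>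
  define coord :: "nat \<Rightarrow> nat \<times> int \<Rightarrow> int" where
    "coord g p = (if fst p = 0 then - 1000 * (int g + 1) + snd p
       else 1000 * int (clause g (fst p)) + side g (fst p) * snd p)" for g p
  have sep: "\<bar>1000 * a + x - (1000 * b + y)\<bar> \<le> 10 \<longleftrightarrow> a = b \<and> \<bar>x - y\<bar> \<le> 10"
    if "\<bar>x - y\<bar> \<le> 900" for a b x y :: int
  proof -
    consider "a = b" | "a \<le> b - 1" | "b \<le> a - 1" by linarith
    then show ?thesis using that by cases auto
  qed
  define pos where "pos v i = coord (fst v) (placement (val (fst v)) (snd v) i)" for v i
  have meet: "\<bar>pos u i - pos v j\<bar> \<le> 10 \<longleftrightarrow> fst u = fst v \<and> r = r' \<and> \<bar>d - d'\<bar> \<le> 10 \<or>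
       mates u v \<and> snd u = r \<and> snd v = r'"
    if uv: "u \<in> vertices" "v \<in> vertices" "u \<noteq> v"
      and p: "placement (val (fst u)) (snd u) i = (r, d)"
      and q: "placement (val (fst v)) (snd v) j = (r', d')" for u v i j r d r' d'
  proof -
    obtain g a h b where u: "u = (g, a)" and v: "v = (h, b)" by fastforce
    have lt: "g < G" "h < G" "a < 13" "b < 13" using uv u v by (auto simp: vertices_def)
    note p' = placement_range[OF lt(3) p[unfolded u, simplified]]
      and q' = placement_range[OF lt(4) q[unfolded v, simplified]]
    have sd: "\<bar>side g t * x\<bar> \<le> 37" if "\<bar>x\<bar> \<le> 37" for g t x using side_range[of g t] that by auto
    have l0: "\<not> literal 0" by (simp add: literal_def)
    show ?thesis
    proof (cases "r = 0 \<or> r' = 0")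
      case True
      have not_mates: "\<not> (mates u v \<and> snd u = r \<and> snd v = r')" using True l0 by (auto simp: mates_def)
      show ?thesis
      proof (cases "r = 0 \<and> r' = 0")
        case True
        then have e: "pos u i = - 1000 * (int g + 1) + d" "pos v j = - 1000 * (int h + 1) + d'"
          using p q by (simp_all add: pos_def coord_def u v)
        have "0 \<le> d" "d \<le> 124" "0 \<le> d'" "d' \<le> 124" using p' q' True l0 by auto
        then have "\<bar>pos u i - pos v j\<bar> \<le> 10 \<longleftrightarrow> g = h \<and> \<bar>d - d'\<bar> \<le> 10"
          using sep[of d d' "- (int g + 1)" "- (int h + 1)"] unfolding e by simp
        then show ?thesis using True not_mates u v by auto
      next
        case False
        have neg: "coord g' (0, x) \<le> - 876" if "x \<le> 124" for g' x using that by (simp add: coord_def)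
        have pos: "coord g' (t, x) \<ge> - 37" if "t \<noteq> 0" "\<bar>x\<bar> \<le> 37" for g' t x
          using that sd[of x g' t] by (simp add: coord_def)
        have "\<bar>d\<bar> \<le> 37" if "r \<noteq> 0" using p' that by auto
        moreover have "\<bar>d'\<bar> \<le> 37" if "r' \<noteq> 0" using q' that by auto
        moreover have "d \<le> 124" "d' \<le> 124"
          using placement_bound(1)[OF lt(3) p[unfolded u, simplified]]
            placement_bound(1)[OF lt(4) q[unfolded v, simplified]] by linarith+
        ultimately have "\<not> \<bar>pos u i - pos v j\<bar> \<le> 10"
          using True False neg[of d g] neg[of d' h] pos[of r d g] pos[of r' d' h] p q
          unfolding pos_def u v by auto
        then show ?thesis using not_mates False True by auto
      qed
    next
      case False
      then have P: "literal r" "d \<in> {5, 13, 21, 26, 29, 37}" "d = 5 \<longleftrightarrow> a = r" "lit_true (val g) r \<longrightarrow> d = 5"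
        and Q: "literal r'" "d' \<in> {5, 13, 21, 26, 29, 37}" "d' = 5 \<longleftrightarrow> b = r'" "lit_true (val h) r' \<longrightarrow> d' = 5"
        using p' q' by auto
      have e: "pos u i = 1000 * int (clause g r) + side g r * d"
        "pos v j = 1000 * int (clause h r') + side h r' * d'"
        using p q False by (simp_all add: pos_def coord_def u v)
      have "\<bar>side g r * d\<bar> \<le> 37" "\<bar>side h r' * d'\<bar> \<le> 37"
        using placement_bound(2)[OF lt(3) p[unfolded u, simplified]] 
          placement_bound(2)[OF lt(4) q[unfolded v, simplified]] False by (simp_all add: sd)
      then have "\<bar>side g r * d - side h r' * d'\<bar> \<le> 900" by linarith
      then have eq: "\<bar>pos u i - pos v j\<bar> \<le> 10 \<longleftrightarrow>
          clause g r = clause h r' \<and> \<bar>side g r * d - side h r' * d'\<bar> \<le> 10"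
        using sep[of "side g r * d" "side h r' * d'" "int (clause g r)" "int (clause h r')"]
        unfolding e by simp
      show ?thesis
      proof (cases "(g, r) = (h, r')")
        case True
        then have same: "g = h" "r = r'" by auto
        \<comment> \<open>Of two vertices of a gadget in the same clause region, one is not the
          literal, so its distance is not 5 and the literal is false. Hence the literal is not at
          the center, and multiplication by the sign preserves distances.\<close>
        have "side g r \<noteq> 0"
          using side_0[of g r] P Q same lt uv(3) u v by auto
        then have "\<bar>side g r * d - side h r' * d'\<bar> = \<bar>d - d'\<bar>"
          using side_range[of g r] same by auto
        moreover have "\<not> (mates u v \<and> snd u = r \<and> snd v = r')" using same u v uv(3) by (auto simp: mates_def)
        ultimately show ?thesis using eq same u v by auto
      next
        case False
        have "\<bar>side g r * d - side h r' * d'\<bar> \<le> 10 \<longleftrightarrow> a = r \<and> b = r'" if c: "clause g r = clause h r'"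
        proof -
          have "side g r \<noteq> side h r'" using side_inj lt P(1) Q(1) c False by blast
          moreover have "side g r = 0 \<Longrightarrow> d = 5" "side h r' = 0 \<Longrightarrow> d' = 5"
            using side_0 lt P(1,4) Q(1,4) by blast+
          moreover have "d = 5 \<or> 13 \<le> d" "d' = 5 \<or> 13 \<le> d'" using P(2) Q(2) by auto
          ultimately have "\<bar>side g r * d - side h r' * d'\<bar> \<le> 10 \<longleftrightarrow> d = 5 \<and> d' = 5"
            by (intro two_sides side_range)
          then show ?thesis using P(3) Q(3) by simp
        qed
        then show ?thesis using eq False u v P(1) Q(1) by (auto simp: mates_def)
      qed
    qed
  qed
  define L where "L v i = real_of_int (pos v i) / 10" for v i
  have close: "close (L u i) (L v j) \<longleftrightarrow> \<bar>pos u i - pos v j\<bar> \<le> 10" for u v i j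
    unfolding close_def L_def by linarith
  have "adj u v \<longleftrightarrow> (\<exists>i j. close (L u i) (L v j))" if uv: "u \<in> vertices" "v \<in> vertices" "u \<noteq> v" for u v
  proof -
    let ?p = "\<lambda>i. placement (val (fst u)) (snd u) i" and ?q = "\<lambda>j. placement (val (fst v)) (snd v) j"
    have m: "\<bar>pos u i - pos v j\<bar> \<le> 10 \<longleftrightarrow> fst u = fst v \<and> fst (?p i) = fst (?q j) \<and>
        \<bar>snd (?p i) - snd (?q j)\<bar> \<le> 10 \<or> mates u v \<and> snd u = fst (?p i) \<and> snd v = fst (?q j)" for i j
      using meet[OF uv, of i "fst (?p i)" "snd (?p i)" j "fst (?q j)" "snd (?q j)"] by simp
    have lt: "snd u < 13" "snd v < 13" using uv by (auto simp: vertices_def)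
    have "fst u = fst v \<Longrightarrow> snd u \<noteq> snd v" using uv(3) by (auto simp: prod_eq_iff)
    then have "fst u = fst v \<and> base (snd u) (snd v) \<longleftrightarrow>
        (\<exists>i j. fst u = fst v \<and> fst (?p i) = fst (?q j) \<and> \<bar>snd (?p i) - snd (?q j)\<bar> \<le> 10)"
      using placement_base[OF lt, of "val (fst u)"] by auto
    moreover have "mates u v \<longleftrightarrow> (\<exists>i j. mates u v \<and> snd u = fst (?p i) \<and> snd v = fst (?q j))"
    proof -
      have "\<exists>i j. snd u = fst (?p i) \<and> snd v = fst (?q j)" if "mates u v"
      proof -
        have "literal (snd u)" "literal (snd v)" using that by (auto simp: mates_def)
        then obtain i j where "?p i = (snd u, 5)" "?q j = (snd v, 5)"
          using placement_literal by meson
        then show ?thesis by (intro exI[of _ i] exI[of _ j]) simp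
      qed
      then show ?thesis by blast
    qed
    ultimately show ?thesis unfolding adj_def close m by blast
  qed
  moreover have "if white v then \<not> close (L v False) (L v True) else L v False = L v True"
    if v: "v \<in> vertices" for v
  proof -
    obtain g t where gt: "v = (g, t)" by fastforce
    have lt: "g < G" "t < 13" using v gt by (auto simp: vertices_def)
    obtain r d r' d' where p: "placement (val g) t False = (r, d)" "placement (val g) t True = (r', d')"
      by (meson surj_pair)
    show ?thesis
    proof (cases "white v")
      case True
      then have w: "r = 0 \<and> r' = 0 \<and> \<bar>d - d'\<bar> > 10 \<or> r = 0 \<and> literal r' \<or> r = 1 \<and> r' = 2"
        using placement_white[of t "val g"] p gt by (simp add: white_def)
      note P = placement_bound[OF lt(2) p(1)] and Q = placement_bound(2)[OF lt(2) p(2)]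
      have sd: "\<bar>side g t * x\<bar> \<le> 37" if "\<bar>x\<bar> \<le> 37" for g t x using side_range[of g t] that by auto
      have "\<bar>pos v False - pos v True\<bar> > 10"
        using w
      proof (elim disjE conjE)
        assume "r = 0" "r' = 0" "10 < \<bar>d - d'\<bar>"
        then show ?thesis using p gt by (simp add: pos_def coord_def)
      next
        assume "r = 0" "literal r'"
        then have "r' \<noteq> 0" by (auto simp: literal_def)
        then show ?thesis using p gt P Q sd[of d' g r'] \<open>r = 0\<close> by (simp add: pos_def coord_def)
      next
        assume "r = 1" "r' = 2"
        then have "pos v False = 1000 * int (clause g 1) + side g 1 * d"
          "pos v True = 1000 * int (clause g 2) + side g 2 * d'" using p gt by (simp_all add: pos_def coord_def)
        moreover have "\<bar>side g 1 * d\<bar> \<le> 37" "\<bar>side g 2 * d'\<bar> \<le> 37"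
          using P Q \<open>r = 1\<close> \<open>r' = 2\<close> by (simp_all add: sd)
        ultimately show ?thesis using clause_distinct(1)[OF lt(1)] by linarith
      qed
      then show ?thesis using True close by auto
    next
      case False
      then show ?thesis using placement_black[of t "val g"] lt gt by (simp add: white_def L_def pos_def)
    qed
  qed
  ultimately show ?thesis unfolding endpoint_rep_def by blast
qed

theorem representation_iff_satisfiable:
  "(\<exists>L. endpoint_rep vertices adj white L) \<longleftrightarrow> (\<exists>val. satisfied val)"
  using representation_imp_satisfied satisfied_imp_representation by blast

subsection \<open>Degrees\<close>

text \<open>The mates of a literal have distinct seats, all different from its own, so there are at
  most two; a literal has at most four neighbors in its gadget, any other vertex at most six and no
  mates.\<close>

lemma degree_le_6:
  assumes u: "u \<in> vertices"
  shows "card {v \<in> vertices. adj u v} \<le> 6"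
proof -
  let ?N = "{v \<in> vertices. mates u v}" and ?B = "Pair (fst u) ` {t \<in> {..<13}. base (snd u) t}"
  have lt: "snd u < 13" using u by (auto simp: vertices_def)
  have fin: "finite ?N" by (rule finite_subset[of _ vertices]) (auto simp: vertices_def)
  have "card ((\<lambda>v. seat (fst v) (snd v)) ` ?N) \<le> card ({..<3} - {seat (fst u) (snd u)})"
  proof (rule card_mono)
    show "(\<lambda>v. seat (fst v) (snd v)) ` ?N \<subseteq> {..<3} - {seat (fst u) (snd u)}"
      using u seat_less seat_inj[of "fst u" _ "snd u"] by (auto simp: vertices_def mates_def)
  qed simp
  moreover have "inj_on (\<lambda>v. seat (fst v) (snd v)) ?N"
    using seat_inj by (auto simp: inj_on_def vertices_def mates_def)
  ultimately have "card ?N \<le> card ({..<3} - {seat (fst u) (snd u)})" by (simp add: card_image)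
  then have N: "card ?N \<le> 2" using seat_less by simp
  have N0: "card ?N = 0" if "\<not> literal (snd u)" using that by (auto simp: mates_def)
  have B: "card ?B = card {t \<in> {..<13}. base (snd u) t}" by (rule card_image) (simp add: inj_on_def)
  have "{t \<in> {..<13}. base a t} = set (filter (base a) [0..<13])" for a
    by auto
  then have le: "card {t \<in> {..<13}. base a t} \<le> length (filter (base a) [0..<13])" for a
    by (simp only: card_length)
  have "\<forall>a<13. length (filter (base a) [0..<13]) \<le> (if literal a then 4 else 6)"
    unfolding all_less_13 by (simp add: base_def base_edges_def literal_def upt_rec)
  then have "length (filter (base (snd u)) [0..<13]) \<le> (if literal (snd u) then 4 else 6)"
    using lt by blast
  then have "card ?B \<le> (if literal (snd u) then 4 else 6)"
    unfolding B by (rule order_trans[OF le])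
  moreover have "card {v \<in> vertices. adj u v} \<le> card (?N \<union> ?B)"
    by (rule card_mono) (use fin in \<open>auto simp: adj_def vertices_def image_iff\<close>)
  moreover have "card (?N \<union> ?B) \<le> card ?N + card ?B" by (rule card_Un_le)
  ultimately show ?thesis using N N0 by (simp split: if_splits)
qed

end


context gadgets
begin

subsection \<open>The graph on natural numbers\<close>

definition vertex_of :: "nat \<Rightarrow> nat \<times> nat" where
  "vertex_of v = (v div 13, v mod 13)"

definition edges :: "nat set set" where
  "edges = {{u, v} |u v. u < 13 * G \<and> v < 13 * G \<and> adj (vertex_of u) (vertex_of v)}"

definition color_of :: "nat \<Rightarrow> color" where
  "color_of v = (if v mod 13 < 4 then White else Black)"

lemma vertex_of_bij: "bij_betw vertex_of {..<13 * G} vertices"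
proof (rule bij_betw_byWitness[of _ "\<lambda>(g, t). 13 * g + t"])
  show "vertex_of ` {..<13 * G} \<subseteq> vertices"
    by (auto simp: vertex_of_def vertices_def less_mult_imp_div_less mult.commute)
qed (auto simp: vertex_of_def vertices_def)

lemma adj_irrefl: "\<not> adj u u"
proof -
  have "\<not> base a a" for a by (auto simp: base_def base_edges_def)
  then show ?thesis by (simp add: adj_def mates_def)
qed

lemma in_edges_iff: "u < 13 * G \<Longrightarrow> v < 13 * G \<Longrightarrow> {u, v} \<in> edges \<longleftrightarrow> adj (vertex_of u) (vertex_of v)"
  unfolding edges_def using adj_sym[of "vertex_of u" "vertex_of v"] by (auto simp: doubleton_eq_iff)

lemma simple_graph_edges: "simple_graph {..<13 * G} edges"
proof -
  have "card {u, v} = 2" if "adj (vertex_of u) (vertex_of v)" for u v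
    using that adj_irrefl by (cases "u = v") auto
  then show ?thesis unfolding simple_graph_def edges_def by auto
qed

lemma degree_edges: "degree_at_most 6 {..<13 * G} edges"
  unfolding degree_at_most_def
proof
  fix u assume u: "u \<in> {..<13 * G}"
  let ?N = "{v \<in> {..<13 * G}. adj (vertex_of u) (vertex_of v)}"
  have "{e \<in> edges. u \<in> e} \<subseteq> (\<lambda>v. {u, v}) ` ?N"
  proof
    fix e assume "e \<in> {e \<in> edges. u \<in> e}"
    then obtain a b where e: "e = {a, b}" "a < 13 * G" "b < 13 * G" "adj (vertex_of a) (vertex_of b)"
        "u = a \<or> u = b" unfolding edges_def by blast
    then show "e \<in> (\<lambda>v. {u, v}) ` ?N"
      using adj_sym[of "vertex_of a" "vertex_of b"] by (auto simp: insert_commute)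
  qed
  then have "card {e \<in> edges. u \<in> e} \<le> card ((\<lambda>v. {u, v}) ` ?N)"
    by (intro card_mono) auto
  also have "\<dots> \<le> card ?N" by (rule card_image_le) auto
  also have "\<dots> = card (vertex_of ` ?N)"
    using vertex_of_bij by (intro card_image[symmetric]) (auto simp: bij_betw_def inj_on_def)
  also have "\<dots> \<le> card {v \<in> vertices. adj (vertex_of u) v}"
    using vertex_of_bij by (intro card_mono) (auto simp: bij_betw_def vertices_def)
  also have "\<dots> \<le> 6"
    by (rule degree_le_6) (rule bij_betwE[OF vertex_of_bij, rule_format, OF u])
  finally show "card {e \<in> edges. u \<in> e} \<le> 6" .
qed

theorem colored_graph_iff_satisfiable:
  "colored_unit_2_interval_graph {..<13 * G} edges color_of \<longleftrightarrow> (\<exists>val. satisfied val)"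
proof -
  let ?V = "{..<13 * G}"
  have image: "vertex_of ` ?V = vertices" and inj: "inj_on vertex_of ?V"
    using vertex_of_bij by (auto simp: bij_betw_def)
  have "endpoint_rep ?V (\<lambda>u v. {u, v} \<in> edges) (\<lambda>v. color_of v = White) (\<lambda>v. L (vertex_of v)) \<longleftrightarrow>
      endpoint_rep vertices adj white L" for L
  proof -
    have 1: "color_of v = White \<longleftrightarrow> white (vertex_of v)" for v
      by (simp add: color_of_def white_def vertex_of_def)
    have 2: "(u \<noteq> v \<longrightarrow> (({u, v} \<in> edges) = P)) \<longleftrightarrow>
        (vertex_of u \<noteq> vertex_of v \<longrightarrow> (adj (vertex_of u) (vertex_of v) = P))"
      if "u \<in> ?V" "v \<in> ?V" for u v P
      using that in_edges_iff[of u v] inj_on_eq_iff[OF inj that] by simp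
    show ?thesis
      unfolding endpoint_rep_def image[symmetric] ball_simps(9) 1
      by (intro arg_cong2[where f = "(\<and>)"] ball_cong refl 2)
  qed
  note rep = this
  have "(\<exists>L. endpoint_rep ?V (\<lambda>u v. {u, v} \<in> edges) (\<lambda>v. color_of v = White) L) \<longleftrightarrow>
      (\<exists>L. endpoint_rep vertices adj white L)"
  proof
    assume "\<exists>L. endpoint_rep ?V (\<lambda>u v. {u, v} \<in> edges) (\<lambda>v. color_of v = White) L"
    then obtain L where L: "endpoint_rep ?V (\<lambda>u v. {u, v} \<in> edges) (\<lambda>v. color_of v = White) L" by blast
    let ?L = "\<lambda>p. L (inv_into ?V vertex_of p)"
    have "endpoint_rep ?V (\<lambda>u v. {u, v} \<in> edges) (\<lambda>v. color_of v = White) (\<lambda>v. ?L (vertex_of v))"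
      using L inj unfolding endpoint_rep_def by simp
    then have "endpoint_rep vertices adj white ?L" using rep[of ?L] by (rule iffD1[rotated])
    then show "\<exists>L. endpoint_rep vertices adj white L" by blast
  next
    assume "\<exists>L. endpoint_rep vertices adj white L"
    then show "\<exists>L. endpoint_rep ?V (\<lambda>u v. {u, v} \<in> edges) (\<lambda>v. color_of v = White) L"
      using rep by blast
  qed
  then show ?thesis using representation_iff_satisfiable colored_graph_iff_endpoint_rep by metis
qed

end


section \<open>From formulas to gadgets\<close>

text \<open>
  A formula has \<open>J\<close> clauses of width \<open>r\<close>; literal \<open>i\<close> of clause \<open>j\<close> is the occurrence \<open>j * r + i\<close>. Each
  literal is doubled, so that each variable occurs at least twice. Occurrence \<open>o\<close> has two gadgets:
  gadget \<open>2 * o\<close> states that this literal is true, and its values agree along the ring of all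
  occurrences of a variable, because of the clauses \<open>2 * o + 1\<close>; gadget \<open>2 * o + 1\<close> states
  that none of the earlier literals of the clause is true, and the clauses \<open>2 * o\<close> split the clauses of
  the formula accordingly. Literals that are not in use get a clause of their own.
\<close>

locale cnf =
  fixes J r :: nat and var :: "nat \<Rightarrow> nat" and sgn :: "nat \<Rightarrow> bool"
  assumes r_pos: "0 < r"
begin

definition formula_sat :: "(nat \<Rightarrow> bool) \<Rightarrow> bool" where
  "formula_sat \<alpha> \<longleftrightarrow> (\<forall>j<J. \<exists>i<r. \<alpha> (var (j * r + i)) = sgn (j * r + i))"

definition width :: nat where "width = 2 * r"

definition occs :: nat where "occs = J * width"

definition occ_var :: "nat \<Rightarrow> nat" where "occ_var o' = var (o' div 2)"

definition occ_sgn :: "nat \<Rightarrow> bool" where "occ_sgn o' = sgn (o' div 2)"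

text \<open>The greatest occurrence of \<open>x\<close> below \<open>N\<close>, written as a sum
  with at most one nonzero term so that it is definable.\<close>

definition last_below :: "nat \<Rightarrow> nat \<Rightarrow> nat" where
  "last_below N x = (\<Sum>k<N. if occ_var k = x \<and> (\<forall>l<N. k < l \<longrightarrow> occ_var l \<noteq> x) then k else 0)"

text \<open>The cyclic predecessor among the occurrences of a variable: the first one is sent to the
  last one.\<close>

definition prev :: "nat \<Rightarrow> nat" where
  "prev o' = last_below (if \<exists>k<o'. occ_var k = occ_var o' then o' else occs) (occ_var o')"

text \<open>Literal types are below 12, so these numbers are pairwise distinct, and they lie above
  the numbers of the proper clauses.\<close>

definition unused :: "nat \<Rightarrow> nat \<Rightarrow> nat" where
  "unused g t = 2 * occs + 12 * g + t"

text \<open>Clause \<open>2 * o'\<close> says that literal \<open>o'\<close> is true, or some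
  earlier literal of the clause is, or none is up to and including \<open>o'\<close>; at the ends,
  dummies replace the missing alternatives. Clause \<open>2 * o' + 1\<close> says that if the
  variable is true according to \<open>o'\<close>, it is so according to the occurrence with
  predecessor \<open>o'\<close>. As gadget \<open>2 * o'\<close> stands for the literal and not for
  the variable, it needs two positive literals and a negative one whatever the sign.\<close>

definition cl :: "nat \<Rightarrow> nat \<Rightarrow> nat" where
  "cl g t = (let o' = g div 2; i = o' mod width in
     if g mod 2 = 0 then
       (if t = 1 then 2 * o'
        else if t = 2 then (if occ_sgn o' then 2 * prev o' + 1 else 2 * o' + 1)
        else if t = 3 then (if occ_sgn o' then 2 * o' + 1 else 2 * prev o' + 1)
        else if t = 11 \<and> (i = 0 \<or> i = width - 1) then 2 * o' else unused g t)
     else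
       (if t = 1 \<and> i \<noteq> 0 then 2 * (o' - 1)
        else if t = 3 \<and> i \<noteq> 0 then 2 * o'
        else if t = 11 then 2 * o' + 1 else unused g t))"

definition seat :: "nat \<Rightarrow> nat \<Rightarrow> nat" where
  "seat g t = (let o' = g div 2; i = o' mod width in
     if g mod 2 = 0 then
       (if t = 2 then (if occ_sgn o' then 1 else 0)
        else if t = 3 then (if occ_sgn o' then 0 else 1)
        else if t = 11 then (if i = 0 then 1 else if i = width - 1 then 2 else 0) else 0)
     else
       (if t = 1 \<and> i \<noteq> 0 then 2
        else if t = 3 \<and> i \<noteq> 0 then 1
        else if t = 11 then 2 else 0))"

section \<open>The ring of the occurrences of a variable\<close>

lemma last_below:
  assumes "k < N" "occ_var k = x"
  shows "last_below N x < N" "occ_var (last_below N x) = x" "k \<le> last_below N x"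
proof -
  let ?K = "{k. k < N \<and> occ_var k = x}"
  let ?m = "Max ?K"
  have fin: "finite ?K" by simp
  have m: "?m \<in> ?K" by (rule Max_in) (use assms in auto)
  have up: "l \<le> ?m" if "l < N" "occ_var l = x" for l using Max_ge[OF fin] that by simp
  have "(if occ_var k = x \<and> (\<forall>l<N. k < l \<longrightarrow> occ_var l \<noteq> x) then k else 0) = (if k = ?m then ?m else 0)"
    if "k < N" for k
    using m up that by (metis (mono_tags, lifting) le_neq_implies_less leD mem_Collect_eq)
  then have "last_below N x = (\<Sum>k<N. if k = ?m then ?m else 0)"
    unfolding last_below_def by (intro sum.cong) auto
  then have "last_below N x = ?m" using m by (simp add: sum.delta)
  then show "last_below N x < N" "occ_var (last_below N x) = x" "k \<le> last_below N x"
    using m up assms by auto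
qed

text \<open>Here the doubling is used: the other copy of \<open>a\<close> has the same variable, so
  no occurrence is its own predecessor. Otherwise literals \<open>2\<close> and \<open>3\<close> of
  a gadget would get into the same clause.\<close>

lemma prev_occ:
  assumes "a < occs"
  shows "prev a < occs" "occ_var (prev a) = occ_var a" "prev a \<noteq> a"
proof -
  have par: "occ_var (if even a then a + 1 else a - 1) = occ_var a" unfolding occ_var_def
    by (auto elim!: oddE evenE)
  have "a + 1 < occs" if "even a" using that assms unfolding occs_def width_def
    by (metis Suc_eq_plus1 Suc_lessI dvd_triv_left even_Suc mult.left_commute)
  then have par_less: "(if even a then a + 1 else a - 1) < occs" using assms by auto
  consider (earlier) k where "k < a" "occ_var k = occ_var a" | (none) "\<nexists>k. k < a \<and> occ_var k = occ_var a"
    by blast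
  then have "prev a < occs \<and> occ_var (prev a) = occ_var a \<and> prev a \<noteq> a"
  proof cases
    case earlier
    then have "prev a = last_below a (occ_var a)" unfolding prev_def by auto
    then show ?thesis using last_below[OF earlier] assms by auto
  next
    case none
    then have p: "prev a = last_below occs (occ_var a)" unfolding prev_def by auto
    have "even a" using none par by (metis diff_less even_zero gr0I less_numeral_extra(1))
    then have "a + 1 \<le> prev a" using last_below(3)[OF par_less par] p by simp
    then show ?thesis using last_below[OF assms refl] p by auto
  qed
  then show "prev a < occs" "occ_var (prev a) = occ_var a" "prev a \<noteq> a" by auto
qed

lemma prev_cases:
  assumes "a < occs" "b < a" "occ_var b = occ_var a"
  shows "b \<le> prev a" "prev a < a"
  using last_below[OF assms(2,3)] assms(2,3) unfolding prev_def by auto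

lemma prev_first:
  assumes "a < occs" "\<nexists>k. k < a \<and> occ_var k = occ_var a" "b < occs" "occ_var b = occ_var a"
  shows "b \<le> prev a"
  using last_below[OF assms(3,4)] assms(2) unfolding prev_def by auto

text \<open>Let \<open>a < b\<close> have the same variable. The predecessor of \<open>b\<close> is
  below \<open>b\<close> and at least \<open>a\<close>, whereas that of \<open>a\<close> is below
  \<open>a\<close> or, if \<open>a\<close> comes first, at least \<open>b\<close>.\<close>

lemma prev_inj: "inj_on prev {..<occs}"
proof (rule linorder_inj_onI)
  fix a b assume ab: "a < b" "a \<in> {..<occs}" "b \<in> {..<occs}"
  show "prev a \<noteq> prev b"
  proof
    assume eq: "prev a = prev b"
    then have v: "occ_var a = occ_var b" using prev_occ(2) ab by (metis lessThan_iff)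
    have b: "a \<le> prev b" "prev b < b" using prev_cases[OF _ ab(1) v] ab by auto
    show False
    proof (cases "\<exists>k. k < a \<and> occ_var k = occ_var a")
      case True
      then obtain k where k: "k < a" "occ_var k = occ_var a" by blast
      have "prev a < a" by (rule prev_cases(2)[OF _ k]) (use ab in simp)
      then show False using b eq by linarith
    next
      case False
      have "b \<le> prev a" by (rule prev_first[OF _ False _ v[symmetric]]) (use ab in simp_all)
      then show False using b eq by linarith
    qed
  qed
qed (rule linear)

text \<open>\<open>X\<close> is inherited by all later occurrences, in particular by the last one.
  This is the predecessor of the first one, from which all others are reached.\<close>

lemma ring_consistent:
  assumes step: "\<And>a. a < occs \<Longrightarrow> X (prev a) \<Longrightarrow> X a"
    and ab: "a < occs" "b < occs" "occ_var a = occ_var b" "X a"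
  shows "X b"
proof -
  have up: "X d" if "c \<le> d" "d < occs" "occ_var c = occ_var d" "X c" for c d
    using that
  proof (induction d rule: less_induct)
    case (less d)
    show ?case
    proof (cases "c = d")
      case False
      then have "c < d" using less.prems(1) by simp
      then have p: "c \<le> prev d" "prev d < d" using prev_cases[OF less.prems(2) _ less.prems(3)] by auto
      have "X (prev d)" using less.IH[OF p(2,1)] p less.prems prev_occ(2)[OF less.prems(2)] by auto
      then show ?thesis using step less.prems(2) by blast
    qed (use less.prems in simp)
  qed
  define f where "f = (LEAST k. occ_var k = occ_var b)"
  have f: "occ_var f = occ_var b" "f \<le> b" unfolding f_def by (auto intro: LeastI Least_le)
  have none: "\<nexists>k. k < f \<and> occ_var k = occ_var f" using f not_less_Least unfolding f_def by metis
  have fo: "f < occs" using f ab by simp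
  have "a \<le> prev f" by (rule prev_first[OF fo none ab(1)]) (use ab(3) f(1) in simp)
  then have "X (prev f)" using up[of a "prev f"] prev_occ[OF fo] ab f by auto
  then have "X f" using step fo by blast
  then show ?thesis using up[of f b] f ab by auto
qed

text \<open>The inverse of the seating: the literal on seat \<open>s\<close> of clause
  \<open>c\<close>. It turns the injectivity of the seating into a computation, and it later tells
  which literals can satisfy a given clause.\<close>

definition owner :: "nat \<Rightarrow> nat \<Rightarrow> nat \<times> nat" where
  "owner c s = (let q = c div 2; i = q mod width; q' = inv_into {..<occs} prev q in
     if 2 * occs \<le> c then ((c - 2 * occs) div 12, (c - 2 * occs) mod 12)
     else if c mod 2 = 0 then
       (if s = 0 then (2 * q, 1)
        else if s = 1 then (if i = 0 then (2 * q, 11) else (2 * q + 1, 3))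
        else if i = width - 1 then (2 * q, 11) else (2 * (q + 1) + 1, 1))
     else
       (if s = 0 then (2 * q, if occ_sgn q then 3 else 2)
        else if s = 1 then (2 * q', if occ_sgn q' then 2 else 3)
        else (2 * q + 1, 11)))"

lemma owner:
  assumes "g < 2 * occs" "literal t"
  shows "owner (cl g t) (seat g t) = (g, t)"
proof -
  define a where "a = g div 2"
  have a: "a < occs" using assms(1) by (simp add: a_def)
  have g: "g = 2 * a \<or> g = 2 * a + 1" by (auto simp: a_def)
  have pa: "inv_into {..<occs} prev (prev a) = a" using prev_inj a by simp
  have w: "0 < width" "width \<noteq> 1" using r_pos by (auto simp: width_def)
  have un: "owner (unused g t) s = (g, t)" for s
    using assms(2) by (auto simp: owner_def unused_def literal_def)
  have odd: "(2 * n + 1) div 2 = n" "(2 * n + 1) mod 2 = 1" for n :: nat by auto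
  from g show ?thesis
  proof
    assume g: "g = 2 * a"
    have gd: "g div 2 = a" "g mod 2 = 0" using g by auto
    note ev = cl_def seat_def Let_def gd
    consider "t = 1" | "t = 2" | "t = 3" | "t = 11" using assms(2) by (auto simp: literal_def)
    then show ?thesis
    proof cases
      case 1
      then show ?thesis using a g unfolding ev by (simp add: owner_def)
    next
      case 2
      then show ?thesis using a g pa prev_occ(1)[OF a] odd unfolding ev by (auto simp: owner_def Let_def)
    next
      case 3
      then show ?thesis using a g pa prev_occ(1)[OF a] odd unfolding ev by (auto simp: owner_def Let_def)
    next
      case 4
      show ?thesis
      proof (cases "a mod width = 0 \<or> a mod width = width - 1")
        case True
        then show ?thesis using 4 a g w unfolding ev by (auto simp: owner_def Let_def)
      next
        case False
        then show ?thesis using 4 un unfolding ev by simp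
      qed
    qed
  next
    assume g: "g = 2 * a + 1"
    have gd: "g div 2 = a" "g mod 2 = 1" using g by auto
    note ev = cl_def seat_def Let_def gd
    consider "t = 1" | "t = 2" | "t = 3" | "t = 11" using assms(2) by (auto simp: literal_def)
    then show ?thesis
    proof cases
      case 1
      show ?thesis
      proof (cases "a mod width = 0")
        case True
        then show ?thesis using un 1 unfolding ev by simp
      next
        case False
        then have "a \<noteq> 0" by (intro notI) simp
        then obtain b where b: "a = Suc b" using not0_implies_Suc by blast
        have "b mod width \<noteq> width - 1"
        proof
          assume "b mod width = width - 1"
          then have "Suc (b mod width) = width" using w by linarith
          then show False using False b by (simp add: mod_Suc)
        qed
        then show ?thesis using 1 g a b False unfolding ev by (simp add: owner_def Let_def)
      qed
    next
      case 2
      then show ?thesis using un unfolding ev by simp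
    next
      case 3
      show ?thesis
      proof (cases "a mod width = 0")
        case True
        then show ?thesis using un 3 unfolding ev by simp
      next
        case False
        then show ?thesis using 3 a g unfolding ev by (simp add: owner_def Let_def)
      qed
    next
      case 4
      then show ?thesis using a g odd unfolding ev by (auto simp: owner_def Let_def)
    qed
  qed
qed

lemma cl_distinct:
  assumes "g < 2 * occs"
  shows "cl g 1 \<noteq> cl g 2" "cl g 1 \<noteq> cl g 3" "cl g 2 \<noteq> cl g 3"
proof -
  define a where "a = g div 2"
  have a: "a < occs" using assms by (simp add: a_def)
  have p: "prev a \<noteq> a" by (rule prev_occ(3)[OF a])
  have u: "2 * (a - 1) < unused g t" "2 * a < unused g t" for t
    using a by (auto simp: unused_def)
  have u': "unused g t \<noteq> unused g t'" if "t \<noteq> t'" for t t' using that by (simp add: unused_def)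
  have "cl g 1 \<noteq> cl g 2 \<and> cl g 1 \<noteq> cl g 3 \<and> cl g 2 \<noteq> cl g 3"
  proof (cases "g mod 2 = 0")
    case True
    have c: "cl g 1 = 2 * a" "cl g 2 = (if occ_sgn a then 2 * prev a + 1 else 2 * a + 1)"
      "cl g 3 = (if occ_sgn a then 2 * a + 1 else 2 * prev a + 1)"
      using True by (simp_all add: cl_def a_def Let_def)
    have "2 * x \<noteq> 2 * y + 1" for x y :: nat by presburger
    then show ?thesis unfolding c using p by simp
  next
    case False
    have c: "cl g 1 = (if a mod width \<noteq> 0 then 2 * (a - 1) else unused g 1)" "cl g 2 = unused g 2"
      "cl g 3 = (if a mod width \<noteq> 0 then 2 * a else unused g 3)"
      using False by (simp_all add: cl_def a_def Let_def)
    show ?thesis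
    proof (cases "a mod width = 0")
      case True
      then show ?thesis unfolding c using u'[of 1 2] u'[of 1 3] u'[of 2 3] by simp
    next
      case False
      then have "a \<noteq> 0" by (intro notI) simp
      then have "2 * (a - 1) \<noteq> 2 * a" by simp
      then show ?thesis unfolding c using False u[of 2] by simp
    qed
  qed
  then show "cl g 1 \<noteq> cl g 2" "cl g 1 \<noteq> cl g 3" "cl g 2 \<noteq> cl g 3" by auto
qed

sublocale gadgets "2 * occs" cl seat
proof
  show "seat g t < 3" for g t by (simp add: seat_def Let_def)
  show "(g, t) = (h, r')" if "g < 2 * occs" "h < 2 * occs" "literal t" "literal r'"
      "cl g t = cl h r'" "seat g t = seat h r'" for g t h r'
    using owner that by metis
qed (rule cl_distinct; assumption)+

section \<open>Equivalence of the formula and its gadgets\<close>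

lemma occ_decomp:
  assumes "j < J" "i < width"
  shows "j * width + i < occs" "(j * width + i) mod width = i"
    "(j * width + i) div 2 = j * r + i div 2" "i div 2 < r"
proof -
  have "j * width + i < Suc j * width" using assms by simp
  also have "\<dots> \<le> occs" unfolding occs_def using assms by (intro mult_le_mono1) auto
  finally show "j * width + i < occs" .
  show "(j * width + i) mod width = i" using assms by simp
  show "(j * width + i) div 2 = j * r + i div 2" unfolding width_def
    by (simp add: mult.left_commute)
  show "i div 2 < r" using assms by (auto simp: width_def)
qed

lemma satisfied_imp_formula_sat:
  assumes "satisfied val"
  shows "\<exists>\<alpha>. formula_sat \<alpha>"
proof -
  have w: "0 < width" "width \<noteq> 1" using r_pos by (auto simp: width_def)
  have seats: "\<exists>s<3. \<forall>g<2 * occs. \<forall>t. literal t \<longrightarrow> cl g t = c \<longrightarrow> seat g t = s \<longrightarrow> lit_true (val g) t" for c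
    using assms unfolding satisfied_def by blast
  \<comment> \<open>The value of the variable according to occurrence \<open>a\<close>; the ring
    clauses pass it on from \<open>prev a\<close> to \<open>a\<close>.\<close>
  define X where "X a \<longleftrightarrow> (val (2 * a) \<longleftrightarrow> occ_sgn a)" for a
  have step: "X a" if a: "a < occs" and X: "X (prev a)" for a
  proof -
    let ?q = "prev a"
    have q: "?q < occs" by (rule prev_occ(1)[OF a])
    obtain s where s: "s < 3" "\<And>g t. g < 2 * occs \<Longrightarrow> literal t \<Longrightarrow> cl g t = 2 * ?q + 1 \<Longrightarrow>
        seat g t = s \<Longrightarrow> lit_true (val g) t" using seats[of "2 * ?q + 1"] by blast
    have "s = 0 \<or> s = 1 \<or> s = 2" using s(1) by auto
    then show ?thesis
    proof (elim disjE)
      assume "s = 0"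
      then have "lit_true (val (2 * ?q)) (if occ_sgn ?q then 3 else 2)"
        using q by (intro s(2)) (auto simp: literal_def cl_def seat_def Let_def)
      then show ?thesis using X by (auto simp: X_def lit_true_def split: if_splits)
    next
      assume "s = 1"
      then have "lit_true (val (2 * a)) (if occ_sgn a then 2 else 3)"
        using a by (intro s(2)) (auto simp: literal_def cl_def seat_def Let_def)
      then show ?thesis by (auto simp: X_def lit_true_def split: if_splits)
    next
      assume "s = 2"
      then have "lit_true (val (2 * ?q + 1)) 11"
        using q by (intro s(2)) (auto simp: literal_def cl_def seat_def Let_def)
      then show ?thesis by (simp add: lit_true_def)
    qed
  qed
  define \<alpha> where "\<alpha> x \<longleftrightarrow> (\<exists>a<occs. occ_var a = x \<and> X a)" for x
  have \<alpha>: "\<alpha> (occ_var a) \<longleftrightarrow> X a" if "a < occs" for a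
    using ring_consistent[of X, OF step] that unfolding \<alpha>_def by blast
  have "\<exists>i<r. \<alpha> (var (j * r + i)) = sgn (j * r + i)" if j: "j < J" for j
  proof (rule ccontr)
    assume no: "\<not> ?thesis"
    have x: "\<not> val (2 * (j * width + i))" if i: "i < width" for i
    proof -
      let ?a = "j * width + i"
      have "\<alpha> (occ_var ?a) \<noteq> occ_sgn ?a"
        using no occ_decomp[OF j i] unfolding occ_var_def occ_sgn_def by auto
      then show ?thesis using \<alpha>[OF occ_decomp(1)[OF j i]] by (auto simp: X_def)
    qed
    \<comment> \<open>If all literals of the clause are false, the split clauses hand the statement
      that none has been true so far on to the end, where the last split clause fails.\<close>
    have y: "i \<noteq> 0 \<Longrightarrow> val (2 * (j * width + i) + 1)" if "i < width" for i
      using that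
    proof (induction i)
      case (Suc i)
      let ?a = "j * width + i"
      have i: "i < width" "i \<noteq> width - 1" using Suc.prems by auto
      note a = occ_decomp[OF j i(1)] and a' = occ_decomp[OF j Suc.prems(2)]
      obtain s where s: "s < 3" "\<And>g t. g < 2 * occs \<Longrightarrow> literal t \<Longrightarrow> cl g t = 2 * ?a \<Longrightarrow>
          seat g t = s \<Longrightarrow> lit_true (val g) t" using seats[of "2 * ?a"] by blast
      have "s = 0 \<or> s = 1 \<or> s = 2" using s(1) by auto
      then show ?case
      proof (elim disjE)
        assume "s = 0"
        then have "lit_true (val (2 * ?a)) 1"
          using a by (intro s(2)) (auto simp: literal_def cl_def seat_def Let_def)
        then show ?thesis using x[OF i(1)] by (simp add: lit_true_def)
      next
        assume s1: "s = 1"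
        show ?thesis
        proof (cases "i = 0")
          case True
          then have "lit_true (val (2 * ?a)) 11"
            using a s1 by (intro s(2)) (auto simp: literal_def cl_def seat_def Let_def)
          then show ?thesis by (simp add: lit_true_def)
        next
          case False
          then have "lit_true (val (2 * ?a + 1)) 3"
            using a s1 by (intro s(2)) (auto simp: literal_def cl_def seat_def Let_def)
          then show ?thesis using Suc.IH[OF False i(1)] by (simp add: lit_true_def)
        qed
      next
        assume "s = 2"
        then have "lit_true (val (2 * (j * width + Suc i) + 1)) 1"
          using a' by (intro s(2)) (auto simp: literal_def cl_def seat_def Let_def)
        then show ?thesis by (simp add: lit_true_def)
      qed
    qed simp
    let ?i = "width - 1"
    let ?a = "j * width + ?i"
    have i: "?i < width" "?i \<noteq> 0" using w by auto
    note a = occ_decomp[OF j i(1)]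
    obtain s where s: "s < 3" "\<And>g t. g < 2 * occs \<Longrightarrow> literal t \<Longrightarrow> cl g t = 2 * ?a \<Longrightarrow>
        seat g t = s \<Longrightarrow> lit_true (val g) t" using seats[of "2 * ?a"] by blast
    have "s = 0 \<or> s = 1 \<or> s = 2" using s(1) by auto
    then show False
    proof (elim disjE)
      assume "s = 0"
      then have "lit_true (val (2 * ?a)) 1"
        using a by (intro s(2)) (auto simp: literal_def cl_def seat_def Let_def)
      then show ?thesis using x[OF i(1)] by (simp add: lit_true_def)
    next
      assume "s = 1"
      then have "lit_true (val (2 * ?a + 1)) 3"
        using a i by (intro s(2)) (auto simp: literal_def cl_def seat_def Let_def)
      then show ?thesis using y[OF i] by (simp add: lit_true_def)
    next
      assume "s = 2"
      then have "lit_true (val (2 * ?a)) 11"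
        using a i by (intro s(2)) (auto simp: literal_def cl_def seat_def Let_def)
      then show ?thesis by (simp add: lit_true_def)
    qed
  qed
  then show ?thesis unfolding formula_sat_def by blast
qed

lemma formula_sat_imp_satisfied:
  assumes "formula_sat \<alpha>"
  shows "\<exists>val. satisfied val"
proof -
  have w: "0 < width" "width \<noteq> 1" using r_pos by (auto simp: width_def)
  define T where "T a \<longleftrightarrow> (\<alpha> (occ_var a) \<longleftrightarrow> occ_sgn a)" for a
  \<comment> \<open>The intended meaning of the gadgets; \<open>a - i\<close> is the first
    occurrence of the clause that contains \<open>a\<close>.\<close>
  define val where "val g \<longleftrightarrow> (let a = g div 2; i = a mod width in
    if g mod 2 = 0 then T a else (\<forall>k<i. \<not> T (a - i + k)))" for g
  have val: "val (2 * a) = T a" "val (2 * a + 1) = (\<forall>k<a mod width. \<not> T (a - a mod width + k))" for a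
    by (simp_all add: val_def Let_def)
  have "\<exists>s<3. lit_true (val (fst (owner c s))) (snd (owner c s)) \<or> (\<forall>g<2 * occs. \<forall>t. literal t \<longrightarrow>
      cl g t = c \<longrightarrow> seat g t \<noteq> s)" for c
  proof (cases "2 * occs \<le> c")
    case True
    have "seat g t \<noteq> 1" if g: "g < 2 * occs" and c: "cl g t = c" for g t
    proof -
      define a where "a = g div 2"
      have "a < occs" using g by (simp add: a_def)
      then have ne: "2 * a \<noteq> c" "2 * a + 1 \<noteq> c" "2 * prev a + 1 \<noteq> c"
        using True prev_occ(1)[of a] by linarith+
      show ?thesis
      proof (cases "g mod 2 = 0")
        case True
        show ?thesis
        proof
          assume "seat g t = 1"
          then have "t = 2 \<and> occ_sgn a \<or> t = 3 \<and> \<not> occ_sgn a \<or> t = 11 \<and> a mod width = 0"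
            using True unfolding seat_def Let_def a_def[symmetric] by (simp split: if_splits)
          then show False using True c ne unfolding cl_def Let_def a_def[symmetric] by (elim disjE) simp_all
        qed
      next
        case False
        show ?thesis
        proof
          assume "seat g t = 1"
          moreover have "seat g t = (if t = 1 \<and> a mod width \<noteq> 0 then 2
              else if t = 3 \<and> a mod width \<noteq> 0 then 1 else if t = 11 then 2 else 0)"
            unfolding seat_def Let_def a_def by (rule if_not_P[OF False])
          ultimately have t: "t = 3" "a mod width \<noteq> 0" by (metis numeral_eq_one_iff semiring_norm(85) zero_neq_one)+
          have "cl g t = 2 * a"
            unfolding cl_def Let_def a_def[symmetric] if_not_P[OF False] using t by simp
          then show False using c ne by simp
        qed
      qed
    qed
    then show ?thesis by (intro exI[of _ 1]) auto
  next
    case False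
    define q where "q = c div 2"
    define i where "i = q mod width"
    have q: "q < occs" using False by (simp add: q_def)
    have iw: "i < width" using w by (simp add: i_def)
    have base: "q = q div width * width + i" unfolding i_def by simp
    have "q div width < J" using q unfolding occs_def by (simp add: less_mult_imp_div_less)
    show ?thesis
    proof (cases "c mod 2 = 0")
      case True
      then have c: "c = 2 * q" by (auto simp: q_def)
      have own: "owner c 0 = (2 * q, 1)" "owner c 1 = (if i = 0 then (2 * q, 11) else (2 * q + 1, 3))"
        "owner c 2 = (if i = width - 1 then (2 * q, 11) else (2 * (q + 1) + 1, 1))"
        using False True by (simp_all add: owner_def Let_def q_def i_def)
      \<comment> \<open>In the third case no literal up to \<open>q\<close> is true. Since the
        clause of the formula is satisfied, \<open>q\<close> is not its last literal, and the
        auxiliary gadget of the next occurrence provides seat 2.\<close>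
      consider "T q" | "i \<noteq> 0" "\<not> val (2 * q + 1)" | "\<not> T q" "i = 0 \<or> val (2 * q + 1)"
        by metis
      then show ?thesis
      proof cases
        case 1
        then show ?thesis by (intro exI[of _ 0]) (simp add: own val lit_true_def)
      next
        case 2
        then show ?thesis by (intro exI[of _ 1]) (simp add: own(2)[simplified] lit_true_def)
      next
        case 3
        have "\<forall>k<i. \<not> T (q - i + k)" using 3(2) val(2)[of q] unfolding i_def by auto
        then have all: "\<not> T (q - i + k)" if "k < Suc i" for k
          using 3(1) that base by (cases "k = i") auto
        have qi: "q - i = q div width * width" using base by linarith
        have "i \<noteq> width - 1"
        proof
          assume i: "i = width - 1"
          obtain k where k: "k < r" "\<alpha> (var (q div width * r + k)) = sgn (q div width * r + k)"
            using assms \<open>q div width < J\<close> unfolding formula_sat_def by blast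
          have "2 * k < width" using k(1) by (simp add: width_def)
          then have "\<not> T (q div width * width + 2 * k)" using all[of "2 * k"] qi i by simp
          moreover have "(d * width + 2 * k) div 2 = d * r + k" for d
          proof -
            have half: "x = 2 * y \<Longrightarrow> x div 2 = y" for x y :: nat by simp
            show ?thesis by (rule half) (simp add: width_def algebra_simps)
          qed
          ultimately show False using k(2) unfolding T_def occ_var_def occ_sgn_def by simp
        qed
        moreover have "val (2 * (q + 1) + 1)"
        proof -
          have "Suc i \<noteq> width" using \<open>i \<noteq> width - 1\<close> by linarith
          then have m: "(q + 1) mod width = Suc i" unfolding i_def by (simp add: mod_Suc)
          have "q + 1 - Suc i = q - i" by simp
          then show ?thesis unfolding val(2)[of "q + 1"] m using all by simp
        qed
        ultimately show ?thesis by (intro exI[of _ 2]) (simp add: own(3) lit_true_def)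
      qed
    next
      case odd: False
      let ?q = "inv_into {..<occs} prev q"
      have own: "owner c 0 = (2 * q, if occ_sgn q then 3 else 2)"
        "owner c 1 = (2 * ?q, if occ_sgn ?q then 2 else 3)"
        using False odd by (simp_all add: owner_def Let_def q_def)
      show ?thesis
      proof (cases "\<alpha> (occ_var q)")
        case False
        then show ?thesis by (intro exI[of _ 0]) (simp add: own val lit_true_def T_def)
      next
        case True
        have surj: "prev ` {..<occs} = {..<occs}"
          using prev_inj prev_occ(1) by (intro endo_inj_surj) auto
        then have "q \<in> prev ` {..<occs}" using q by simp
        then have "?q \<in> {..<occs}" "prev ?q = q" by (rule inv_into_into, rule f_inv_into_f)
        then have "\<alpha> (occ_var ?q)" using prev_occ(2)[of ?q] True by simp
        then show ?thesis by (intro exI[of _ 1]) (simp add: own(2)[simplified] val lit_true_def T_def)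
      qed
    qed
  qed
  then have "satisfied val" unfolding satisfied_def using owner by (metis fst_conv snd_conv)
  then show ?thesis by blast
qed

theorem satisfiable_iff: "(\<exists>val. satisfied val) \<longleftrightarrow> (\<exists>\<alpha>. formula_sat \<alpha>)"
  using satisfied_imp_formula_sat formula_sat_imp_satisfied by blast

end


section \<open>The computation tableau\<close>

text \<open>
  The propositional variables state that at time \<open>t\<close> the state is \<open>q\<close> and the symbols scanned on the
  first tapes are \<open>as\<close> (\<open>Scan q as\<close>), that the head of tape \<open>l\<close> is at cell \<open>i\<close> (\<open>Head l\<close>), and that this
  tape has symbol \<open>s\<close> in cell \<open>i\<close> (\<open>Cell l s\<close>). Apart from the rules for the guessed cells, all rules are
  Horn clauses. Hence a satisfying assignment makes all facts about the actual run true; it may make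
  other facts true as well, but this does no harm.
\<close>

datatype atom = Scan nat "nat list" | Head nat | Cell nat nat

datatype time = Now | Next | Start | Final

datatype place = Origin | Here | Right | Left | Other | Home

datatype guard = Always | Inner | Distinct | Fixed nat | Guessed

type_synonym rule = "guard \<times> (bool \<times> atom \<times> time \<times> place) list"

text \<open>The part of \<open>pair_code x u\<close> that depends on \<open>x\<close> only: a marker
  \<open>True\<close> at each even place, the bits of \<open>x\<close> at the odd places, then the
  separator \<open>False\<close>, which is symbol 1, followed by blanks.\<close>

definition input_symbol :: "bool list \<Rightarrow> nat \<Rightarrow> nat" where
  "input_symbol x e = (if e < 2 * length x then (if e mod 2 = 0 \<or> bit x (e div 2) then 2 else 1)
     else if e = 2 * length x then 1 else 0)"

text \<open>Cell \<open>0\<close> of the tapes has index \<open>home\<close>, and the guessed word has length at most \<open>p\<close>.\<close>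

fun time_val :: "nat \<Rightarrow> time \<Rightarrow> nat \<Rightarrow> nat" where
  "time_val T Now t = t"
| "time_val T Next t = Suc t"
| "time_val T Start t = 0"
| "time_val T Final t = T"

fun place_val :: "nat \<Rightarrow> place \<Rightarrow> nat \<Rightarrow> nat \<Rightarrow> nat" where
  "place_val home Origin i j = 0"
| "place_val home Here i j = i"
| "place_val home Right i j = Suc i"
| "place_val home Left i j = i - 1"
| "place_val home Other i j = j"
| "place_val home Home i j = home"

fun guard_holds :: "bool list \<Rightarrow> nat \<Rightarrow> nat \<Rightarrow> guard \<Rightarrow> nat \<Rightarrow> nat \<Rightarrow> bool" where
  "guard_holds x p home Always i j \<longleftrightarrow> True"
| "guard_holds x p home Inner i j \<longleftrightarrow> 0 < i"
| "guard_holds x p home Distinct i j \<longleftrightarrow> i \<noteq> j"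
| "guard_holds x p home (Fixed s) i j \<longleftrightarrow> (i < home + 2 * length x + 1 \<or> home + 2 * length x + 1 + p \<le> i) \<and>
     s = (if i < home then 0 else input_symbol x (i - home))"
| "guard_holds x p home Guessed i j \<longleftrightarrow> home + 2 * length x + 1 \<le> i \<and> i < home + 2 * length x + 1 + p"

text \<open>The halting state is given a transition that rewrites the scanned symbols, so that the
  tableau can run on uniformly up to a fixed time.\<close>

definition transition :: "machine \<Rightarrow> nat \<Rightarrow> nat list \<Rightarrow> nat \<times> (nat \<times> move) list" where
  "transition M q as = (if q < nstates M then delta M q as else (q, map (\<lambda>a. (a, Stay)) as))"

fun move_place :: "move \<Rightarrow> place" where
  "move_place Move_Left = Left"
| "move_place Stay = Here"
| "move_place Move_Right = Right"

definition symbol_words :: "machine \<Rightarrow> nat list set" where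
  "symbol_words M = {as. set as \<subseteq> {..<nsyms M} \<and> length as \<le> ntapes M}"

text \<open>The scanned word is assembled tape by tape; thus four literals per clause suffice for
  any number of tapes.\<close>

definition scan_rules :: "machine \<Rightarrow> rule set" where
  "scan_rules M = (\<lambda>(q, as, s). (Always, [(False, Scan q as, Now, Origin),
     (False, Head (length as), Now, Here), (False, Cell (length as) s, Now, Here),
     (True, Scan q (as @ [s]), Now, Origin)])) ` ({..nstates M} \<times> symbol_words M \<times> {..<nsyms M})"

definition state_rules :: "machine \<Rightarrow> rule set" where
  "state_rules M = (\<lambda>(q, as). (Always, [(False, Scan q as, Now, Origin),
     (True, Scan (fst (transition M q as)) [], Next, Origin)])) `
     ({..nstates M} \<times> {as \<in> symbol_words M. length as = ntapes M})"

text \<open>The guard excludes index 0, at which the truncated \<open>i - 1\<close> would not be the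
  left neighbor.\<close>

definition head_rules :: "machine \<Rightarrow> rule set" where
  "head_rules M = (\<lambda>(q, as, l). (Inner, [(False, Scan q as, Now, Origin), (False, Head l, Now, Here),
     (True, Head l, Next, move_place (snd (snd (transition M q as) ! l)))])) `
     ({..nstates M} \<times> {as \<in> symbol_words M. length as = ntapes M} \<times> {..<ntapes M})"

definition write_rules :: "machine \<Rightarrow> rule set" where
  "write_rules M = (\<lambda>(q, as, l). (Always, [(False, Scan q as, Now, Origin), (False, Head l, Now, Here),
     (True, Cell l (fst (snd (transition M q as) ! l)), Next, Here)])) `
     ({..nstates M} \<times> {as \<in> symbol_words M. length as = ntapes M} \<times> {..<ntapes M})"

definition keep_rules :: "machine \<Rightarrow> rule set" where
  "keep_rules M = (\<lambda>(l, s). (Distinct, [(False, Cell l s, Now, Here), (False, Head l, Now, Other),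
     (True, Cell l s, Next, Here)])) ` ({..<ntapes M} \<times> {..<nsyms M})"

text \<open>A guessed cell has some symbol, and blanks are followed by blanks, so that the guessed
  cells form a word. The only purely negative clause forbids that the output begins with symbol 1,
  the bit \<open>False\<close>.\<close>

definition boundary_rules :: "machine \<Rightarrow> rule set" where
  "boundary_rules M = {(Always, [(True, Scan 0 [], Start, Origin)]),
      (Guessed, [(True, Cell 0 0, Start, Here), (True, Cell 0 1, Start, Here), (True, Cell 0 2, Start, Here)]),
      (Guessed, [(False, Cell 0 0, Start, Here), (True, Cell 0 0, Start, Right)]),
      (Always, [(False, Cell 1 1, Final, Home)])} \<union>
    (\<lambda>l. (Always, [(True, Head l, Start, Home)])) ` {..<ntapes M} \<union>
    (\<lambda>l. (Always, [(True, Cell l 0, Start, Here)])) ` {1..<ntapes M} \<union>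
    (\<lambda>s. (Fixed s, [(True, Cell 0 s, Start, Here)])) ` {..<3}"

definition rules :: "machine \<Rightarrow> rule set" where
  "rules M = scan_rules M \<union> state_rules M \<union> head_rules M \<union> write_rules M \<union> keep_rules M \<union> boundary_rules M"

lemma finite_rules: "finite (rules M)"
proof -
  have "finite (symbol_words M)"
    unfolding symbol_words_def by (rule finite_lists_length_le) simp
  then show ?thesis
    unfolding rules_def scan_rules_def state_rules_def head_rules_def write_rules_def keep_rules_def
      boundary_rules_def by simp
qed

lemma rule_length: "(gd, ls) \<in> rules M \<Longrightarrow> ls \<noteq> [] \<and> length ls \<le> 4"
  unfolding rules_def scan_rules_def state_rules_def head_rules_def write_rules_def keep_rules_def
    boundary_rules_def by auto

lemma contents_int: "contents w (int e) = (if e < length w then if w ! e then 2 else 1 else 0)"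
  by (simp add: contents_def)

lemma contents_pair_code:
  "contents (pair_code x u) (int e) =
     (if e < 2 * length x + 1 then input_symbol x e else contents u (int (e - (2 * length x + 1))))"
proof -
  have len: "length (concat (map (\<lambda>b. [True, b]) y)) = 2 * length y" for y :: "bool list"
    by (induction y) auto
  have nth: "concat (map (\<lambda>b. [True, b]) y) ! e = (e mod 2 = 0 \<or> y ! (e div 2))"
    if "e < 2 * length y" for y :: "bool list" and e
    using that
  proof (induction y arbitrary: e)
    case (Cons b y)
    then show ?case by (cases e; cases "e - 1") auto
  qed simp
  let ?y = "concat (map (\<lambda>b. [True, b]) x)"
  consider "e < 2 * length x" | "e = 2 * length x" | d where "e = 2 * length x + 1 + d"
    by (metis Suc_eq_plus1 less_iff_Suc_add linorder_neqE_nat plus_1_eq_Suc add.assoc add.commute)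
  then show ?thesis
  proof cases
    case 1
    then have "(?y @ False # u) ! e = (e mod 2 = 0 \<or> x ! (e div 2))" using nth[of e x] len[of x]
      by (simp add: nth_append)
    moreover have "e div 2 < length x" using 1 by simp
    ultimately show ?thesis using 1 len[of x]
      unfolding contents_int pair_code_def input_symbol_def bit_def by simp
  next
    case 2
    then show ?thesis using len[of x] unfolding contents_int pair_code_def input_symbol_def
      by (simp add: nth_append)
  next
    case (3 d)
    then show ?thesis using len[of x] unfolding contents_int pair_code_def by (simp add: nth_append)
  qed
qed

locale tableau =
  fixes M :: machine and x :: "bool list" and p T :: nat
  assumes wf: "wf_machine M" and T_ge: "2 * length x + 1 + p \<le> T"
begin

definition home :: nat where "home = T + 1"

text \<open>Up to time \<open>T\<close> the heads stay within distance \<open>T\<close> of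
  \<open>home\<close>, so at indices from 1 to \<open>2 * T + 1\<close>; there is one spare index at
  each end.\<close>

definition range :: nat where "range = 2 * T + 3"

definition rule_holds :: "(atom \<Rightarrow> nat \<Rightarrow> nat \<Rightarrow> bool) \<Rightarrow> rule \<Rightarrow> nat \<Rightarrow> nat \<Rightarrow> nat \<Rightarrow> bool" where
  "rule_holds \<alpha> ru t i j \<longleftrightarrow> (guard_holds x p home (fst ru) i j \<longrightarrow>
     (\<exists>(b, a, tm, pl) \<in> set (snd ru). \<alpha> a (time_val T tm t) (place_val home pl i j) = b))"

definition model :: "(atom \<Rightarrow> nat \<Rightarrow> nat \<Rightarrow> bool) \<Rightarrow> bool" where
  "model \<alpha> \<longleftrightarrow> (\<forall>ru\<in>rules M. \<forall>t<range. \<forall>i<range. \<forall>j<range. rule_holds \<alpha> ru t i j)"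

lemma range_pos: "0 < range" by (simp add: range_def)

lemma modelD: "model \<alpha> \<Longrightarrow> ru \<in> rules M \<Longrightarrow> t < range \<Longrightarrow> i < range \<Longrightarrow> j < range \<Longrightarrow> rule_holds \<alpha> ru t i j"
  unfolding model_def by blast

section \<open>The actual run\<close>

definition config_at :: "bool list \<Rightarrow> nat \<Rightarrow> config" where
  "config_at u t = (step M ^^ t) (initial M (pair_code x u))"

definition state_at :: "bool list \<Rightarrow> nat \<Rightarrow> nat" where "state_at u t = fst (config_at u t)"

definition tapes_at :: "bool list \<Rightarrow> nat \<Rightarrow> tape list" where "tapes_at u t = snd (config_at u t)"

definition syms_at :: "bool list \<Rightarrow> nat \<Rightarrow> nat list" where "syms_at u t = map scanned (tapes_at u t)"

definition act_at :: "bool list \<Rightarrow> nat \<Rightarrow> nat \<Rightarrow> nat \<times> move" where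
  "act_at u t l = snd (transition M (state_at u t) (syms_at u t)) ! l"

definition cell :: "nat \<Rightarrow> int" where "cell i = int i - int home"

text \<open>The bounds on states, symbols and head positions guarantee that every step of the run is
  an instance of one of the finitely many rules, with parameters in range.\<close>

lemma invariant:
  "length (tapes_at u t) = ntapes M \<and> state_at u t \<le> nstates M \<and>
   (\<forall>l<ntapes M. (\<forall>z. fst (tapes_at u t ! l) z < nsyms M) \<and> \<bar>snd (tapes_at u t ! l)\<bar> \<le> int t)"
  "state_at u (Suc t) = fst (transition M (state_at u t) (syms_at u t))"
  "l < ntapes M \<Longrightarrow> tapes_at u (Suc t) ! l = act (act_at u t l) (tapes_at u t ! l)"
proof -
  have st: "config_at u (Suc t) = (let (q', as) = transition M (state_at u t) (syms_at u t) in
      (q', map2 act as (tapes_at u t)))" for t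
  proof -
    have "map2 act (map (\<lambda>a. (a, Stay)) (map scanned tps)) tps = tps" for tps
      by (induction tps) (auto simp: act_def scanned_def)
    then show ?thesis
      unfolding config_at_def state_at_def tapes_at_def syms_at_def
      by (auto simp: step_def transition_def split: prod.splits)
  qed
  have fac: "length (snd (transition M q as)) = ntapes M \<and> fst (transition M q as) \<le> nstates M \<and>
      (\<forall>l<ntapes M. fst (snd (transition M q as) ! l) < nsyms M)"
    if "q \<le> nstates M" "length as = ntapes M" "set as \<subseteq> {..<nsyms M}" for q as
  proof (cases "q < nstates M")
    case True
    then have "fst (delta M q as) \<le> nstates M" "length (snd (delta M q as)) = ntapes M"
      "\<forall>(a, d) \<in> set (snd (delta M q as)). a < nsyms M"
      using wf that unfolding wf_machine_def by blast+
    moreover have "fst (snd (delta M q as) ! l) < nsyms M" if "l < ntapes M" for l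
    proof -
      have "snd (delta M q as) ! l \<in> set (snd (delta M q as))" using calculation(2) that by simp
      then have "case snd (delta M q as) ! l of (a, d) \<Rightarrow> a < nsyms M" by (rule bspec[OF calculation(3)])
      then show ?thesis by (simp add: case_prod_beta)
    qed
    ultimately show ?thesis using True by (simp add: transition_def)
  next
    case False
    have "as ! l < nsyms M" if "l < ntapes M" for l
      using subsetD[OF \<open>set as \<subseteq> {..<nsyms M}\<close> nth_mem[of l as]] that \<open>length as = ntapes M\<close> by simp
    then show ?thesis using that False by (simp add: transition_def)
  qed
  have syms: "length (syms_at u t) = ntapes M" "set (syms_at u t) \<subseteq> {..<nsyms M}"
    if inv: "length (tapes_at u t) = ntapes M \<and> state_at u t \<le> nstates M \<and>
      (\<forall>l<ntapes M. (\<forall>z. fst (tapes_at u t ! l) z < nsyms M) \<and> \<bar>snd (tapes_at u t ! l)\<bar> \<le> int t)" for t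
  proof -
    show "length (syms_at u t) = ntapes M" using inv by (simp add: syms_at_def)
    show "set (syms_at u t) \<subseteq> {..<nsyms M}"
    proof
      fix s assume "s \<in> set (syms_at u t)"
      then obtain l where l: "l < ntapes M" "s = fst (tapes_at u t ! l) (snd (tapes_at u t ! l))"
        using inv by (auto simp: in_set_conv_nth syms_at_def scanned_def)
      then show "s \<in> {..<nsyms M}" using inv by blast
    qed
  qed
  have inv: "length (tapes_at u t) = ntapes M \<and> state_at u t \<le> nstates M \<and>
    (\<forall>l<ntapes M. (\<forall>z. fst (tapes_at u t ! l) z < nsyms M) \<and> \<bar>snd (tapes_at u t ! l)\<bar> \<le> int t)" for t
  proof (induction t)
    case 0
    have "3 \<le> nsyms M" "2 \<le> ntapes M" using wf by (auto simp: wf_machine_def)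
    then show ?case
      by (auto simp: tapes_at_def state_at_def config_at_def initial_def nth_Cons' contents_def)
  next
    case (Suc t)
    note syms = syms[OF Suc]
    note f = fac[OF conjunct1[OF conjunct2[OF Suc]] syms]
    have mv: "\<bar>move_head d z\<bar> \<le> \<bar>z\<bar> + 1" for d z by (cases d) auto
    have tp: "tapes_at u (Suc t) ! l = act (act_at u t l) (tapes_at u t ! l)" if "l < ntapes M" for l
      using st[of t] f Suc that by (auto simp: tapes_at_def act_at_def split: prod.splits)
    have "\<bar>snd (tapes_at u (Suc t) ! l)\<bar> \<le> int (Suc t)" if "l < ntapes M" for l
      using tp[OF that] mv[of "snd (act_at u t l)" "snd (tapes_at u t ! l)"] Suc that
      by (force simp: act_def)
    moreover have "fst (tapes_at u (Suc t) ! l) z < nsyms M" if "l < ntapes M" for l z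
      using tp[OF that] f Suc that by (auto simp: act_def act_at_def)
    moreover have "length (tapes_at u (Suc t)) = ntapes M" "state_at u (Suc t) \<le> nstates M"
      using st[of t] f Suc by (auto simp: tapes_at_def state_at_def split: prod.splits)
    ultimately show ?case by blast
  qed
  then show "length (tapes_at u t) = ntapes M \<and> state_at u t \<le> nstates M \<and>
    (\<forall>l<ntapes M. (\<forall>z. fst (tapes_at u t ! l) z < nsyms M) \<and> \<bar>snd (tapes_at u t ! l)\<bar> \<le> int t)" .
  show "state_at u (Suc t) = fst (transition M (state_at u t) (syms_at u t))"
    using st[of t] by (auto simp: state_at_def split: prod.splits)
  note syms = syms[OF inv[of t]]
  show "l < ntapes M \<Longrightarrow> tapes_at u (Suc t) ! l = act (act_at u t l) (tapes_at u t ! l)"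
    using st[of t] fac[OF conjunct1[OF conjunct2[OF inv[of t]]] syms] inv[of t]
    by (auto simp: tapes_at_def act_at_def split: prod.splits)
qed

lemma syms_at: "length (syms_at u t) = ntapes M" "set (syms_at u t) \<subseteq> {..<nsyms M}"
  "l < ntapes M \<Longrightarrow> syms_at u t ! l = fst (tapes_at u t ! l) (snd (tapes_at u t ! l))"
proof -
  note inv = invariant(1)[of u t]
  show "length (syms_at u t) = ntapes M" using inv by (simp add: syms_at_def)
  show nth: "syms_at u t ! l = fst (tapes_at u t ! l) (snd (tapes_at u t ! l))" if "l < ntapes M" for l
    using inv that by (simp add: syms_at_def scanned_def)
  show "set (syms_at u t) \<subseteq> {..<nsyms M}"
  proof
    fix s assume "s \<in> set (syms_at u t)"
    then obtain l where l: "l < ntapes M" "s = syms_at u t ! l"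
      using inv by (auto simp: in_set_conv_nth syms_at_def)
    then show "s \<in> {..<nsyms M}" using inv unfolding l(2) nth[OF l(1)] by blast
  qed
qed

definition actual :: "bool list \<Rightarrow> atom \<Rightarrow> nat \<Rightarrow> nat \<Rightarrow> bool" where
  "actual u a t i = (case a of
      Scan q as \<Rightarrow> q = state_at u t \<and> as = take (length as) (syms_at u t)
    | Head l \<Rightarrow> l < ntapes M \<and> snd (tapes_at u t ! l) = cell i
    | Cell l s \<Rightarrow> fst (tapes_at u t ! l) (cell i) = s)"

lemma tapes_initial:
  "fst (tapes_at u 0 ! 0) = contents (pair_code x u)"
  "0 < l \<Longrightarrow> l < ntapes M \<Longrightarrow> fst (tapes_at u 0 ! l) = contents []"
  "l < ntapes M \<Longrightarrow> snd (tapes_at u 0 ! l) = 0" "state_at u 0 = 0"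
  by (auto simp: tapes_at_def state_at_def config_at_def initial_def nth_Cons')

lemma initial_symbol:
  assumes "length u \<le> p" "i < home + 2 * length x + 1 \<or> home + 2 * length x + 1 + p \<le> i"
  shows "contents (pair_code x u) (cell i) = (if i < home then 0 else input_symbol x (i - home))"
proof (cases "i < home")
  case True
  then show ?thesis by (simp add: contents_def cell_def)
next
  case False
  then have c: "cell i = int (i - home)" by (simp add: cell_def)
  show ?thesis
  proof (cases "i - home < 2 * length x + 1")
    case True
    then show ?thesis using False unfolding c contents_pair_code by simp
  next
    case big: False
    then have 0: "\<not> i - home - (2 * length x + 1) < length u" "input_symbol x (i - home) = 0"
      using False assms by (auto simp: input_symbol_def)
    have "contents (pair_code x u) (cell i) = contents u (int (i - home - (2 * length x + 1)))"
      unfolding c contents_pair_code by (rule if_not_P[OF big])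
    also have "\<dots> = 0" unfolding contents_int by (rule if_not_P[OF 0(1)])
    finally show ?thesis using False 0(2) by simp
  qed
qed

lemma guessed_symbol:
  assumes "home + 2 * length x + 1 \<le> i"
  shows "contents (pair_code x u) (cell i) = contents u (int (i - (home + 2 * length x + 1)))"
proof -
  have "cell i = int (i - home)" using assms by (simp add: cell_def)
  moreover have "i - home - (2 * length x + 1) = i - (home + 2 * length x + 1)" by simp
  moreover have "\<not> i - home < 2 * length x + 1" using assms by simp
  ultimately show ?thesis using contents_pair_code[of x u "i - home"] by (simp only: if_False)
qed

lemma actual_model:
  assumes u: "length u \<le> p" and acc: "fst (tapes_at u T ! 1) 0 \<noteq> 1"
  shows "model (actual u)"
  unfolding model_def rules_def
proof (intro ballI allI impI, elim UnE)
  fix ru t i j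
  have full: "as = syms_at u t" if "length as = ntapes M" "as = take (length as) (syms_at u t)" for as
    using that syms_at(1) by simp
  {
    assume "ru \<in> scan_rules M"
    then obtain q as s where ru: "ru = (Always, [(False, Scan q as, Now, Origin),
     (False, Head (length as), Now, Here), (False, Cell (length as) s, Now, Here),
     (True, Scan q (as @ [s]), Now, Origin)])" unfolding scan_rules_def by auto
    \<comment> \<open>A word that already covers all tapes is not extended, since
      \<open>Head (length as)\<close> is then false.\<close>
    have "actual u (Scan q (as @ [s])) t 0" if "actual u (Scan q as) t 0" "actual u (Head (length as)) t i"
        "actual u (Cell (length as) s) t i"
      using that syms_at(1)[of u t] syms_at(3)[of "length as" u t]
      by (simp add: actual_def take_Suc_conv_app_nth)
    then show "rule_holds (actual u) ru t i j" unfolding ru rule_holds_def by auto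
  next
    assume "ru \<in> state_rules M"
    then obtain q as where ru: "ru = (Always, [(False, Scan q as, Now, Origin),
     (True, Scan (fst (transition M q as)) [], Next, Origin)])" "length as = ntapes M"
      unfolding state_rules_def by auto
    have "actual u (Scan (fst (transition M q as)) []) (Suc t) 0" if "actual u (Scan q as) t 0"
      using that full[OF ru(2)] invariant(2) by (auto simp: actual_def)
    then show "rule_holds (actual u) ru t i j" unfolding ru rule_holds_def by auto
  next
    assume "ru \<in> head_rules M"
    then obtain q as l where ru: "ru = (Inner, [(False, Scan q as, Now, Origin), (False, Head l, Now, Here),
     (True, Head l, Next, move_place (snd (snd (transition M q as) ! l)))])" "length as = ntapes M" "l < ntapes M"
      unfolding head_rules_def by auto
    have pl: "cell (place_val home (move_place d) i j) = move_head d (cell i)" if "0 < i" for d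
      using that by (cases d) (auto simp: cell_def)
    have "actual u (Head l) (Suc t) (place_val home (move_place (snd (snd (transition M q as) ! l))) i j)"
      if "actual u (Scan q as) t 0" "actual u (Head l) t i" "0 < i"
    proof -
      have "as = syms_at u t" "q = state_at u t" using full[OF ru(2)] that(1) by (auto simp: actual_def)
      then show ?thesis using that(2) pl[OF that(3)] invariant(3)[OF ru(3), of u t]
        by (simp add: actual_def act_def act_at_def)
    qed
    then show "rule_holds (actual u) ru t i j" unfolding ru(1) rule_holds_def by auto
  next
    assume "ru \<in> write_rules M"
    then obtain q as l where ru: "ru = (Always, [(False, Scan q as, Now, Origin), (False, Head l, Now, Here),
     (True, Cell l (fst (snd (transition M q as) ! l)), Next, Here)])" "length as = ntapes M" "l < ntapes M"
      unfolding write_rules_def by auto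
    have "actual u (Cell l (fst (snd (transition M q as) ! l))) (Suc t) i"
      if "actual u (Scan q as) t 0" "actual u (Head l) t i"
    proof -
      have "as = syms_at u t" "q = state_at u t" using full[OF ru(2)] that(1) by (auto simp: actual_def)
      then show ?thesis using that(2) invariant(3)[OF ru(3), of u t]
        by (simp add: actual_def act_def act_at_def)
    qed
    then show "rule_holds (actual u) ru t i j" unfolding ru(1) rule_holds_def by auto
  next
    assume "ru \<in> keep_rules M"
    then obtain l s where ru: "ru = (Distinct, [(False, Cell l s, Now, Here), (False, Head l, Now, Other),
     (True, Cell l s, Next, Here)])" "l < ntapes M" unfolding keep_rules_def by auto
    have "actual u (Cell l s) (Suc t) i" if "actual u (Cell l s) t i" "actual u (Head l) t j" "i \<noteq> j"
      using that invariant(3)[OF ru(2), of u t] by (auto simp: actual_def act_def cell_def)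
    then show "rule_holds (actual u) ru t i j" unfolding ru(1) rule_holds_def by auto
  next
    assume "ru \<in> boundary_rules M"
    then consider "ru = (Always, [(True, Scan 0 [], Start, Origin)])"
      | "ru = (Guessed, [(True, Cell 0 0, Start, Here), (True, Cell 0 1, Start, Here), (True, Cell 0 2, Start, Here)])"
      | "ru = (Guessed, [(False, Cell 0 0, Start, Here), (True, Cell 0 0, Start, Right)])"
      | "ru = (Always, [(False, Cell 1 1, Final, Home)])"
      | l where "ru = (Always, [(True, Head l, Start, Home)])" "l < ntapes M"
      | l where "ru = (Always, [(True, Cell l 0, Start, Here)])" "0 < l" "l < ntapes M"
      | s where "ru = (Fixed s, [(True, Cell 0 s, Start, Here)])"
      unfolding boundary_rules_def by (elim UnE imageE insertE emptyE; auto)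
    then show "rule_holds (actual u) ru t i j"
    proof cases
      case 1
      have "actual u (Scan 0 []) 0 0" by (simp add: actual_def tapes_initial)
      then show ?thesis unfolding 1 rule_holds_def by simp
    next
      case 2
      have "contents w z \<in> {0, 1, 2}" for w z by (simp add: contents_def)
      then have "actual u (Cell 0 0) 0 i \<or> actual u (Cell 0 1) 0 i \<or> actual u (Cell 0 2) 0 i"
        by (simp add: actual_def tapes_initial)
      then show ?thesis unfolding 2 rule_holds_def by simp
    next
      case 3
      have "actual u (Cell 0 0) 0 (Suc i)"
        if i: "home + 2 * length x + 1 \<le> i" and 0: "actual u (Cell 0 0) 0 i"
      proof -
        have "\<not> i - (home + 2 * length x + 1) < length u"
          using 0 guessed_symbol[OF i, of u] unfolding contents_int
          by (auto simp: actual_def tapes_initial(1) split: if_splits)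
        then have "\<not> Suc i - (home + 2 * length x + 1) < length u" using i by linarith
        moreover have "home + 2 * length x + 1 \<le> Suc i" using i by linarith
        ultimately show ?thesis using guessed_symbol[of "Suc i" u] unfolding contents_int
          by (simp add: actual_def tapes_initial(1))
      qed
      then show ?thesis unfolding 3 rule_holds_def by auto
    next
      case 4
      have "\<not> actual u (Cell 1 1) T home" using acc by (simp add: actual_def cell_def)
      then show ?thesis unfolding 4 rule_holds_def by simp
    next
      case (5 l)
      have "actual u (Head l) 0 home" using 5(2) by (simp add: actual_def tapes_initial cell_def)
      then show ?thesis unfolding 5(1) rule_holds_def by simp
    next
      case (6 l)
      have "actual u (Cell l 0) 0 i" using 6 by (simp add: actual_def tapes_initial contents_def)
      then show ?thesis unfolding 6(1) rule_holds_def by simp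
    next
      case (7 s)
      have "actual u (Cell 0 s) 0 i" if "guard_holds x p home (Fixed s) i j"
        using that initial_symbol[OF u, of i] by (simp add: actual_def tapes_initial)
      then show ?thesis unfolding 7 rule_holds_def by simp
    qed
  }
qed

text \<open>The rules are implications with one conclusion, so each fact of the run is derived from
  facts at the previous time. Nothing is claimed about facts that do not belong to the run.\<close>

lemma model_imp_actual:
  assumes \<alpha>: "model \<alpha>"
    and init: "\<And>i. 0 < i \<Longrightarrow> i < range - 1 \<Longrightarrow> \<alpha> (Cell 0 (contents (pair_code x u) (cell i))) 0 i"
    and t: "t \<le> T"
  shows "\<alpha> (Scan (state_at u t) []) t 0 \<and>
    (\<forall>l<ntapes M. \<alpha> (Head l) t (nat (snd (tapes_at u t ! l) + int home)) \<and>
      (\<forall>i. 0 < i \<longrightarrow> i < range - 1 \<longrightarrow> \<alpha> (Cell l (fst (tapes_at u t ! l) (cell i))) t i))"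
  using t
proof (induction t)
  case 0
  have bd: "\<exists>(b, a, tm, pl) \<in> set ls. \<alpha> a (time_val T tm 0) (place_val home pl i 0) = b"
    if "(Always, ls) \<in> boundary_rules M" "i < range" for ls i
    using modelD[OF \<alpha> _ range_pos that(2) range_pos, of "(Always, ls)"] that(1)
    by (simp add: rules_def rule_holds_def)
  have 1: "\<alpha> (Scan 0 []) 0 0" using bd[of "[(True, Scan 0 [], Start, Origin)]" 0] range_pos
    by (simp add: boundary_rules_def)
  have 2: "\<alpha> (Head l) 0 home" if "l < ntapes M" for l
    using bd[of "[(True, Head l, Start, Home)]" 0] that range_pos by (simp add: boundary_rules_def)
  have 3: "\<alpha> (Cell l (fst (tapes_at u 0 ! l) (cell i))) 0 i"
    if l: "l < ntapes M" and i: "0 < i" "i < range - 1" for l i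
  proof (cases "l = 0")
    case True
    then show ?thesis using init[OF i] tapes_initial(1) by simp
  next
    case False
    have "i < range" using i by linarith
    then have "\<alpha> (Cell l 0) 0 i"
      using bd[of "[(True, Cell l 0, Start, Here)]" i] l False by (simp add: boundary_rules_def)
    moreover have "fst (tapes_at u 0 ! l) (cell i) = 0"
      using tapes_initial(2)[of l u] l False by (simp add: contents_def)
    ultimately show ?thesis by simp
  qed
  show ?case using 1 2 3 by (simp add: tapes_initial(3,4))
next
  case (Suc t)
  have tT: "t < T" "t < range" using Suc.prems by (auto simp: range_def)
  let ?h = "\<lambda>t l. nat (snd (tapes_at u t ! l) + int home)"
  have bound: "0 < ?h s l" "?h s l < range - 1" "cell (?h s l) = snd (tapes_at u s ! l)"
    if "s \<le> T" "l < ntapes M" for s l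
  proof -
    have "\<bar>snd (tapes_at u s ! l)\<bar> \<le> int T" using invariant(1)[of u s] that by force
    then show "0 < ?h s l" "?h s l < range - 1" "cell (?h s l) = snd (tapes_at u s ! l)"
      by (auto simp: home_def range_def cell_def)
  qed
  have IH: "\<alpha> (Scan (state_at u t) []) t 0" "\<And>l. l < ntapes M \<Longrightarrow> \<alpha> (Head l) t (?h t l)"
    "\<And>l i. l < ntapes M \<Longrightarrow> 0 < i \<Longrightarrow> i < range - 1 \<Longrightarrow> \<alpha> (Cell l (fst (tapes_at u t ! l) (cell i))) t i"
    using Suc.IH tT by auto
  have use: "\<exists>(b, a, tm, pl) \<in> set ls. \<alpha> a (time_val T tm t) (place_val home pl i j) = b"
    if "(gd, ls) \<in> rules M" "guard_holds x p home gd i j" "i < range" "j < range" for gd ls i j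
    using modelD[OF \<alpha> that(1) tT(2) that(3,4)] that(2) by (simp add: rule_holds_def)
  let ?q = "state_at u t" and ?as = "syms_at u t"
  have q: "?q \<in> {..nstates M}" using invariant(1)[of u t] by simp
  have pre: "\<alpha> (Scan ?q (take l ?as)) t 0" if "l \<le> ntapes M" for l
    using that
  proof (induction l)
    case (Suc l)
    then have l: "l < ntapes M" by simp
    let ?i = "?h t l" and ?as' = "take l ?as"
    have len: "length ?as' = l" using l syms_at(1)[of u t] by simp
    have s: "?as ! l = fst (tapes_at u t ! l) (cell ?i)" "?as ! l \<in> {..<nsyms M}"
      using syms_at(3)[OF l, of u t] bound[OF _ l, of t] tT invariant(1)[of u t] l by auto
    have as': "?as' \<in> symbol_words M"
      using syms_at(2)[of u t] len l by (auto simp: symbol_words_def dest: in_set_takeD)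
    have "(Always, [(False, Scan ?q ?as', Now, Origin), (False, Head l, Now, Here),
        (False, Cell l (?as ! l), Now, Here), (True, Scan ?q (?as' @ [?as ! l]), Now, Origin)]) \<in> rules M"
      unfolding rules_def scan_rules_def using q as' s(2) len
      by (intro UnI1 image_eqI[of _ _ "(?q, ?as', ?as ! l)"]) auto
    from use[OF this, of ?i 0] have "\<alpha> (Scan ?q (?as' @ [?as ! l])) t 0"
      using Suc IH(2)[OF l] IH(3)[OF l, of ?i] s(1) bound[OF _ l, of t] tT l by (auto simp: range_def)
    then show ?case using l syms_at(1)[of u t] by (simp add: take_Suc_conv_app_nth)
  qed (use IH in simp)
  then have all: "\<alpha> (Scan ?q ?as) t 0" using syms_at(1)[of u t] by (metis order_refl take_all_iff)
  have as: "?as \<in> {as \<in> symbol_words M. length as = ntapes M}"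
    using syms_at(1,2)[of u t] by (auto simp: symbol_words_def)
  have "(Always, [(False, Scan ?q ?as, Now, Origin), (True, Scan (fst (transition M ?q ?as)) [], Next, Origin)])
      \<in> rules M"
    unfolding rules_def state_rules_def using q as by (auto intro!: image_eqI[of _ _ "(?q, ?as)"])
  from use[OF this, of 0 0] have 1: "\<alpha> (Scan (state_at u (Suc t)) []) (Suc t) 0"
    using all unfolding invariant(2) by (simp add: range_def)
  have 2: "\<alpha> (Head l) (Suc t) (?h (Suc t) l)" if l: "l < ntapes M" for l
  proof -
    let ?d = "snd (act_at u t l)"
    have "(Inner, [(False, Scan ?q ?as, Now, Origin), (False, Head l, Now, Here),
        (True, Head l, Next, move_place (snd (snd (transition M ?q ?as) ! l)))]) \<in> rules M"
      unfolding rules_def head_rules_def using q as l by (auto intro!: image_eqI[of _ _ "(?q, ?as, l)"])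
    from use[OF this, of "?h t l" 0] have "\<alpha> (Head l) (Suc t) (place_val home (move_place ?d) (?h t l) 0)"
      using all IH(2)[OF l] bound[OF _ l, of t] tT by (simp add: act_at_def range_def)
    moreover have "place_val home (move_place ?d) (?h t l) 0 = ?h (Suc t) l"
      unfolding invariant(3)[OF l] using bound(1)[OF _ l, of t] tT by (cases ?d) (auto simp: act_def)
    ultimately show ?thesis by simp
  qed
  have 3: "\<alpha> (Cell l (fst (tapes_at u (Suc t) ! l) (cell i))) (Suc t) i"
    if l: "l < ntapes M" and i: "0 < i" "i < range - 1" for l i
  proof (cases "i = ?h t l")
    case True
    have "(Always, [(False, Scan ?q ?as, Now, Origin), (False, Head l, Now, Here),
        (True, Cell l (fst (snd (transition M ?q ?as) ! l)), Next, Here)]) \<in> rules M"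
      unfolding rules_def write_rules_def using q as l by (auto intro!: image_eqI[of _ _ "(?q, ?as, l)"])
    from use[OF this, of i 0] have "\<alpha> (Cell l (fst (act_at u t l))) (Suc t) i"
      using all IH(2)[OF l] True i by (simp add: act_at_def range_def)
    moreover have "fst (tapes_at u (Suc t) ! l) (cell i) = fst (act_at u t l)"
      unfolding invariant(3)[OF l] using bound(3)[OF _ l, of t] tT True by (simp add: act_def)
    ultimately show ?thesis by simp
  next
    case False
    let ?s = "fst (tapes_at u t ! l) (cell i)"
    have "?s < nsyms M" using invariant(1)[of u t] l by blast
    then have "(Distinct, [(False, Cell l ?s, Now, Here), (False, Head l, Now, Other),
        (True, Cell l ?s, Next, Here)]) \<in> rules M"
      unfolding rules_def keep_rules_def using l by (auto intro!: image_eqI[of _ _ "(l, ?s)"])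
    from use[OF this, of i "?h t l"] have "\<alpha> (Cell l ?s) (Suc t) i"
      using IH(2)[OF l] IH(3)[OF l i] False i bound(2)[OF _ l, of t] tT by simp
    moreover have "cell i \<noteq> snd (tapes_at u t ! l)" using False by (auto simp: cell_def)
    then have "fst (tapes_at u (Suc t) ! l) (cell i) = ?s"
      unfolding invariant(3)[OF l] by (simp add: act_def)
    ultimately show ?thesis by simp
  qed
  show ?case using 1 2 3 by blast
qed

lemma guessed_word:
  assumes "model \<alpha>"
  obtains u where "length u \<le> p"
    "\<And>i. 0 < i \<Longrightarrow> i < range - 1 \<Longrightarrow> \<alpha> (Cell 0 (contents (pair_code x u) (cell i))) 0 i"
proof -
  let ?b = "home + 2 * length x + 1"
  let ?blank = "\<lambda>e. \<alpha> (Cell 0 0) 0 (?b + e)"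
  define m where "m = (LEAST e. e = p \<or> ?blank e)"
  define u where "u = map (\<lambda>e. \<alpha> (Cell 0 2) 0 (?b + e)) [0..<m]"
  have in_range: "?b + e < range" if "e \<le> p" for e using that T_ge by (simp add: home_def range_def)
  have bd: "guard_holds x p home gd i 0 \<Longrightarrow>
      \<exists>(b, a, tm, pl) \<in> set ls. \<alpha> a (time_val T tm 0) (place_val home pl i 0) = b"
    if "(gd, ls) \<in> boundary_rules M" "i < range" for gd ls i
    using modelD[OF assms _ range_pos that(2) range_pos, of "(gd, ls)"] that(1)
    by (simp add: rules_def rule_holds_def)
  have m: "m \<le> p" unfolding m_def by (rule Least_le) simp
  have m': "m = p \<or> ?blank m" unfolding m_def by (rule LeastI) (rule disjI1, rule refl)
  have nonblank: "\<not> ?blank e" if "e < m" for e using not_less_Least that unfolding m_def by blast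
  have blank: "?blank e" if "m \<le> e" "e < p" for e
    using that
  proof (induction e rule: dec_induct)
    case base
    then show ?case using m' by simp
  next
    case (step e)
    have "(Guessed, [(False, Cell 0 0, Start, Here), (True, Cell 0 0, Start, Right)]) \<in> boundary_rules M"
      by (simp add: boundary_rules_def)
    from bd[OF this in_range[of e]] show ?case using step by simp
  qed
  have symbol: "?blank e \<or> \<alpha> (Cell 0 1) 0 (?b + e) \<or> \<alpha> (Cell 0 2) 0 (?b + e)" if "e < p" for e
  proof -
    have "(Guessed, [(True, Cell 0 0, Start, Here), (True, Cell 0 1, Start, Here), (True, Cell 0 2, Start, Here)])
      \<in> boundary_rules M" by (simp add: boundary_rules_def)
    from bd[OF this in_range[of e]] show ?thesis using that by simp
  qed
  have u: "length u \<le> p" using m by (simp add: u_def)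
  moreover have "\<alpha> (Cell 0 (contents (pair_code x u) (cell i))) 0 i" if "0 < i" "i < range - 1" for i
  proof (cases "?b \<le> i \<and> i < ?b + p")
    case True
    then obtain e where e: "i = ?b + e" "e < p" by (metis le_Suc_ex nat_add_left_cancel_less)
    have c: "contents (pair_code x u) (cell i) = contents u (int e)"
      using guessed_symbol[of i u] e by simp
    show ?thesis
    proof (cases "e < m")
      case True
      then show ?thesis using symbol[OF e(2)] nonblank unfolding c unfolding e
        by (auto simp: contents_def u_def)
    next
      case False
      then show ?thesis using blank[of e] e unfolding c by (simp add: contents_def u_def)
    qed
  next
    case False
    let ?s = "if i < home then 0 else input_symbol x (i - home)"
    have "?s < 3" by (simp add: input_symbol_def)
    then have "(Fixed ?s, [(True, Cell 0 ?s, Start, Here)]) \<in> boundary_rules M"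
      unfolding boundary_rules_def by (intro UnI2 image_eqI[of _ _ ?s]) auto
    from bd[OF this, of i] have "\<alpha> (Cell 0 ?s) 0 i" using False that by auto
    then show ?thesis using initial_symbol[OF u, of i] False by auto
  qed
  ultimately show thesis by (rule that)
qed

theorem model_iff_accepting:
  "(\<exists>\<alpha>. model \<alpha>) \<longleftrightarrow> (\<exists>u. length u \<le> p \<and> fst (tapes_at u T ! 1) 0 \<noteq> 1)"
proof
  assume "\<exists>\<alpha>. model \<alpha>"
  then obtain \<alpha> where \<alpha>: "model \<alpha>" ..
  then obtain u where u: "length u \<le> p"
    "\<And>i. 0 < i \<Longrightarrow> i < range - 1 \<Longrightarrow> \<alpha> (Cell 0 (contents (pair_code x u) (cell i))) 0 i"
    by (rule guessed_word) blast
  have "1 < ntapes M" using wf by (simp add: wf_machine_def)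
  then have "\<alpha> (Cell 1 (fst (tapes_at u T ! 1) (cell home))) T home"
    using model_imp_actual[OF \<alpha> u(2) order_refl] by (simp add: home_def range_def)
  moreover have "rule_holds \<alpha> (Always, [(False, Cell 1 1, Final, Home)]) 0 0 0"
    using \<alpha> unfolding model_def rules_def boundary_rules_def by (simp add: range_def)
  then have "\<not> \<alpha> (Cell 1 1) T home" by (simp add: rule_holds_def)
  ultimately have "fst (tapes_at u T ! 1) 0 \<noteq> 1" by (auto simp: cell_def)
  then show "\<exists>u. length u \<le> p \<and> fst (tapes_at u T ! 1) 0 \<noteq> 1" using u(1) by blast
qed (use actual_model in blast)

end


section \<open>Membership in NP\<close>

lemma concat_map_upt:
  "concat (map (\<lambda>u. map (f u) [0..<n]) [0..<m]) = map (\<lambda>i. f (i div n) (i mod n)) [0..<m * n]"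
proof (induction m)
  case (Suc m)
  have "[0..<Suc m * n] = [0..<m * n] @ map (\<lambda>i. i + m * n) [0..<n]"
    using upt_add_eq_append[of 0 "m * n" n] by (simp add: map_add_upt add.commute)
  moreover have "map ((\<lambda>i. f (i div n) (i mod n)) \<circ> (\<lambda>i. i + m * n)) [0..<n] = map (f m) [0..<n]"
    by (rule map_cong) auto
  ultimately show ?case using Suc by simp
qed simp

lemma encode_eq_map:
  "encode n E \<gamma> = map (\<lambda>i. if i < n then True else if i = n then False
     else if i < 2 * n + 1 then \<gamma> (i - (n + 1)) = Black
     else {(i - (2 * n + 1)) div n, (i - (2 * n + 1)) mod n} \<in> E) [0..<2 * n + 1 + n * n]"
  (is "_ = map ?f _")
proof -
  let ?A = "map (\<lambda>v. \<gamma> v = Black) [0..<n]"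
    and ?B = "map (\<lambda>i. {i div n, i mod n} \<in> E) [0..<n * n]"
  have "replicate n True @ [False] @ ?A @ ?B = map ?f [0..<2 * n + 1 + n * n]"
  proof (rule nth_equalityI)
    fix i assume "i < length (replicate n True @ [False] @ ?A @ ?B)"
    then have i: "i < 2 * n + 1 + n * n" by simp
    then have "map ?f [0..<2 * n + 1 + n * n] ! i = ?f i" by (simp del: upt_Suc)
    moreover consider "i < n" | "i = n" | d where "i = n + 1 + d" "d < n" | d where "i = 2 * n + 1 + d" "d < n * n"
    proof -
      have "i < n \<or> i = n \<or> (\<exists>d<n. i = n + 1 + d) \<or> (\<exists>d<n * n. i = 2 * n + 1 + d)"
        using i by presburger
      then show ?thesis using that by blast
    qed
    then have "(replicate n True @ [False] @ ?A @ ?B) ! i = ?f i"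
      by cases (simp_all add: nth_append)
    ultimately show "(replicate n True @ [False] @ ?A @ ?B) ! i = map ?f [0..<2 * n + 1 + n * n] ! i" by simp
  qed simp
  then show ?thesis unfolding encode_def concat_map_upt .
qed

definition edge_bit :: "bool list \<Rightarrow> nat \<Rightarrow> nat \<Rightarrow> nat \<Rightarrow> bool" where
  "edge_bit x n u v \<longleftrightarrow> bit x (2 * n + 1 + u * n + v)"

definition codes_graph :: "bool list \<Rightarrow> nat \<Rightarrow> bool" where
  "codes_graph x n \<longleftrightarrow> length x = 2 * n + 1 + n * n \<and> (\<forall>i<n. bit x i) \<and> \<not> bit x n \<and>
     (\<forall>u<n. \<forall>v<n. edge_bit x n u v \<longrightarrow> edge_bit x n v u \<and> u \<noteq> v)"

definition edges_of :: "bool list \<Rightarrow> nat \<Rightarrow> nat set set" where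
  "edges_of x n = {{u, v} |u v. u < n \<and> v < n \<and> edge_bit x n u v}"

definition colors_of :: "bool list \<Rightarrow> nat \<Rightarrow> nat \<Rightarrow> color" where
  "colors_of x n v = (if bit x (n + 1 + v) then Black else White)"

lemma edges_of_iff:
  "codes_graph x n \<Longrightarrow> u < n \<Longrightarrow> v < n \<Longrightarrow> {u, v} \<in> edges_of x n \<longleftrightarrow> edge_bit x n u v"
  unfolding edges_of_def codes_graph_def by (auto simp: doubleton_eq_iff)

lemma index_bound: "u < n \<Longrightarrow> v < n \<Longrightarrow> u * n + v < n * (n :: nat)"
proof -
  assume "u < n" "v < n"
  then have "u * n + v < Suc u * n" by simp
  also have "\<dots> \<le> n * n" using \<open>u < n\<close> by (intro mult_le_mono1) simp
  finally show ?thesis .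
qed

lemma bit_encode:
  assumes "simple_graph {..<n} E"
  shows "codes_graph (encode n E \<gamma>) n" "edges_of (encode n E \<gamma>) n = E"
    "v < n \<Longrightarrow> colors_of (encode n E \<gamma>) n v = \<gamma> v"
proof -
  let ?x = "encode n E \<gamma>"
  have len: "length ?x = 2 * n + 1 + n * n" unfolding encode_eq_map by simp
  have bit: "bit ?x i \<longleftrightarrow> i < 2 * n + 1 + n * n \<and> (if i < n then True else if i = n then False
     else if i < 2 * n + 1 then \<gamma> (i - (n + 1)) = Black
     else {(i - (2 * n + 1)) div n, (i - (2 * n + 1)) mod n} \<in> E)" for i
    unfolding bit_def len unfolding encode_eq_map by (auto simp del: upt_Suc)
  have e: "edge_bit ?x n u v \<longleftrightarrow> {u, v} \<in> E" if "u < n" "v < n" for u v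
    unfolding edge_bit_def bit using index_bound[OF that] that by simp
  have ne: "u \<noteq> v" if "{u, v} \<in> E" for u v using assms that unfolding simple_graph_def by auto
  show "codes_graph ?x n" unfolding codes_graph_def using len e ne by (simp add: bit insert_commute)
  show "edges_of ?x n = E"
  proof
    show "edges_of ?x n \<subseteq> E" unfolding edges_of_def using e by auto
    show "E \<subseteq> edges_of ?x n"
    proof
      fix s assume s: "s \<in> E"
      then have "s \<subseteq> {..<n}" "card s = 2" using assms unfolding simple_graph_def by auto
      then obtain u v where "s = {u, v}" "u < n" "v < n" by (auto simp: card_2_iff)
      then show "s \<in> edges_of ?x n" using s e unfolding edges_of_def by auto
    qed
  qed
  show "colors_of ?x n v = \<gamma> v" if "v < n"
    using that unfolding colors_of_def bit by (cases "\<gamma> v") auto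
qed

lemma codes_graph_imp_encode:
  assumes "codes_graph x n"
  shows "simple_graph {..<n} (edges_of x n)" "x = encode n (edges_of x n) (colors_of x n)"
proof -
  show "simple_graph {..<n} (edges_of x n)"
    using assms unfolding simple_graph_def codes_graph_def edges_of_def by (auto simp: card_insert_if)
  have len: "length x = 2 * n + 1 + n * n" using assms by (simp add: codes_graph_def)
  have bits: "x ! i = bit x i" if "i < length x" for i using that by (simp add: bit_def)
  show "x = encode n (edges_of x n) (colors_of x n)"
  proof (rule nth_equalityI)
    show "length x = length (encode n (edges_of x n) (colors_of x n))" by (simp add: len encode_eq_map)
    fix i assume i: "i < length x"
    consider "i < n" | "i = n" | "n < i" "i < 2 * n + 1" | d where "i = 2 * n + 1 + d"
      by (metis le_Suc_ex linorder_neqE_nat not_le)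
    then have "bit x i = (if i < n then True else if i = n then False
      else if i < 2 * n + 1 then colors_of x n (i - (n + 1)) = Black
      else {(i - (2 * n + 1)) div n, (i - (2 * n + 1)) mod n} \<in> edges_of x n)"
    proof cases
      case 3
      then show ?thesis by (simp add: colors_of_def)
    next
      case (4 d)
      then have "d < n * n" using i len by simp
      moreover from this have "n \<noteq> 0" by (intro notI) simp
      ultimately have "d div n < n" "d mod n < n" by (simp_all add: less_mult_imp_div_less)
      then show ?thesis using edges_of_iff[OF assms, of "d div n" "d mod n"] 4
        by (simp add: edge_bit_def add.assoc)
    qed (use assms in \<open>auto simp: codes_graph_def\<close>)
    then show "x ! i = encode n (edges_of x n) (colors_of x n) ! i"
      using bits[OF i] i unfolding encode_eq_map len by (simp del: upt_Suc)
  qed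
qed

text \<open>\<open>Q\<close> is a placeholder for the degree condition, so that both problems are
  treated at once. On the right, adjacency and colors are read directly from the bits of
  \<open>x\<close>.\<close>

lemma language_iff:
  "(\<exists>n E \<gamma>. x = encode n E \<gamma> \<and> simple_graph {..<n} E \<and> Q n E \<and> colored_unit_2_interval_graph {..<n} E \<gamma>)
   \<longleftrightarrow> (\<exists>n. codes_graph x n \<and> Q n (edges_of x n) \<and>
     (\<exists>L. endpoint_rep {..<n} (edge_bit x n) (\<lambda>v. \<not> bit x (n + 1 + v)) L))"
  (is "?l \<longleftrightarrow> ?r")
proof -
  have rep: "endpoint_rep {..<n} (\<lambda>u v. {u, v} \<in> E) (\<lambda>v. \<gamma> v = White) L \<longleftrightarrow>
      endpoint_rep {..<n} (edge_bit x n) (\<lambda>v. \<not> bit x (n + 1 + v)) L"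
    if "codes_graph x n" "E = edges_of x n" "\<And>v. v < n \<Longrightarrow> colors_of x n v = \<gamma> v" for n E \<gamma> L
  proof -
    have "(\<gamma> v = White) = (\<not> bit x (n + 1 + v))" if "v < n" for v
      using \<open>\<And>v. v < n \<Longrightarrow> colors_of x n v = \<gamma> v\<close>[OF that] by (auto simp: colors_of_def split: if_splits)
    then show ?thesis
      using edges_of_iff[OF that(1)] that(2) unfolding endpoint_rep_def by simp
  qed
  show ?thesis
  proof
    assume ?l
    then obtain n E \<gamma> where x: "x = encode n E \<gamma>" and E: "simple_graph {..<n} E" "Q n E"
      "colored_unit_2_interval_graph {..<n} E \<gamma>" by blast
    note b = bit_encode(1,2)[OF E(1), of \<gamma>, folded x] bit_encode(3)[OF E(1), of _ \<gamma>, folded x]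
    obtain L where "endpoint_rep {..<n} (edge_bit x n) (\<lambda>v. \<not> bit x (n + 1 + v)) L"
      using E(3) rep[OF b(1) b(2)[symmetric] b(3)] unfolding colored_graph_iff_endpoint_rep by blast
    moreover have "Q n (edges_of x n)" using E(2) b(2) by simp
    ultimately show ?r using b(1) by blast
  next
    assume ?r
    then obtain n where n: "codes_graph x n" "Q n (edges_of x n)"
      "\<exists>L. endpoint_rep {..<n} (edge_bit x n) (\<lambda>v. \<not> bit x (n + 1 + v)) L" by blast
    then have "colored_unit_2_interval_graph {..<n} (edges_of x n) (colors_of x n)"
      using rep[OF n(1) refl refl] unfolding colored_graph_iff_endpoint_rep by blast
    then show ?l using codes_graph_imp_encode[OF n(1)] n(2) by blast
  qed
qed

lemma degree_iff:
  assumes "codes_graph x n"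
  shows "degree_at_most d {..<n} (edges_of x n) \<longleftrightarrow> (\<forall>u<n. (\<Sum>v<n. of_bool (edge_bit x n u v)) \<le> d)"
proof -
  have "card {e \<in> edges_of x n. u \<in> e} = (\<Sum>v<n. of_bool (edge_bit x n u v))" if u: "u < n" for u
  proof -
    let ?N = "{v. v < n \<and> edge_bit x n u v}"
    have sym: "edge_bit x n a b \<Longrightarrow> a < n \<Longrightarrow> b < n \<Longrightarrow> edge_bit x n b a \<and> a \<noteq> b" for a b
      using assms unfolding codes_graph_def by blast
    have "{e \<in> edges_of x n. u \<in> e} = (\<lambda>v. {u, v}) ` ?N" unfolding edges_of_def using sym u by blast
    moreover have "inj_on (\<lambda>v. {u, v}) ?N" by (auto simp: inj_on_def doubleton_eq_iff)
    moreover have "(\<Sum>v<n. of_bool (edge_bit x n u v)) = card ({..<n} \<inter> {v. edge_bit x n u v})"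
      by (simp add: of_bool_def sum.If_cases)
    moreover have "{..<n} \<inter> {v. edge_bit x n u v} = ?N" by auto
    ultimately show ?thesis by (simp add: card_image)
  qed
  then show ?thesis unfolding degree_at_most_def Ball_def lessThan_iff by simp
qed

subsection \<open>Representations with small integer coordinates\<close>

text \<open>
  Fractional parts are replaced by their ranks, and integral parts by ranks among all integral parts and
  their successors. The latter preserves the relations \<open>z = z' + 1\<close> and \<open>z \<ge> z' + 2\<close>.
\<close>

lemma discretize:
  fixes X :: "real set" and K :: nat
  assumes X: "finite X" "card X < K"
  obtains N :: "real \<Rightarrow> nat" where
    "\<And>a b. a \<in> X \<Longrightarrow> b \<in> X \<Longrightarrow> N a \<le> N b + K \<longleftrightarrow> a \<le> b + 1"
    "\<And>a. a \<in> X \<Longrightarrow> N a < K * (2 * card X + 1)"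
proof
  define F where "F = floor ` X \<union> (\<lambda>a. floor a + 1) ` X"
  define g where "g z = card {y \<in> F. y \<le> z}" for z :: int
  define rk where "rk f = card {y \<in> frac ` X. y < f}" for f :: real
  \<comment> \<open>A number in base \<open>K\<close>: since \<open>card X < K\<close>, the rank of
    the fractional part is a digit, and adding \<open>K\<close> changes only the leading
    part.\<close>
  define N where "N a = K * g (floor a) + rk (frac a)" for a
  have F: "finite F" "card F \<le> 2 * card X"
    using X card_Un_le[of "floor ` X" "(\<lambda>a. floor a + 1) ` X"]
      card_image_le[OF X(1), of floor] card_image_le[OF X(1), of "\<lambda>a. floor a + 1"]
    unfolding F_def by auto
  have finR: "finite {y \<in> frac ` X. y < f}" for f using X(1) by simp
  have finG: "finite {y \<in> F. y \<le> z}" for z using F(1) by simp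
  have rkK: "rk f < K" for f
  proof -
    have "{y \<in> frac ` X. y < f} \<subseteq> frac ` X" by blast
    then have "rk f \<le> card (frac ` X)" unfolding rk_def by (rule card_mono[OF finite_imageI[OF X(1)]])
    also have "\<dots> \<le> card X" by (rule card_image_le[OF X(1)])
    finally show ?thesis using X(2) by simp
  qed
  have rk_le: "rk (frac a) \<le> rk (frac b) \<longleftrightarrow> frac a \<le> frac b" if "a \<in> X" "b \<in> X" for a b
  proof
    assume le: "frac a \<le> frac b"
    have "{y \<in> frac ` X. y < frac a} \<subseteq> {y \<in> frac ` X. y < frac b}"
      using le by (blast intro: less_le_trans)
    then show "rk (frac a) \<le> rk (frac b)" unfolding rk_def by (rule card_mono[OF finR])
  next
    assume le: "rk (frac a) \<le> rk (frac b)"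
    show "frac a \<le> frac b"
    proof (rule ccontr)
      assume "\<not> frac a \<le> frac b"
      then have lt: "frac b < frac a" by (rule not_le_imp_less)
      have "{y \<in> frac ` X. y < frac b} \<subseteq> {y \<in> frac ` X. y < frac a}"
        using lt by (blast intro: less_trans)
      moreover have "frac b \<in> {y \<in> frac ` X. y < frac a}" "frac b \<notin> {y \<in> frac ` X. y < frac b}"
        using lt that(2) by blast+
      ultimately have "{y \<in> frac ` X. y < frac b} \<subset> {y \<in> frac ` X. y < frac a}" by blast
      then have "rk (frac b) < rk (frac a)" unfolding rk_def by (rule psubset_card_mono[OF finR])
      then show False using le by linarith
    qed
  qed
  have g_mono: "g z \<le> g z'" if "z \<le> z'" for z z'
  proof -
    have "{y \<in> F. y \<le> z} \<subseteq> {y \<in> F. y \<le> z'}" using that by (blast intro: order_trans)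
    then show ?thesis unfolding g_def by (rule card_mono[OF finG])
  qed
  have g_strict: "g z < g z'" if "z < z'" "z' \<in> F" for z z'
  proof -
    have "{y \<in> F. y \<le> z} \<subseteq> {y \<in> F. y \<le> z'}" using that by (auto intro: order_trans)
    moreover have "z' \<in> {y \<in> F. y \<le> z'}" "z' \<notin> {y \<in> F. y \<le> z}" using that by auto
    ultimately have "{y \<in> F. y \<le> z} \<subset> {y \<in> F. y \<le> z'}" by blast
    then show ?thesis unfolding g_def by (rule psubset_card_mono[OF finG])
  qed
  have g_succ: "g (z + 1) = g z + 1" if "z + 1 \<in> F" for z
  proof -
    have "{y \<in> F. y \<le> z + 1} = insert (z + 1) {y \<in> F. y \<le> z}" using that by auto
    then show ?thesis unfolding g_def using finG by simp
  qed
  show "N a \<le> N b + K \<longleftrightarrow> a \<le> b + 1" if ab: "a \<in> X" "b \<in> X" for a b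
  proof -
    let ?z = "floor a" and ?z' = "floor b"
    have inF: "?z \<in> F" "?z' + 1 \<in> F" using ab by (auto simp: F_def)
    have dec: "a = of_int ?z + frac a" "b = of_int ?z' + frac b" by (simp_all add: frac_def)
    have fr: "0 \<le> frac a" "frac a < 1" "0 \<le> frac b" "frac b < 1" by (simp_all add: frac_lt_1)
    consider "?z \<le> ?z'" | "?z = ?z' + 1" | "?z' + 2 \<le> ?z" by linarith
    then show ?thesis
    proof cases
      case 1
      have "K * g ?z \<le> K * g ?z'" using g_mono[OF 1] by simp
      then have "N a \<le> N b + K" using rkK[of "frac a"] unfolding N_def by linarith
      moreover have "(of_int ?z :: real) \<le> of_int ?z'" using 1 by simp
      then have "a \<le> b + 1" using dec fr by linarith
      ultimately show ?thesis by simp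
    next
      case 2
      have "g ?z = g ?z' + 1" using g_succ inF(2) 2 by simp
      then have "N a \<le> N b + K \<longleftrightarrow> rk (frac a) \<le> rk (frac b)" unfolding N_def by simp
      moreover have "(of_int ?z :: real) = of_int ?z' + 1" using 2 by simp
      then have "a \<le> b + 1 \<longleftrightarrow> frac a \<le> frac b" using dec by linarith
      ultimately show ?thesis using rk_le[OF ab] by simp
    next
      case 3
      have "g ?z' + 1 < g ?z" using g_succ[OF inF(2)] g_strict[of "?z' + 1" ?z] 3 inF(1) by simp
      then have "K * (g ?z' + 2) \<le> K * g ?z" by (intro mult_le_mono2) simp
      then have "\<not> N a \<le> N b + K" using rkK[of "frac b"] unfolding N_def by (simp add: algebra_simps)
      moreover have "(of_int ?z :: real) \<ge> of_int ?z' + 2" using 3 by linarith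
      then have "\<not> a \<le> b + 1" using dec fr by linarith
      ultimately show ?thesis by simp
    qed
  qed
  show "N a < K * (2 * card X + 1)" for a
  proof -
    have "{y \<in> F. y \<le> floor a} \<subseteq> F" by blast
    then have "g (floor a) \<le> card F" unfolding g_def by (rule card_mono[OF F(1)])
    then have "K * g (floor a) \<le> K * (2 * card X)" using F(2) by (intro mult_le_mono2) simp
    moreover have "K * (2 * card X + 1) = K * (2 * card X) + K" by simp
    ultimately show ?thesis using rkK[of "frac a"] unfolding N_def by linarith
  qed
qed

definition near :: "nat \<Rightarrow> nat \<Rightarrow> nat \<Rightarrow> bool" where
  "near K a b \<longleftrightarrow> a \<le> b + K \<and> b \<le> a + K"

definition integer_rep ::
    "nat \<Rightarrow> nat \<Rightarrow> (nat \<Rightarrow> nat \<Rightarrow> bool) \<Rightarrow> (nat \<Rightarrow> bool) \<Rightarrow> (nat \<Rightarrow> nat \<Rightarrow> nat) \<Rightarrow> bool" where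
  "integer_rep K n adj white N \<longleftrightarrow>
     (\<forall>v<n. if white v then \<not> near K (N v 0) (N v (Suc 0)) else N v 0 = N v (Suc 0)) \<and>
     (\<forall>u<n. \<forall>v<n. u \<noteq> v \<longrightarrow> (adj u v \<longleftrightarrow> (\<exists>i<2. \<exists>j<2. near K (N u i) (N v j))))"

lemma ex_less_2: "(\<exists>i<2. P i) \<longleftrightarrow> P 0 \<or> P (Suc 0)"
  by (auto simp: less_2_cases_iff)

lemma integer_rep_imp_endpoint_rep:
  assumes "0 < K" "integer_rep K n adj white N"
  shows "\<exists>L. endpoint_rep {..<n} adj white L"
proof
  let ?L = "\<lambda>v c. real (N v (of_bool c)) / real K"
  have "close (real a / real K) (real b / real K) \<longleftrightarrow> near K a b" for a b
  proof -
    have "real a / real K - real b / real K = (real a - real b) / real K" by (simp add: diff_divide_distrib)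
    then have "close (real a / real K) (real b / real K) \<longleftrightarrow> \<bar>(real a - real b) / real K\<bar> \<le> 1"
      unfolding close_def by (simp only:)
    also have "\<dots> \<longleftrightarrow> \<bar>real a - real b\<bar> / real K \<le> 1" unfolding abs_divide abs_of_nat ..
    also have "\<dots> \<longleftrightarrow> \<bar>real a - real b\<bar> \<le> real K" using assms(1) divide_le_eq_1_pos[of "real K"] by simp
    also have "\<dots> \<longleftrightarrow> near K a b" unfolding near_def by linarith
    finally show ?thesis .
  qed
  note close = this
  have "if white v then \<not> close (?L v False) (?L v True) else ?L v False = ?L v True" if v: "v < n" for v
  proof -
    have "if white v then \<not> near K (N v 0) (N v (Suc 0)) else N v 0 = N v (Suc 0)"
      using assms(2) v unfolding integer_rep_def by blast
    then show ?thesis unfolding close by (cases "white v") simp_all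
  qed
  moreover have "adj u v \<longleftrightarrow> (\<exists>i j. close (?L u i) (?L v j))" if "u < n" "v < n" "u \<noteq> v" for u v
  proof -
    have "adj u v \<longleftrightarrow> (\<exists>i<2. \<exists>j<2. near K (N u i) (N v j))"
      using assms(2) that unfolding integer_rep_def by blast
    then show ?thesis unfolding close ex_bool_eq ex_less_2 by auto
  qed
  ultimately show "endpoint_rep {..<n} adj white ?L"
    unfolding endpoint_rep_def Ball_def lessThan_iff by (intro conjI allI impI)
qed

lemma endpoint_rep_imp_integer_rep:
  assumes L: "endpoint_rep {..<n} adj white L"
  obtains N where "integer_rep (2 * n + 1) n adj white N"
    "\<And>v i. v < n \<Longrightarrow> i < 2 \<Longrightarrow> N v i < (2 * n + 1) * (4 * n + 1)"
proof -
  let ?X = "(\<lambda>(v, c). L v c) ` ({..<n} \<times> UNIV)"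
  have X: "finite ?X" by simp
  have card: "card ?X \<le> 2 * n" using card_image_le[of "{..<n} \<times> (UNIV :: bool set)" "\<lambda>(v, c). L v c"]
    by (simp add: card_cartesian_product)
  then obtain N :: "real \<Rightarrow> nat" where N:
    "\<And>a b. a \<in> ?X \<Longrightarrow> b \<in> ?X \<Longrightarrow> N a \<le> N b + (2 * n + 1) \<longleftrightarrow> a \<le> b + 1"
    "\<And>a. a \<in> ?X \<Longrightarrow> N a < (2 * n + 1) * (2 * card ?X + 1)"
    using discretize[OF X, of "2 * n + 1"] by (metis Suc_eq_plus1 less_Suc_eq_le)
  have mem: "L v c \<in> ?X" if "v < n" for v c using that by force
  have near: "near (2 * n + 1) (N (L u c)) (N (L v d)) \<longleftrightarrow> close (L u c) (L v d)" if "u < n" "v < n" for u v c d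
    unfolding near_def N(1)[OF mem[OF that(1)] mem[OF that(2)]] N(1)[OF mem[OF that(2)] mem[OF that(1)]]
      close_def by linarith
  show thesis
  proof (rule that[of "\<lambda>v i. N (L v (i = 1))"])
    have "if white v then \<not> near (2 * n + 1) (N (L v False)) (N (L v True))
        else N (L v False) = N (L v True)"
      if "v < n" for v
      using L that near[OF that that] unfolding endpoint_rep_def by (auto split: if_splits)
    moreover have "adj u v \<longleftrightarrow>
        (\<exists>i<2. \<exists>j<2. near (2 * n + 1) (N (L u (i = (1 :: nat)))) (N (L v (j = (1 :: nat)))))"
      if uv: "u < n" "v < n" "u \<noteq> v" for u v
    proof -
      have "adj u v \<longleftrightarrow> (\<exists>i j. close (L u i) (L v j))"
        using L uv unfolding endpoint_rep_def by blast
      then show ?thesis unfolding ex_bool_eq ex_less_2 near[OF uv(1,2)] by auto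
    qed
    ultimately show "integer_rep (2 * n + 1) n adj white (\<lambda>v i. N (L v (i = 1)))"
      unfolding integer_rep_def
      by (intro conjI allI impI) (simp_all only: One_nat_def nat.distinct simp_thms)
    show "N (L v (i = 1)) < (2 * n + 1) * (4 * n + 1)" if "v < n" for v i
    proof -
      have "(2 * n + 1) * (2 * card ?X + 1) \<le> (2 * n + 1) * (4 * n + 1)"
        using card by (intro mult_le_mono2) simp
      then show ?thesis using N(2)[OF mem[OF that, of "i = 1"]] by linarith
    qed
  qed
qed

subsection \<open>The verifier\<close>

text \<open>
  A certificate lists the coordinates in unary: a coordinate is the number of bits \<open>True\<close> in its block.
\<close>

definition block_size :: "nat \<Rightarrow> nat" where
  "block_size n = (2 * n + 1) * (4 * n + 1)"

definition code_length :: "nat \<Rightarrow> nat" where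
  "code_length n = 2 * n + 1 + n * n"

definition coordinate :: "bool list \<Rightarrow> nat \<Rightarrow> nat \<Rightarrow> nat \<Rightarrow> nat \<Rightarrow> nat" where
  "coordinate w off n v i =
     (\<Sum>e<block_size n. of_bool (bit w (off + ((2 * v + i) * block_size n + e))))"

definition x_bit :: "bool list \<Rightarrow> nat \<Rightarrow> bool" where
  "x_bit w i \<longleftrightarrow> bit w (2 * i + 1)"

definition x_edge :: "bool list \<Rightarrow> nat \<Rightarrow> nat \<Rightarrow> nat \<Rightarrow> bool" where
  "x_edge w n u v \<longleftrightarrow> x_bit w (2 * n + 1 + u * n + v)"

text \<open>The input is the whole word \<open>pair_code x u\<close>, with the bits of
  \<open>x\<close> at odd places. The first conjunct locates the separator and thereby checks the
  length of \<open>x\<close>; the certificate begins right after it. For \<open>d = None\<close> the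
  degrees are unrestricted.\<close>

definition verify :: "nat option \<Rightarrow> bool list \<Rightarrow> bool" where
  "verify d w \<longleftrightarrow> (\<exists>n<length w.
     ((\<forall>i<code_length n. bit w (2 * i)) \<and> \<not> bit w (2 * code_length n)) \<and>
     ((\<forall>i<n. x_bit w i) \<and> \<not> x_bit w n \<and>
       (\<forall>u<n. \<forall>v<n. x_edge w n u v \<longrightarrow> x_edge w n v u \<and> u \<noteq> v)) \<and>
     (\<forall>u<n. d \<noteq> None \<longrightarrow> (\<Sum>v<n. of_bool (x_edge w n u v)) \<le> the d) \<and>
     integer_rep (2 * n + 1) n (x_edge w n) (\<lambda>v. \<not> x_bit w (n + 1 + v))
       (coordinate w (2 * code_length n + 1) n))"

lemma definable_x_edge:
  "definable a \<Longrightarrow> definable b \<Longrightarrow> definable c \<Longrightarrow> definable_pred (\<lambda>w s. x_edge w (a w s) (b w s) (c w s))"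
  unfolding x_edge_def x_bit_def by (intro definable_intros)

lemma definable_x_bit: "definable a \<Longrightarrow> definable_pred (\<lambda>w s. x_bit w (a w s))"
  unfolding x_bit_def by (intro definable_intros)

lemma definable_coordinate:
  assumes "definable a" "definable b" "definable c" "definable d"
  shows "definable (\<lambda>w s. coordinate w (a w s) (b w s) (c w s) (d w s))"
proof (rule definable_substitute4[OF _ assms])
  show "definable (\<lambda>w s. coordinate w (s 0) (s (Suc 0)) (s (Suc (Suc 0))) (s (Suc (Suc (Suc 0)))))"
    unfolding coordinate_def block_size_def by (intro definable_intros)
qed

lemma definable_near:
  "definable a \<Longrightarrow> definable b \<Longrightarrow> definable c \<Longrightarrow> definable_pred (\<lambda>w s. near (a w s) (b w s) (c w s))"
  unfolding near_def by (intro definable_intros)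

lemma definable_verify: "definable_pred (\<lambda>w s. verify d w)"
  unfolding verify_def code_length_def integer_rep_def
  by (intro definable_intros definable_x_edge definable_x_bit definable_coordinate definable_near)

lemma in_P_verify: "in_P {w. verify d w}"
proof -
  have "poly_time (\<lambda>w. map (\<lambda>i. verify d w) [0..<1])"
    by (rule poly_time_definable[OF definable_one definable_verify])
  then show ?thesis unfolding in_P_def by simp
qed

lemma bit_pair_code:
  "bit (pair_code x u) (2 * i) \<longleftrightarrow> i < length x \<or> length x < i \<and> bit u (2 * i - (2 * length x + 1))"
  "i < length x \<Longrightarrow> bit (pair_code x u) (2 * i + 1) = bit x i"
  "bit (pair_code x u) (2 * length x + 1 + i) = bit u i"
proof -
  have bit: "bit w e \<longleftrightarrow> contents w (int e) = 2" for w e by (simp add: bit_def contents_int)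
  note c = contents_pair_code[of x u]
  show "bit (pair_code x u) (2 * i) \<longleftrightarrow> i < length x \<or> length x < i \<and> bit u (2 * i - (2 * length x + 1))"
    unfolding bit c by (auto simp: input_symbol_def)
  show "bit (pair_code x u) (2 * i + 1) = bit x i" if "i < length x"
    unfolding bit[of "pair_code x u"] c using that by (simp add: input_symbol_def)
  show "bit (pair_code x u) (2 * length x + 1 + i) = bit u i"
    unfolding bit c by simp
qed

lemma verify_pair_code:
  "verify d (pair_code x u) \<longleftrightarrow> (\<exists>n. codes_graph x n \<and>
     (d \<noteq> None \<longrightarrow> degree_at_most (the d) {..<n} (edges_of x n)) \<and>
     integer_rep (2 * n + 1) n (edge_bit x n) (\<lambda>v. \<not> bit x (n + 1 + v)) (coordinate u 0 n))"
  (is "_ \<longleftrightarrow> (\<exists>n. ?P n)")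
proof -
  let ?w = "pair_code x u"
  have len: "(\<forall>i<m. bit ?w (2 * i)) \<and> \<not> bit ?w (2 * m) \<longleftrightarrow> m = length x" for m
    using bit_pair_code(1)[of x u] by (metis linorder_neqE_nat less_irrefl)
  have main: "(\<forall>i<n. x_bit ?w i) \<and> \<not> x_bit ?w n \<and>
       (\<forall>a<n. \<forall>v<n. x_edge ?w n a v \<longrightarrow> x_edge ?w n v a \<and> a \<noteq> v) \<longleftrightarrow> codes_graph x n"
      "(\<forall>a<n. d \<noteq> None \<longrightarrow> (\<Sum>v<n. of_bool (x_edge ?w n a v)) \<le> the d) \<longleftrightarrow>
       (\<forall>a<n. d \<noteq> None \<longrightarrow> (\<Sum>v<n. of_bool (edge_bit x n a v)) \<le> the d)"
      "integer_rep (2 * n + 1) n (x_edge ?w n) (\<lambda>v. \<not> x_bit ?w (n + 1 + v))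
       (coordinate ?w (2 * length x + 1) n) \<longleftrightarrow>
       integer_rep (2 * n + 1) n (edge_bit x n) (\<lambda>v. \<not> bit x (n + 1 + v)) (coordinate u 0 n)"
    if l: "length x = code_length n" for n
  proof -
    have b: "x_bit ?w i = bit x i" if "i < 2 * n + 1 + n * n" for i
      unfolding x_bit_def by (rule bit_pair_code(2)) (use that l in \<open>simp add: code_length_def\<close>)
    have e: "x_edge ?w n a v = edge_bit x n a v" if "a < n" "v < n" for a v
      unfolding x_edge_def edge_bit_def by (rule b) (use index_bound[OF that] in simp)
    have c: "coordinate ?w (2 * length x + 1) n = coordinate u 0 n"
      unfolding coordinate_def bit_pair_code(3) by simp
    show "(\<forall>i<n. x_bit ?w i) \<and> \<not> x_bit ?w n \<and>
       (\<forall>a<n. \<forall>v<n. x_edge ?w n a v \<longrightarrow> x_edge ?w n v a \<and> a \<noteq> v) \<longleftrightarrow> codes_graph x n"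
      unfolding codes_graph_def l code_length_def using b e by simp
    have "(\<Sum>v<n. of_bool (x_edge ?w n a v) :: nat) = (\<Sum>v<n. of_bool (edge_bit x n a v))" if "a < n" for a
      using e[OF that] by (intro sum.cong) auto
    then show "(\<forall>a<n. d \<noteq> None \<longrightarrow> (\<Sum>v<n. of_bool (x_edge ?w n a v)) \<le> the d) \<longleftrightarrow>
       (\<forall>a<n. d \<noteq> None \<longrightarrow> (\<Sum>v<n. of_bool (edge_bit x n a v)) \<le> the d)" by simp
    show "integer_rep (2 * n + 1) n (x_edge ?w n) (\<lambda>v. \<not> x_bit ?w (n + 1 + v))
       (coordinate ?w (2 * length x + 1) n) \<longleftrightarrow>
       integer_rep (2 * n + 1) n (edge_bit x n) (\<lambda>v. \<not> bit x (n + 1 + v)) (coordinate u 0 n)"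
      unfolding c integer_rep_def using b e by simp
  qed
  have wl: "length x < length ?w"
  proof -
    have "length (concat (map (\<lambda>b. [True, b]) x)) = 2 * length x" by (induction x) auto
    then show ?thesis by (simp add: pair_code_def)
  qed
  have small: "n < length ?w" if "code_length n = length x" for n
    using that wl by (simp add: code_length_def)
  show ?thesis
  proof
    assume "verify d ?w"
    then obtain n where n: "code_length n = length x" and
      v: "(\<forall>i<n. x_bit ?w i) \<and> \<not> x_bit ?w n \<and>
       (\<forall>u<n. \<forall>v<n. x_edge ?w n u v \<longrightarrow> x_edge ?w n v u \<and> u \<noteq> v)"
       "\<forall>u<n. d \<noteq> None \<longrightarrow> (\<Sum>v<n. of_bool (x_edge ?w n u v)) \<le> the d"
       "integer_rep (2 * n + 1) n (x_edge ?w n) (\<lambda>v. \<not> x_bit ?w (n + 1 + v))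
       (coordinate ?w (2 * length x + 1) n)"
      unfolding verify_def len by (elim exE conjE) (rule that, auto)
    note m = main[OF n[symmetric]]
    have "?P n" using v unfolding m using degree_iff[of x n "the d"] by blast
    then show "\<exists>n. ?P n" by blast
  next
    assume "\<exists>n. ?P n"
    then obtain n where n: "?P n" by blast
    then have l: "code_length n = length x" by (simp add: codes_graph_def code_length_def)
    note m = main[OF l[symmetric]]
    note A = iffD2[OF m(1) conjunct1[OF n]]
    have "(\<forall>a<n. d \<noteq> None \<longrightarrow> (\<Sum>v<n. of_bool (edge_bit x n a v)) \<le> the d)"
      using n degree_iff[of x n "the d"] by blast
    note B = iffD2[OF m(2) this]
    have C: "integer_rep (2 * n + 1) n (x_edge ?w n) (\<lambda>v. \<not> x_bit ?w (n + 1 + v))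
       (coordinate ?w (2 * code_length n + 1) n)"
      unfolding l by (rule iffD2[OF m(3) conjunct2[OF conjunct2[OF n]]])
    show "verify d ?w" unfolding verify_def len
      by (rule exI[of _ n]) (rule conjI[OF small[OF l] conjI[OF l conjI[OF A conjI[OF B C]]]])
  qed
qed

lemma certificate:
  assumes "\<And>v i. v < n \<Longrightarrow> i < 2 \<Longrightarrow> N v i < block_size n"
  obtains u where "length u = 2 * n * block_size n" "\<And>v i. v < n \<Longrightarrow> i < 2 \<Longrightarrow> coordinate u 0 n v i = N v i"
proof
  let ?B = "block_size n"
  define u where "u = map (\<lambda>k. k mod ?B < N (k div ?B div 2) (k div ?B mod 2)) [0..<2 * n * ?B]"
  show "length u = 2 * n * ?B" by (simp add: u_def)
  fix v i :: nat assume vi: "v < n" "i < 2"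
  have "bit u ((2 * v + i) * ?B + e) \<longleftrightarrow> e < N v i" if e: "e < ?B" for e
  proof -
    have "(2 * v + i) * ?B + e < Suc (2 * v + i) * ?B" using e by simp
    also have "\<dots> \<le> 2 * n * ?B" using vi by (intro mult_le_mono1) simp
    finally have lt: "(2 * v + i) * ?B + e < 2 * n * ?B" .
    have k: "((2 * v + i) * ?B + e) mod ?B = e" "((2 * v + i) * ?B + e) div ?B = 2 * v + i" using e by auto
    have "(2 * v + i) div 2 = v" "(2 * v + i) mod 2 = i" using vi by auto
    then show ?thesis using lt unfolding bit_def u_def by (simp add: k mod_less[OF e])
  qed
  then have "coordinate u 0 n v i = (\<Sum>e<?B. of_bool (e < N v i))"
    unfolding coordinate_def by (intro sum.cong) auto
  also have "\<dots> = card ({..<?B} \<inter> {..<N v i})" by (simp add: of_bool_def sum.If_cases lessThan_def)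
  also have "{..<?B} \<inter> {..<N v i} = {..<N v i}" using assms[OF vi] by auto
  finally show "coordinate u 0 n v i = N v i" by simp
qed

lemma integer_rep_cong:
  "(\<And>v i. v < n \<Longrightarrow> i < 2 \<Longrightarrow> N v i = N' v i) \<Longrightarrow> integer_rep K n adj white N = integer_rep K n adj white N'"
  unfolding integer_rep_def by (simp add: ex_less_2)

lemma in_NP_by_verify:
  assumes "\<And>x. x \<in> A \<longleftrightarrow> (\<exists>n E \<gamma>. x = encode n E \<gamma> \<and> simple_graph {..<n} E \<and>
    (d \<noteq> None \<longrightarrow> degree_at_most (the d) {..<n} E) \<and> colored_unit_2_interval_graph {..<n} E \<gamma>)"
  shows "in_NP A"
  unfolding in_NP_def
proof (intro exI conjI allI)
  \<comment> \<open>This is \<open>2 * n * block_size n\<close>, the length of a certificate, as a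
    polynomial; it is evaluated at \<open>length x\<close>, which is at least
    \<open>n\<close>.\<close>
  let ?p = "[:0, 2:] * ([:1, 2:] * [:1, 4:]) :: nat poly"
  show "in_P {w. verify d w}" by (rule in_P_verify)
  fix x
  have A: "x \<in> A \<longleftrightarrow> (\<exists>n. codes_graph x n \<and> (d \<noteq> None \<longrightarrow> degree_at_most (the d) {..<n} (edges_of x n)) \<and>
      (\<exists>L. endpoint_rep {..<n} (edge_bit x n) (\<lambda>v. \<not> bit x (n + 1 + v)) L))"
    unfolding assms by (rule language_iff)
  show "x \<in> A \<longleftrightarrow> (\<exists>u. length u \<le> poly ?p (length x) \<and> pair_code x u \<in> {w. verify d w})"
  proof
    assume "x \<in> A"
    then obtain n L where n: "codes_graph x n" "d \<noteq> None \<longrightarrow> degree_at_most (the d) {..<n} (edges_of x n)"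
      and L: "endpoint_rep {..<n} (edge_bit x n) (\<lambda>v. \<not> bit x (n + 1 + v)) L" unfolding A by blast
    obtain N where N: "integer_rep (2 * n + 1) n (edge_bit x n) (\<lambda>v. \<not> bit x (n + 1 + v)) N"
      "\<And>v i. v < n \<Longrightarrow> i < 2 \<Longrightarrow> N v i < block_size n"
      unfolding block_size_def using endpoint_rep_imp_integer_rep[OF L] by metis
    obtain u where u: "length u = 2 * n * block_size n"
      "\<And>v i. v < n \<Longrightarrow> i < 2 \<Longrightarrow> coordinate u 0 n v i = N v i"
      by (rule certificate[OF N(2)]) blast+
    have "integer_rep (2 * n + 1) n (edge_bit x n) (\<lambda>v. \<not> bit x (n + 1 + v)) (coordinate u 0 n)"
      by (rule iffD1[OF integer_rep_cong N(1)]) (rule u(2)[symmetric])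
    then have "verify d (pair_code x u)" unfolding verify_pair_code using n by blast
    moreover have "n \<le> length x" using n(1) by (simp add: codes_graph_def)
    then have "2 * n * ((2 * n + 1) * (4 * n + 1)) \<le>
        2 * length x * ((2 * length x + 1) * (4 * length x + 1))" by (intro mult_le_mono) auto
    then have "length u \<le> poly ?p (length x)" unfolding u block_size_def by (simp add: algebra_simps)
    ultimately show "\<exists>u. length u \<le> poly ?p (length x) \<and> pair_code x u \<in> {w. verify d w}" by blast
  next
    assume "\<exists>u. length u \<le> poly ?p (length x) \<and> pair_code x u \<in> {w. verify d w}"
    then obtain u n where n: "codes_graph x n" "d \<noteq> None \<longrightarrow> degree_at_most (the d) {..<n} (edges_of x n)"
      and rep: "integer_rep (2 * n + 1) n (edge_bit x n) (\<lambda>v. \<not> bit x (n + 1 + v)) (coordinate u 0 n)"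
      unfolding mem_Collect_eq verify_pair_code by blast
    have "\<exists>L. endpoint_rep {..<n} (edge_bit x n) (\<lambda>v. \<not> bit x (n + 1 + v)) L"
      by (rule integer_rep_imp_endpoint_rep[OF _ rep]) simp
    then show "x \<in> A" unfolding A by (intro exI[of _ n] conjI n)
  qed
qed

lemma in_NP_languages:
  "in_NP colored_unit_2_interval_recognition"
  "in_NP (colored_unit_2_interval_recognition_max_degree d)"
proof -
  show "in_NP colored_unit_2_interval_recognition"
    by (rule in_NP_by_verify[where d = None]) (auto simp: colored_unit_2_interval_recognition_def)
  show "in_NP (colored_unit_2_interval_recognition_max_degree d)"
    by (rule in_NP_by_verify[where d = "Some d"])
      (auto simp: colored_unit_2_interval_recognition_max_degree_def)
qed


section \<open>The reduction\<close>

subsection \<open>Definability of the gadget graph\<close>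

lemma definable_base: "definable a \<Longrightarrow> definable b \<Longrightarrow> definable_pred (\<lambda>w s. base (a w s) (b w s))"
  unfolding base_def base_edges_def list.set insert_iff empty_iff prod.inject
  by (intro definable_intros)

lemma definable_literal: "definable a \<Longrightarrow> definable_pred (\<lambda>w s. literal (a w s))"
  unfolding literal_def by (intro definable_intros)

text \<open>A formula for each input word. The width is constant, and the variable and the sign of
  an occurrence are definable from the word and its index.\<close>

locale definable_cnf =
  fixes J :: "bool list \<Rightarrow> nat" and r :: nat
    and var :: "bool list \<Rightarrow> nat \<Rightarrow> nat" and sgn :: "bool list \<Rightarrow> nat \<Rightarrow> bool"
  assumes r_pos: "0 < r"
    and definable_J: "definable (\<lambda>w s. J w)"
    and definable_var: "definable (\<lambda>w s. var w (s 0))"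
    and definable_sgn: "definable_pred (\<lambda>w s. sgn w (s 0))"
begin

sublocale F: cnf "J w" r "var w" "sgn w" for w
  by standard (rule r_pos)

lemma definable_occs: "definable (\<lambda>w s. cnf.occs (J w) r)"
  unfolding F.occs_def F.width_def by (intro definable_intros definable_J)

lemma definable_occ_var:
  assumes "definable a"
  shows "definable (\<lambda>w s. cnf.occ_var (var w) (a w s))"
  unfolding F.occ_var_def
  by (rule definable_substitute1[of var, OF definable_var definable_div[OF assms definable_const]])

lemma definable_occ_sgn:
  assumes "definable a"
  shows "definable_pred (\<lambda>w s. cnf.occ_sgn (sgn w) (a w s))"
  unfolding F.occ_sgn_def
  by (rule definable_pred_substitute1[of sgn, OF definable_sgn definable_div[OF assms definable_const]])

lemma definable_last_below:
  assumes "definable a" "definable b"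
  shows "definable (\<lambda>w s. cnf.last_below (var w) (a w s) (b w s))"
proof (rule definable_substitute2[where f = "\<lambda>w. cnf.last_below (var w)", OF _ assms])
  show "definable (\<lambda>w s. cnf.last_below (var w) (s 0) (s (Suc 0)))"
    unfolding F.last_below_def by (intro definable_intros definable_occ_var)
qed

lemma definable_prev:
  assumes "definable a"
  shows "definable (\<lambda>w s. cnf.prev (J w) r (var w) (a w s))"
proof (rule definable_substitute1[where f = "\<lambda>w. cnf.prev (J w) r (var w)", OF _ assms])
  show "definable (\<lambda>w s. cnf.prev (J w) r (var w) (s 0))"
    unfolding F.prev_def
    by (intro definable_intros definable_last_below definable_occ_var definable_occs)
qed

lemma definable_cl:
  assumes "definable a" "definable b"
  shows "definable (\<lambda>w s. cnf.cl (J w) r (var w) (sgn w) (a w s) (b w s))"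
proof (rule definable_substitute2[where f = "\<lambda>w. cnf.cl (J w) r (var w) (sgn w)", OF _ assms])
  show "definable (\<lambda>w s. cnf.cl (J w) r (var w) (sgn w) (s 0) (s (Suc 0)))"
    unfolding F.cl_def F.unused_def F.width_def Let_def
    by (intro definable_intros definable_prev definable_occ_sgn definable_occs)
qed

definition size :: "bool list \<Rightarrow> nat" where
  "size w = 13 * (2 * cnf.occs (J w) r)"

definition adjacent :: "bool list \<Rightarrow> nat \<Rightarrow> nat \<Rightarrow> bool" where
  "adjacent w u v \<longleftrightarrow> gadgets.adj (cnf.cl (J w) r (var w) (sgn w)) (gadgets.vertex_of u) (gadgets.vertex_of v)"

definition instance_of :: "bool list \<Rightarrow> bool list" where
  "instance_of w = encode (size w) (gadgets.edges (2 * cnf.occs (J w) r) (cnf.cl (J w) r (var w) (sgn w)))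
     gadgets.color_of"

lemma definable_size: "definable (\<lambda>w s. size w)"
  unfolding size_def by (intro definable_intros definable_occs)

lemma definable_adjacent:
  assumes "definable a" "definable b"
  shows "definable_pred (\<lambda>w s. adjacent w (a w s) (b w s))"
proof -
  have "adjacent w u v \<longleftrightarrow> u div 13 = v div 13 \<and> base (u mod 13) (v mod 13) \<or>
      (\<not> (u div 13 = v div 13 \<and> u mod 13 = v mod 13)) \<and> literal (u mod 13) \<and> literal (v mod 13) \<and>
      cnf.cl (J w) r (var w) (sgn w) (u div 13) (u mod 13) =
      cnf.cl (J w) r (var w) (sgn w) (v div 13) (v mod 13)" for w u v
    unfolding adjacent_def F.adj_def F.mates_def F.vertex_of_def fst_conv snd_conv prod.inject ..
  then show ?thesis
    by (simp only:) (intro definable_intros definable_base definable_literal definable_cl assms)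
qed

lemma instance_eq_map:
  "instance_of w = map (\<lambda>i. if i < size w then True else if i = size w then False
     else if i < 2 * size w + 1 then \<not> (i - (size w + 1)) mod 13 < 4
     else adjacent w ((i - (2 * size w + 1)) div size w) ((i - (2 * size w + 1)) mod size w))
     [0..<2 * size w + 1 + size w * size w]"
  unfolding instance_of_def encode_eq_map
proof (rule map_cong[OF refl])
  fix i assume "i \<in> set [0..<2 * size w + 1 + size w * size w]"
  then have i: "i < 2 * size w + 1 + size w * size w" by (simp only: set_upt atLeastLessThan_iff)
  let ?d = "i - (2 * size w + 1)"
  have "{?d div size w, ?d mod size w} \<in> gadgets.edges (2 * cnf.occs (J w) r) (cnf.cl (J w) r (var w) (sgn w))
      \<longleftrightarrow> adjacent w (?d div size w) (?d mod size w)" if "\<not> i < 2 * size w + 1"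
  proof -
    have d: "?d < size w * size w" using i that by linarith
    then have "size w \<noteq> 0" by (intro notI) simp
    with d have "?d div size w < size w" "?d mod size w < size w" by (simp_all add: less_mult_imp_div_less)
    then show ?thesis unfolding adjacent_def size_def by (rule F.in_edges_iff)
  qed
  moreover have "gadgets.color_of v = Black \<longleftrightarrow> \<not> v mod 13 < 4" for v
    by (simp add: F.color_of_def)
  ultimately show "(if i < size w then True else if i = size w then False
      else if i < 2 * size w + 1 then gadgets.color_of (i - (size w + 1)) = Black
      else {?d div size w, ?d mod size w} \<in> gadgets.edges (2 * cnf.occs (J w) r) (cnf.cl (J w) r (var w) (sgn w))) =
     (if i < size w then True else if i = size w then False
      else if i < 2 * size w + 1 then \<not> (i - (size w + 1)) mod 13 < 4
      else adjacent w (?d div size w) (?d mod size w))"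
    by (simp only: split: if_split) blast
qed

lemma poly_time_instance: "poly_time instance_of"
proof -
  have "poly_time (\<lambda>w. map (\<lambda>i. (\<lambda>w s. if s 0 < size w then True else if s 0 = size w then False
     else if s 0 < 2 * size w + 1 then \<not> (s 0 - (size w + 1)) mod 13 < 4
     else adjacent w ((s 0 - (2 * size w + 1)) div size w) ((s 0 - (2 * size w + 1)) mod size w))
     w (case_nat i (\<lambda>_. 0))) [0..<(\<lambda>w s. 2 * size w + 1 + size w * size w) w (\<lambda>_. 0 :: nat)])"
    by (rule poly_time_definable) (intro definable_intros definable_size definable_adjacent)+
  then show ?thesis unfolding instance_eq_map[abs_def] by (simp only: nat.case)
qed

lemma instance_iff:
  "instance_of w \<in> colored_unit_2_interval_recognition \<longleftrightarrow> (\<exists>\<alpha>. cnf.formula_sat (J w) r (var w) (sgn w) \<alpha>)"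
  "instance_of w \<in> colored_unit_2_interval_recognition_max_degree 6 \<longleftrightarrow>
     (\<exists>\<alpha>. cnf.formula_sat (J w) r (var w) (sgn w) \<alpha>)"
proof -
  let ?E = "gadgets.edges (2 * cnf.occs (J w) r) (cnf.cl (J w) r (var w) (sgn w))"
  have simple: "simple_graph {..<size w} ?E" and deg: "degree_at_most 6 {..<size w} ?E"
    unfolding size_def by (rule F.simple_graph_edges, rule F.degree_edges)
  have sat: "colored_unit_2_interval_graph {..<size w} ?E gadgets.color_of \<longleftrightarrow>
      (\<exists>\<alpha>. cnf.formula_sat (J w) r (var w) (sgn w) \<alpha>)"
    unfolding size_def using F.colored_graph_iff_satisfiable F.satisfiable_iff by simp
  have "colored_unit_2_interval_graph {..<size w} ?E gadgets.color_of"
    if mem: "instance_of w \<in> colored_unit_2_interval_recognition"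
  proof -
    obtain n E \<gamma> where *: "instance_of w = encode n E \<gamma>" "simple_graph {..<n} E"
      "colored_unit_2_interval_graph {..<n} E \<gamma>"
      using mem unfolding colored_unit_2_interval_recognition_def by blast
    \<comment> \<open>Membership in the language yields only some graph with this code; the
      injectivity of the encoding identifies it with the gadget graph.\<close>
    note inj = encode_inj[OF *(1)[unfolded instance_of_def] simple *(2)]
    show ?thesis using *(3) inj unfolding colored_unit_2_interval_graph_def by simp
  qed
  moreover have "instance_of w \<in> colored_unit_2_interval_recognition_max_degree 6"
    if "colored_unit_2_interval_graph {..<size w} ?E gadgets.color_of"
    unfolding colored_unit_2_interval_recognition_max_degree_def instance_of_def using simple deg that by blast
  moreover have "colored_unit_2_interval_recognition_max_degree 6 \<subseteq> colored_unit_2_interval_recognition"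
    unfolding colored_unit_2_interval_recognition_max_degree_def colored_unit_2_interval_recognition_def by blast
  ultimately show "instance_of w \<in> colored_unit_2_interval_recognition \<longleftrightarrow>
      (\<exists>\<alpha>. cnf.formula_sat (J w) r (var w) (sgn w) \<alpha>)"
    "instance_of w \<in> colored_unit_2_interval_recognition_max_degree 6 \<longleftrightarrow>
      (\<exists>\<alpha>. cnf.formula_sat (J w) r (var w) (sgn w) \<alpha>)"
    unfolding sat[symmetric] by blast+
qed

end

subsection \<open>The tableau as a formula\<close>

text \<open>
  Clause \<open>j\<close> encodes a rule together with the parameters \<open>t\<close>, \<open>i\<close>, \<open>i'\<close>. Short clauses are padded by
  repeating the last literal. If the guard of the rule fails, the clause becomes a fact that belongs to
  the tableau anyway.
\<close>

definition lit_at :: "rule \<Rightarrow> nat \<Rightarrow> bool \<times> atom \<times> time \<times> place" where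
  "lit_at ru k = snd ru ! min k (length (snd ru) - 1)"

text \<open>A number with three digits: atom, place and time. All places are below
  \<open>2 * T + 4\<close>, because the right neighbor of the last index may occur; the time is the
  leading digit and needs no bound.\<close>

definition lit_var :: "(atom \<Rightarrow> nat) \<Rightarrow> nat \<Rightarrow> nat \<Rightarrow> bool \<times> atom \<times> time \<times> place \<Rightarrow> nat \<Rightarrow> nat \<Rightarrow> nat \<Rightarrow> nat" where
  "lit_var code NA T l t i j = code (fst (snd l)) +
     NA * (time_val T (fst (snd (snd l))) t * (2 * T + 4) + place_val (T + 1) (snd (snd (snd l))) i j)"

definition var_of :: "rule list \<Rightarrow> (atom \<Rightarrow> nat) \<Rightarrow> nat \<Rightarrow> bool list \<Rightarrow> nat \<Rightarrow> nat \<Rightarrow> nat \<Rightarrow> nat \<Rightarrow> nat \<Rightarrow> nat \<Rightarrow> nat" where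
  "var_of rs code NA x p T c k e m = (if guard_holds x p (T + 1) (fst (rs ! c)) (e mod (2 * T + 3)) (e div (2 * T + 3))
     then lit_var code NA T (lit_at (rs ! c) k) m (e mod (2 * T + 3)) (e div (2 * T + 3)) else code (Scan 0 []))"

text \<open>The clause number is split, from its lowest digit, into the number of the rule, the time
  and the two indices.\<close>

definition formula_var :: "rule list \<Rightarrow> (atom \<Rightarrow> nat) \<Rightarrow> nat \<Rightarrow> bool list \<Rightarrow> nat \<Rightarrow> nat \<Rightarrow> nat \<Rightarrow> nat" where
  "formula_var rs code NA x p T a = (let j = a div 4; d = j div length rs in
     var_of rs code NA x p T (j mod length rs) (a mod 4) (d div (2 * T + 3)) (d mod (2 * T + 3)))"

definition sgn_of :: "rule list \<Rightarrow> bool list \<Rightarrow> nat \<Rightarrow> nat \<Rightarrow> nat \<Rightarrow> nat \<Rightarrow> nat \<Rightarrow> bool" where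
  "sgn_of rs x p T c k e =
     (guard_holds x p (T + 1) (fst (rs ! c)) (e mod (2 * T + 3)) (e div (2 * T + 3)) \<longrightarrow> fst (lit_at (rs ! c) k))"

definition formula_sgn :: "rule list \<Rightarrow> bool list \<Rightarrow> nat \<Rightarrow> nat \<Rightarrow> nat \<Rightarrow> bool" where
  "formula_sgn rs x p T a = (let j = a div 4; d = j div length rs in
     sgn_of rs x p T (j mod length rs) (a mod 4) (d div (2 * T + 3)))"

definition formula_size :: "rule list \<Rightarrow> nat \<Rightarrow> nat" where
  "formula_size rs T = length rs * ((2 * T + 3) * ((2 * T + 3) * (2 * T + 3)))"

lemma definable_input_symbol: "definable a \<Longrightarrow> definable (\<lambda>w s. input_symbol w (a w s))"
  unfolding input_symbol_def by (intro definable_intros)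

lemma definable_guard:
  assumes "definable p" "definable h" "definable a" "definable b"
  shows "definable_pred (\<lambda>w s. guard_holds w (p w s) (h w s) gd (a w s) (b w s))"
  by (cases gd; simp only: guard_holds.simps; intro definable_intros definable_input_symbol assms)

lemma definable_lit_var:
  assumes "definable T" "definable a" "definable b" "definable c"
  shows "definable (\<lambda>w s. lit_var code NA (T w s) l (a w s) (b w s) (c w s))"
proof -
  have "definable (\<lambda>w s. time_val (T w s) tm (a w s))" for tm
    by (cases tm; simp only: time_val.simps; intro definable_intros assms)
  moreover have "definable (\<lambda>w s. place_val (T w s + 1) pl (b w s) (c w s))" for pl
    by (cases pl; simp only: place_val.simps; intro definable_intros assms)
  ultimately show ?thesis unfolding lit_var_def by (intro definable_intros assms)
qed

text \<open>Rules and atom codes are no objects of expressions, but there are only finitely many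
  combinations of a rule and a literal position; for each of them the value is arithmetic in the
  parameters.\<close>

lemma definable_formula_var:
  assumes T: "definable (\<lambda>w s. T w)" and p: "definable (\<lambda>w s. p w)" and rs: "rs \<noteq> []"
  shows "definable (\<lambda>w s. formula_var rs code NA w (p w) (T w) (s 0))"
proof -
  let ?d = "\<lambda>s :: nat \<Rightarrow> nat. s 0 div 4 div length rs"
  let ?f = "\<lambda>c k w s. var_of rs code NA w (p w) (T w) c k (?d s div (2 * T w + 3)) (?d s mod (2 * T w + 3))"
  have 1: "definable (?f c k)" for c k
    unfolding var_of_def
    by (intro definable_if definable_guard definable_lit_var definable_intros T p)
  have 2: "definable (\<lambda>w s. if s 0 mod 4 < 4 then ?f c (s 0 mod 4) w s else 0)" for c
    by (rule definable_cases[where h = "\<lambda>w s. s 0 mod 4" and f = "?f c"]) (intro definable_intros 1)+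
  have "definable (\<lambda>w s. if s 0 div 4 mod length rs < length rs then
      (\<lambda>c w s. if s 0 mod 4 < 4 then ?f c (s 0 mod 4) w s else 0) (s 0 div 4 mod length rs) w s else 0)"
    by (rule definable_cases) (intro definable_intros 2)+
  then show ?thesis using rs unfolding formula_var_def Let_def by simp
qed

lemma definable_formula_sgn:
  assumes T: "definable (\<lambda>w s. T w)" and p: "definable (\<lambda>w s. p w)" and rs: "rs \<noteq> []"
  shows "definable_pred (\<lambda>w s. formula_sgn rs w (p w) (T w) (s 0))"
proof -
  let ?d = "\<lambda>s :: nat \<Rightarrow> nat. s 0 div 4 div length rs"
  let ?f = "\<lambda>c k w s. of_bool (sgn_of rs w (p w) (T w) c k (?d s div (2 * T w + 3))) :: nat"
  have 1: "definable (?f c k)" for c k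
    unfolding sgn_of_def
    by (intro definable_of_bool definable_pred_imp definable_guard definable_intros T p)
  have 2: "definable (\<lambda>w s. if s 0 mod 4 < 4 then ?f c (s 0 mod 4) w s else 0)" for c
    by (rule definable_cases[where h = "\<lambda>w s. s 0 mod 4" and f = "?f c"]) (intro definable_intros 1)+
  have "definable (\<lambda>w s. if s 0 div 4 mod length rs < length rs then
      (\<lambda>c w s. if s 0 mod 4 < 4 then ?f c (s 0 mod 4) w s else 0) (s 0 div 4 mod length rs) w s else 0)"
    by (rule definable_cases) (intro definable_intros 2)+
  then show ?thesis using rs unfolding formula_sgn_def Let_def definable_pred_def by simp
qed

context tableau
begin

lemma place_less: "i < range \<Longrightarrow> j < range \<Longrightarrow> place_val home pl i j < 2 * T + 4"
  by (cases pl) (auto simp: range_def home_def)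

text \<open>Both sides use the same triples of atom, time and place. An assignment becomes a model
  by encoding triples; a model becomes an assignment by decoding, which works because
  \<open>code\<close> is injective on the atoms in use.\<close>

lemma formula_iff_model:
  assumes rs: "set rs = rules M"
    and code: "inj_on code A" "\<And>a. a \<in> A \<Longrightarrow> code a < NA"
    and A: "Scan 0 [] \<in> A" "\<And>ru l. ru \<in> rules M \<Longrightarrow> l \<in> set (snd ru) \<Longrightarrow> fst (snd l) \<in> A"
  shows "(\<exists>\<beta>. cnf.formula_sat (formula_size rs T) 4 (formula_var rs code NA x p T) (formula_sgn rs x p T) \<beta>)
    \<longleftrightarrow> (\<exists>\<alpha>. model \<alpha>)"
proof -
  interpret F: cnf "formula_size rs T" 4 "formula_var rs code NA x p T" "formula_sgn rs x p T"
    by standard simp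
  let ?W = "2 * T + 3" and ?V = "2 * T + 4"
  have W: "range = ?W" "home = T + 1" by (simp_all add: range_def home_def)
  have ne: "ls \<noteq> []" "length ls \<le> 4" if "(gd, ls) \<in> rules M" for gd ls
    using rule_length[OF that] by auto
  define place :: "atom \<Rightarrow> nat \<Rightarrow> nat \<Rightarrow> nat" where "place a t i = code a + NA * (t * ?V + i)" for a t i
  have var: "formula_var rs code NA x p T (j * 4 + k) =
      (let d = j div length rs; ru = rs ! (j mod length rs); e = d div ?W; i = e mod ?W; i' = e div ?W in
       if guard_holds x p home (fst ru) i i' then (case lit_at ru k of (b, a, tm, pl) \<Rightarrow>
         place a (time_val T tm (d mod ?W)) (place_val home pl i i')) else place (Scan 0 []) 0 0)"
    "formula_sgn rs x p T (j * 4 + k) =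
      (let d = j div length rs; ru = rs ! (j mod length rs); e = d div ?W; i = e mod ?W; i' = e div ?W in
       guard_holds x p home (fst ru) i i' \<longrightarrow> fst (lit_at ru k))" if "k < 4" for j k
    using that unfolding formula_var_def formula_sgn_def var_of_def sgn_of_def lit_var_def place_def W Let_def
    by (auto split: prod.splits)
  show ?thesis
  proof
    assume "\<exists>\<beta>. F.formula_sat \<beta>"
    then obtain \<beta> where \<beta>: "\<And>j. j < formula_size rs T \<Longrightarrow>
        \<exists>k<4. \<beta> (formula_var rs code NA x p T (j * 4 + k)) = formula_sgn rs x p T (j * 4 + k)"
      unfolding F.formula_sat_def by blast
    have "rule_holds (\<lambda>a t i. \<beta> (place a t i)) ru t i i'"
      if ru: "ru \<in> rules M" and lt: "t < ?W" "i < ?W" "i' < ?W" for ru t i i'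
      unfolding rule_holds_def
    proof
      assume guard: "guard_holds x p home (fst ru) i i'"
      obtain c where c: "c < length rs" "rs ! c = ru" using ru rs by (metis in_set_conv_nth)
      let ?d = "t + ?W * (i + ?W * i')"
      let ?j = "c + length rs * ?d"
      have digits: "(b + n * d) mod n = b" "(b + n * d) div n = d" if "b < n" for b n d :: nat
        using that by auto
      note dec = digits[OF c(1), of ?d] and dec' = digits[OF lt(1), of "i + ?W * i'"]
        and dec'' = digits[OF lt(2), of i']
      have "i + ?W * i' < ?W * ?W" using index_bound[OF lt(3,2)] by (simp add: algebra_simps)
      then have "Suc (i + ?W * i') \<le> ?W * ?W" by simp
      then have "?W * Suc (i + ?W * i') \<le> ?W * (?W * ?W)" by (rule mult_le_mono2)
      moreover have "?d < ?W * Suc (i + ?W * i')" using lt(1) by simp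
      ultimately have "Suc ?d \<le> ?W * (?W * ?W)" by linarith
      then have "length rs * Suc ?d \<le> formula_size rs T" unfolding formula_size_def by (rule mult_le_mono2)
      moreover have "?j < length rs * Suc ?d" using c(1) by simp
      ultimately have "?j < formula_size rs T" by linarith
      from \<beta>[OF this] obtain k where k: "k < 4"
        "\<beta> (formula_var rs code NA x p T (?j * 4 + k)) = formula_sgn rs x p T (?j * 4 + k)" by blast
      obtain b a tm pl where l: "lit_at ru k = (b, a, tm, pl)" by (metis prod_cases4)
      have "\<beta> (place a (time_val T tm t) (place_val home pl i i')) = b"
        using k(2) guard unfolding var[OF k(1)] Let_def dec dec' dec'' c(2) l by simp
      moreover have "0 < length (snd ru)" using ne(1)[of "fst ru" "snd ru"] ru by simp
      then have "min k (length (snd ru) - 1) < length (snd ru)" by linarith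
      then have "lit_at ru k \<in> set (snd ru)" unfolding lit_at_def by (rule nth_mem)
      ultimately show "\<exists>(b, a, tm, pl)\<in>set (snd ru).
          \<beta> (place a (time_val T tm t) (place_val home pl i i')) = b" unfolding l by blast
    qed
    then have "model (\<lambda>a t i. \<beta> (place a t i))" unfolding model_def W by blast
    then show "\<exists>\<alpha>. model \<alpha>" by blast
  next
    assume "\<exists>\<alpha>. model \<alpha>"
    then obtain \<alpha> where \<alpha>: "model \<alpha>" ..
    define \<beta> where "\<beta> v = \<alpha> (inv_into A code (v mod NA)) (v div NA div ?V) (v div NA mod ?V)" for v
    have \<beta>: "\<beta> (place a t i) = \<alpha> a t i" if "a \<in> A" "i < ?V" for a t i
    proof -
      have "place a t i mod NA = code a" "place a t i div NA = t * ?V + i"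
        using code(2)[OF that(1)] unfolding place_def by auto
      moreover have "(t * ?V + i) div ?V = t" "(t * ?V + i) mod ?V = i" using that(2) by auto
      ultimately show ?thesis unfolding \<beta>_def using inv_into_f_f[OF code(1) that(1)] by simp
    qed
    have "\<exists>k<4. \<beta> (formula_var rs code NA x p T (j * 4 + k)) = formula_sgn rs x p T (j * 4 + k)"
      if j: "j < formula_size rs T" for j
    proof -
      let ?d = "j div length rs" and ?ru = "rs ! (j mod length rs)"
      let ?e = "?d div ?W"
      let ?i = "?e mod ?W" and ?i' = "?e div ?W"
      have "rs \<noteq> []" using j by (auto simp: formula_size_def)
      then have ru: "?ru \<in> rules M" using rs by (metis length_greater_0_conv mod_less_divisor nth_mem)
      have "?d < ?W * (?W * ?W)" using j unfolding formula_size_def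
        by (simp add: less_mult_imp_div_less mult.commute)
      then have "?e < ?W * ?W" by (simp add: less_mult_imp_div_less mult.commute)
      then have i': "?i' < ?W" by (simp add: less_mult_imp_div_less)
      have i: "?i < ?W" "?d mod ?W < ?W" by simp_all
      show ?thesis
      proof (cases "guard_holds x p home (fst ?ru) ?i ?i'")
        case True
        have "rule_holds \<alpha> ?ru (?d mod ?W) ?i ?i'"
          using modelD[OF \<alpha> ru] i i' unfolding W by blast
        then obtain l where l: "l \<in> set (snd ?ru)"
          "\<alpha> (fst (snd l)) (time_val T (fst (snd (snd l))) (?d mod ?W))
             (place_val home (snd (snd (snd l))) ?i ?i') = fst l"
          using True unfolding rule_holds_def by (auto split: prod.splits)
        obtain k where k: "k < length (snd ?ru)" "snd ?ru ! k = l" using l(1) by (metis in_set_conv_nth)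
        have k4: "k < 4" using k(1) ne[of "fst ?ru" "snd ?ru"] ru by simp
        have "min k (length (snd ?ru) - 1) = k" using k(1) by linarith
        then have at: "lit_at ?ru k = l" unfolding lit_at_def using k(2) by simp
        have "place_val home (snd (snd (snd l))) ?i ?i' < ?V" using place_less i(1) i' unfolding W by blast
        then have "\<beta> (place (fst (snd l)) (time_val T (fst (snd (snd l))) (?d mod ?W))
             (place_val home (snd (snd (snd l))) ?i ?i')) = fst l"
          using \<beta>[OF A(2)[OF ru l(1)]] l(2) by simp
        then show ?thesis using True k4 unfolding ex_simps
          by (intro exI[of _ k]) (simp add: var[OF k4] Let_def at case_prod_beta)
      next
        case False
        have "(Always, [(True, Scan 0 [], Start, Origin)]) \<in> rules M"
          by (simp add: rules_def boundary_rules_def)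
        from modelD[OF \<alpha> this range_pos range_pos range_pos] have "\<alpha> (Scan 0 []) 0 0"
          by (simp add: rule_holds_def)
        then have "\<beta> (place (Scan 0 []) 0 0)" using \<beta>[OF A(1)] by simp
        then show ?thesis using False by (intro exI[of _ 0]) (simp add: var[of 0, simplified] Let_def)
      qed
    qed
    then show "\<exists>\<beta>. F.formula_sat \<beta>" unfolding F.formula_sat_def by blast
  qed
qed

text \<open>A halted configuration does not change any more, so the answer can be inspected at time
  \<open>T\<close>. The bit \<open>False\<close> is written as symbol 1.\<close>

lemma accepting_iff:
  assumes "(step M ^^ t) (initial M (pair_code x u)) = (nstates M, tps)" "t \<le> T"
    "fst (tps ! 1) = contents [b]"
  shows "fst (tapes_at u T ! 1) 0 \<noteq> 1 \<longleftrightarrow> b"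
proof -
  have "(step M ^^ d) (nstates M, tps) = (nstates M, tps)" for d
    by (induction d) (auto simp: step_def)
  moreover have "(step M ^^ T) (initial M (pair_code x u)) =
      (step M ^^ (T - t)) ((step M ^^ t) (initial M (pair_code x u)))"
    using assms(2) by (simp flip: funpow_add o_apply[of "step M ^^ _" "step M ^^ _"])
  ultimately have "tapes_at u T = tps" unfolding tapes_at_def config_at_def assms(1) by simp
  then show ?thesis using assms(3) by (simp add: contents_def)
qed

end

text \<open>One reduction serves both problems, since its instances have degree at most 6
  anyway.\<close>

lemma NP_reducible:
  assumes "in_NP K"
  shows "\<exists>f. poly_time f \<and> (\<forall>w. (w \<in> K \<longleftrightarrow> f w \<in> colored_unit_2_interval_recognition) \<and>
    (w \<in> K \<longleftrightarrow> f w \<in> colored_unit_2_interval_recognition_max_degree 6))"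
proof -
  obtain R q M pR where K: "\<And>x. x \<in> K \<longleftrightarrow> (\<exists>u. length u \<le> poly q (length x) \<and> pair_code x u \<in> R)"
    and M: "wf_machine M" "computes_in_time M (\<lambda>w. [w \<in> R]) (poly pR)"
    using assms unfolding in_NP_def in_P_def poly_time_def by blast
  define p where "p x = poly q (length x)" for x :: "bool list"
  \<comment> \<open>The last summand is the running time of the verifier on the longest relevant
    word; the others make sure that this word fits on the tape segment of the tableau.\<close>
  define T where "T x = 2 * length x + 1 + p x + poly pR (2 * length x + 1 + p x)" for x
  obtain rs where rs: "set rs = rules M" using finite_list[OF finite_rules] by blast
  have "(Always, [(True, Scan 0 [], Start, Origin)]) \<in> rules M" by (simp add: rules_def boundary_rules_def)
  then have "rs \<noteq> []" using rs by auto
  let ?A = "insert (Scan 0 []) ((\<lambda>l. fst (snd l)) ` (\<Union>ru\<in>rules M. set (snd ru)))"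
  have "finite ?A" using finite_rules by simp
  then obtain code where code: "bij_betw code ?A {0..<card ?A}" using ex_bij_betw_finite_nat by blast
  have tab: "tableau M x (p x) (T x)" for x
    by standard (use M(1) in \<open>simp_all add: T_def\<close>)
  have defp: "definable (\<lambda>w s. p w)" unfolding p_def by (intro definable_poly definable_len)
  have defT: "definable (\<lambda>w s. T w)"
    unfolding T_def by (intro definable_intros definable_poly defp)
  interpret D: definable_cnf "\<lambda>x. formula_size rs (T x)" 4 "\<lambda>x. formula_var rs code (card ?A) x (p x) (T x)"
    "\<lambda>x. formula_sgn rs x (p x) (T x)"
  proof
    show "definable (\<lambda>w s. formula_size rs (T w))"
      unfolding formula_size_def by (intro definable_intros defT)
    show "definable (\<lambda>w s. formula_var rs code (card ?A) w (p w) (T w) (s 0))"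
      by (rule definable_formula_var[OF defT defp \<open>rs \<noteq> []\<close>])
    show "definable_pred (\<lambda>w s. formula_sgn rs w (p w) (T w) (s 0))"
      by (rule definable_formula_sgn[OF defT defp \<open>rs \<noteq> []\<close>])
  qed simp
  have "x \<in> K \<longleftrightarrow> (\<exists>\<alpha>. cnf.formula_sat (formula_size rs (T x)) 4
      (formula_var rs code (card ?A) x (p x) (T x)) (formula_sgn rs x (p x) (T x)) \<alpha>)" for x
  proof -
    interpret tableau M x "p x" "T x" by (rule tab)
    have "fst (tapes_at u (T x) ! 1) 0 \<noteq> 1 \<longleftrightarrow> pair_code x u \<in> R" if u: "length u \<le> p x" for u
    proof -
      obtain t tps where t: "t \<le> poly pR (length (pair_code x u))"
        "(step M ^^ t) (initial M (pair_code x u)) = (nstates M, tps)"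
        "fst (tps ! 1) = contents [pair_code x u \<in> R]"
        using M(2) unfolding computes_in_time_def by blast
      have "length (concat (map (\<lambda>b. [True, b]) x)) = 2 * length x" by (induction x) auto
      then have "length (pair_code x u) \<le> 2 * length x + 1 + p x" using u by (simp add: pair_code_def)
      then have "t \<le> T x" using t(1) poly_nat_mono[of _ "2 * length x + 1 + p x" pR]
        unfolding T_def by (meson le_trans trans_le_add2)
      then show ?thesis using accepting_iff[OF t(2) _ t(3)] by blast
    qed
    then have "x \<in> K \<longleftrightarrow> (\<exists>\<alpha>. model \<alpha>)" unfolding K model_iff_accepting p_def[symmetric] by blast
    also have "\<dots> \<longleftrightarrow> (\<exists>\<alpha>. cnf.formula_sat (formula_size rs (T x)) 4
      (formula_var rs code (card ?A) x (p x) (T x)) (formula_sgn rs x (p x) (T x)) \<alpha>)"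
    proof (rule formula_iff_model[OF rs, symmetric])
      show "inj_on code ?A" using code by (simp add: bij_betw_def)
      show "code a < card ?A" if "a \<in> ?A" for a
        using bij_betw_apply[OF code that] by (simp only: atLeastLessThan_iff)
      show "fst (snd l) \<in> ?A" if "ru \<in> rules M" "l \<in> set (snd ru)" for ru l using that by blast
    qed simp
    finally show ?thesis .
  qed
  then have "(x \<in> K \<longleftrightarrow> D.instance_of x \<in> colored_unit_2_interval_recognition) \<and>
      (x \<in> K \<longleftrightarrow> D.instance_of x \<in> colored_unit_2_interval_recognition_max_degree 6)" for x
    unfolding D.instance_iff by simp
  then show ?thesis by (intro exI[of _ D.instance_of] conjI D.poly_time_instance allI) blast+
qed

theorem theorem2:
  shows "NP_complete colored_unit_2_interval_recognition \<and>
    NP_complete (colored_unit_2_interval_recognition_max_degree 6)"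
proof -
  have hard: "NP_hard colored_unit_2_interval_recognition"
    "NP_hard (colored_unit_2_interval_recognition_max_degree 6)"
    unfolding NP_hard_def poly_reducible_def using NP_reducible by fast+
  show ?thesis unfolding NP_complete_def by (intro conjI in_NP_languages hard)
qed

end
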